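(* Let $\mathcal{C}$ be a small category satisfying the amalgamation property and in which all arrows are strict monomorphisms. Then the category $\mathcal{C}_e$ (defined in the context) is (weakly) equivalent to the atomic completion $\mathcal{C}_{at}$ of $\mathcal{C}$.
   Context: Amalgamation property: for all $f:a\to b$, $g:a\to c$ there are $f':b\to d$, $g':c\to d$ with $f'f=g'g$. $f:d\to c$ is a strict monomorphism if any $g:e\to c$ such that $hg=kg$ whenever $hf=kf$ factors uniquely through $f$. $J_{at}$ is the atomic topology on $\mathcal{C}^{\mathrm{op}}$ (covering sieves = non-empty sieves), $\mathbf{a}:[\mathcal{C},\mathbf{Set}]\to\mathbf{Sh}(\mathcal{C}^{\mathrm{op}},J_{at})$ the associated sheaf functor, $y:\mathcal{C}^{\mathrm{op}}\to[\mathcal{C},\mathbf{Set}]$ the Yoneda embedding. The atomic completion $\mathcal{C}_{at}$ is the dual of the full subcategory of $\mathbf{Sh}(\mathcal{C}^{\mathrm{op}},J_{at})$ on its atoms (non-zero objects with no proper non-zero subobjects). An equivalence relation $R$ on $yc$ in $[\mathcal{C},\mathbf{Set}]$ assigns to each $e\in\mathcal{C}$ an equivalence relation $R_e$ on $\mathrm{Hom}_{\mathcal{C}}(c,e)$, stably under postcomposition; its $J_{at}$-closure $\overline{R}$ is given by $(\chi,\xi)\in\overline{R}_e$ iff $(h\chi,h\xi)\in R_{e'}$ for some $h:e\to e'$; $R$ is $J_{at}$-closed if $R=\overline{R}$. For $R\subseteq P$, $\pi_{R,P}:yc/R\to yc/P$ is the canonical projection. Category $\mathcal{C}_e$. Objects: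 pairs $(c,R)$ with $c\in\mathcal{C}$ and $R$ a $J_{at}$-closed equivalence relation on $yc$. Arrows $(c',R')\to(c,R)$: triples $(P,\alpha,\beta)$, where $P$ is a $J_{at}$-closed equivalence relation on $yc$ containing $R$ and $\langle\alpha,\beta\rangle:Q\rightarrowtail yc/P\times yc'/R'$ is a subobject in $[\mathcal{C},\mathbf{Set}]$ such that $\mathbf{a}(\alpha)$ and $\mathbf{a}(\beta)$ are isomorphisms, modulo the equivalence relation identifying $(P,\alpha,\beta)$ with $(P,\delta,\gamma)$ when $\mathbf{a}(\beta)\circ\mathbf{a}(\alpha)^{-1}=\mathbf{a}(\gamma)\circ\mathbf{a}(\delta)^{-1}$ (equivalently, when, $p_\beta,p_\gamma$ being the projections of the pullback of $\beta$ and $\gamma$ to their domains, $\mathbf{a}(\alpha\circ p_\beta)=\mathbf{a}(\delta\circ p_\gamma)$). The class of $(P,\alpha,\beta)$ represents the arrow $\mathbf{a}(\beta)\circ\mathbf{a}(\alpha)^{-1}\circ\mathbf{a}(\pi_{R,P}):\mathbf{a}(yc/R)\to\mathbf{a}(yc'/R')$ of $\mathbf{Sh}(\mathcal{C}^{\mathrm{op}},J_{at})$. Composition. The composite of $(P,\alpha,\beta):(c',R')\to(c,R)$ and $(P',\alpha',\beta'):(c'',R'')\to(c',R')$, with $\langle\alpha,\beta\rangle:Q\rightarrowtail yc/P\times yc'/R'$ and $\langle\alpha',\beta'\rangle:Q'\rightarrowtail yc'/P'\times yc''/R''$, is the class of the triple $(P'',\alpha'',\beta''):(c'',R'')\to(c,R)$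 constructed as follows in $[\mathcal{C},\mathbf{Set}]$. Let $\tilde{P'}\rightarrowtail yc'/R'\times yc'/R'$ be the equivalence relation on $yc'/R'$ corresponding to $P'$; let $\langle\chi,\xi\rangle:L\to Q\times Q$ be the pullback of $\tilde{P'}$ along $\beta\times\beta$; let $h:H\to yc/R\times yc/R$ be the pullback of $\langle\alpha\chi,\alpha\xi\rangle:L\to yc/P\times yc/P$ along $\pi_{R,P}\times\pi_{R,P}$; let $P_0$ be the pullback along $yc\to yc/R$ of the equivalence relation on $yc/R$ generated by $h$, and $P''$ the $J_{at}$-closure of $P_0$. Let $K$ be the coequalizer of $\alpha\chi,\alpha\xi:L\rightrightarrows yc/P$ and $K'$ the coequalizer of $\chi,\xi:L\rightrightarrows Q$, and let $b_1:yc/P_0\to K$, $b_2:K'\to K$, $b_3:K'\to yc'/P'$ be the arrows induced by $\pi_{R,P}$, $\alpha$, $\beta$ respectively. Let $M$ be the pullback of $b_1$ and $b_2$, with projections $p:M\to yc/P_0$ and $q:M\to K'$; let $W$ be the pullback of $b_3$ and $\alpha'$, with projections $r:W\to K'$ and $x:W\to Q'$; let $N$ be the pullback of $q$ and $r$, with projections $d:N\to M$ and $b:N\to W$. Then $\langle\alpha'',\beta''\rangle$ is the image of the arrow $N\to yc/P''\times yc''/R''$ with components $N\xrightarrow{d}M\xrightarrow{p}yc/P_0\to yc/P''$ and $\beta'\circ x\circ b$. *)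

theory Defs
  imports "HOL-Library.FuncSet"
begin

section \<open>Categories\<close>

record ('o, 'm) cat =
  Obj :: "'o set"
  Arr :: "'m set"
  Dom :: "'m \<Rightarrow> 'o"
  Cod :: "'m \<Rightarrow> 'o"
  Id :: "'o \<Rightarrow> 'm"
  Comp :: "'m \<Rightarrow> 'm \<Rightarrow> 'm" (infixl "\<cdot>\<index>" 70)

definition hom :: "('o, 'm) cat \<Rightarrow> 'o \<Rightarrow> 'o \<Rightarrow> 'm set" where
  "hom C a b = {f \<in> Arr C. Dom C f = a \<and> Cod C f = b}"

locale category =
  fixes C :: "('o, 'm) cat" (structure)
  assumes dom_obj: "f \<in> Arr C \<Longrightarrow> Dom C f \<in> Obj C"
    and cod_obj: "f \<in> Arr C \<Longrightarrow> Cod C f \<in> Obj C"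
    and id_hom: "a \<in> Obj C \<Longrightarrow> Id C a \<in> hom C a a"
    and comp_hom: "f \<in> hom C a b \<Longrightarrow> g \<in> hom C b c \<Longrightarrow> g \<cdot> f \<in> hom C a c"
    and comp_id_right: "f \<in> hom C a b \<Longrightarrow> f \<cdot> Id C a = f"
    and comp_id_left: "f \<in> hom C a b \<Longrightarrow> Id C b \<cdot> f = f"
    and comp_assoc: "f \<in> hom C a b \<Longrightarrow> g \<in> hom C b c \<Longrightarrow> h \<in> hom C c d \<Longrightarrow>
      (h \<cdot> g) \<cdot> f = h \<cdot> (g \<cdot> f)"

definition dual :: "('o, 'm) cat \<Rightarrow> ('o, 'm) cat" where
  "dual C = \<lparr>Obj = Obj C, Arr = Arr C, Dom = Cod C, Cod = Dom C, Id = Id C,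
     Comp = (\<lambda>g f. f \<cdot>\<^bsub>C\<^esub> g)\<rparr>"

definition full_subcat :: "('o, 'm) cat \<Rightarrow> 'o set \<Rightarrow> ('o, 'm) cat" where
  "full_subcat C X = C\<lparr>Obj := Obj C \<inter> X, Arr := {f \<in> Arr C. Dom C f \<in> X \<and> Cod C f \<in> X}\<rparr>"

definition is_iso :: "('o, 'm) cat \<Rightarrow> 'm \<Rightarrow> bool" where
  "is_iso C f \<longleftrightarrow> f \<in> Arr C \<and>
     (\<exists>g \<in> hom C (Cod C f) (Dom C f). g \<cdot>\<^bsub>C\<^esub> f = Id C (Dom C f) \<and> f \<cdot>\<^bsub>C\<^esub> g = Id C (Cod C f))"

definition is_mono :: "('o, 'm) cat \<Rightarrow> 'm \<Rightarrow> bool" where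
  "is_mono C f \<longleftrightarrow> f \<in> Arr C \<and>
     (\<forall>a. \<forall>g \<in> hom C a (Dom C f). \<forall>h \<in> hom C a (Dom C f). f \<cdot>\<^bsub>C\<^esub> g = f \<cdot>\<^bsub>C\<^esub> h \<longrightarrow> g = h)"

definition is_initial :: "('o, 'm) cat \<Rightarrow> 'o \<Rightarrow> bool" where
  "is_initial C z \<longleftrightarrow> z \<in> Obj C \<and> (\<forall>a \<in> Obj C. \<exists>!f. f \<in> hom C z a)"

text \<open>The zero object of a topos is its initial object; subobjects are given by monomorphisms.\<close>

definition is_atom :: "('o, 'm) cat \<Rightarrow> 'o \<Rightarrow> bool" where
  "is_atom C a \<longleftrightarrow> a \<in> Obj C \<and> \<not> is_initial C a \<and>
     (\<forall>f. is_mono C f \<and> Cod C f = a \<longrightarrow> is_iso C f \<or> is_initial C (Dom C f))"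

definition is_functor ::
  "('o, 'm) cat \<Rightarrow> ('p, 'n) cat \<Rightarrow> ('o \<Rightarrow> 'p) \<Rightarrow> ('m \<Rightarrow> 'n) \<Rightarrow> bool" where
  "is_functor A B Fo Fa \<longleftrightarrow>
     (\<forall>a \<in> Obj A. Fo a \<in> Obj B) \<and>
     (\<forall>f \<in> Arr A. Fa f \<in> hom B (Fo (Dom A f)) (Fo (Cod A f))) \<and>
     (\<forall>a \<in> Obj A. Fa (Id A a) = Id B (Fo a)) \<and>
     (\<forall>f \<in> Arr A. \<forall>g \<in> Arr A. Cod A f = Dom A g \<longrightarrow> Fa (g \<cdot>\<^bsub>A\<^esub> f) = Fa g \<cdot>\<^bsub>B\<^esub> Fa f)"

text \<open>Weak equivalence: a fully faithful, essentially surjective functor.\<close>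

definition weakly_equivalent :: "('o, 'm) cat \<Rightarrow> ('p, 'n) cat \<Rightarrow> bool" where
  "weakly_equivalent A B \<longleftrightarrow> category A \<and> category B \<and>
     (\<exists>Fo Fa. is_functor A B Fo Fa \<and>
        (\<forall>a \<in> Obj A. \<forall>b \<in> Obj A. bij_betw Fa (hom A a b) (hom B (Fo a) (Fo b))) \<and>
        (\<forall>b \<in> Obj B. \<exists>a \<in> Obj A. \<exists>f \<in> hom B (Fo a) b. is_iso B f))"

definition amalgamation_property :: "('o, 'm) cat \<Rightarrow> bool" where
  "amalgamation_property C \<longleftrightarrow>
     (\<forall>f \<in> Arr C. \<forall>g \<in> Arr C. Dom C f = Dom C g \<longrightarrow>
        (\<exists>d. \<exists>f' \<in> hom C (Cod C f) d. \<exists>g' \<in> hom C (Cod C g) d. f' \<cdot>\<^bsub>C\<^esub> f = g' \<cdot>\<^bsub>C\<^esub> g))"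

definition strict_monomorphism :: "('o, 'm) cat \<Rightarrow> 'm \<Rightarrow> bool" where
  "strict_monomorphism C f \<longleftrightarrow> f \<in> Arr C \<and>
     (\<forall>g \<in> Arr C. Cod C g = Cod C f \<and>
        (\<forall>a. \<forall>h \<in> hom C (Cod C f) a. \<forall>k \<in> hom C (Cod C f) a.
           h \<cdot>\<^bsub>C\<^esub> f = k \<cdot>\<^bsub>C\<^esub> f \<longrightarrow> h \<cdot>\<^bsub>C\<^esub> g = k \<cdot>\<^bsub>C\<^esub> g) \<longrightarrow>
        (\<exists>!u. u \<in> hom C (Dom C g) (Dom C f) \<and> f \<cdot>\<^bsub>C\<^esub> u = g))"


section \<open>Set-valued functors\<close>

text \<open>
  Functors from \<open>C\<close> to sets, with elements drawn from a type \<open>'v\<close>. The functors of the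
  construction below live over different types \<open>'v\<close>, so natural transformations are
  families of functions between possibly different types.
\<close>

record ('o, 'm, 'v) setfun =
  Fob :: "'o \<Rightarrow> 'v set"
  Fmap :: "'m \<Rightarrow> 'v \<Rightarrow> 'v"

definition set_functor :: "('o, 'm) cat \<Rightarrow> ('o, 'm, 'v) setfun \<Rightarrow> bool" where
  "set_functor C F \<longleftrightarrow>
     (\<forall>f \<in> Arr C. Fmap F f \<in> Fob F (Dom C f) \<rightarrow> Fob F (Cod C f)) \<and>
     (\<forall>a \<in> Obj C. \<forall>x \<in> Fob F a. Fmap F (Id C a) x = x) \<and>
     (\<forall>f \<in> Arr C. \<forall>g \<in> Arr C. Cod C f = Dom C g \<longrightarrow>
        (\<forall>x \<in> Fob F (Dom C f). Fmap F (g \<cdot>\<^bsub>C\<^esub> f) x = Fmap F g (Fmap F f x)))"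

definition nat_trans :: "('o, 'm) cat \<Rightarrow> ('o, 'm, 'v) setfun \<Rightarrow> ('o, 'm, 'w) setfun \<Rightarrow>
    ('o \<Rightarrow> 'v \<Rightarrow> 'w) \<Rightarrow> bool" where
  "nat_trans C F G \<eta> \<longleftrightarrow>
     (\<forall>a \<in> Obj C. \<eta> a \<in> Fob F a \<rightarrow> Fob G a) \<and>
     (\<forall>f \<in> Arr C. \<forall>x \<in> Fob F (Dom C f).
        \<eta> (Cod C f) (Fmap F f x) = Fmap G f (\<eta> (Dom C f) x))"

definition nat_iso :: "('o, 'm) cat \<Rightarrow> ('o, 'm, 'v) setfun \<Rightarrow> ('o, 'm, 'w) setfun \<Rightarrow>
    ('o \<Rightarrow> 'v \<Rightarrow> 'w) \<Rightarrow> bool" where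
  "nat_iso C F G \<eta> \<longleftrightarrow> nat_trans C F G \<eta> \<and>
     (\<exists>\<theta>. nat_trans C G F \<theta> \<and>
        (\<forall>a \<in> Obj C. (\<forall>x \<in> Fob F a. \<theta> a (\<eta> a x) = x) \<and> (\<forall>y \<in> Fob G a. \<eta> a (\<theta> a y) = y)))"

definition yoneda :: "('o, 'm) cat \<Rightarrow> 'o \<Rightarrow> ('o, 'm, 'm) setfun" where
  "yoneda C c = \<lparr>Fob = hom C c, Fmap = (\<lambda>f g. f \<cdot>\<^bsub>C\<^esub> g)\<rparr>"

definition prod_fun ::
  "('o, 'm, 'v) setfun \<Rightarrow> ('o, 'm, 'w) setfun \<Rightarrow> ('o, 'm, 'v \<times> 'w) setfun" where
  "prod_fun F G = \<lparr>Fob = (\<lambda>e. Fob F e \<times> Fob G e), Fmap = (\<lambda>f. map_prod (Fmap F f) (Fmap G f))\<rparr>"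

definition pullback :: "('o, 'm, 'v) setfun \<Rightarrow> ('o, 'm, 'w) setfun \<Rightarrow>
    ('o \<Rightarrow> 'v \<Rightarrow> 'z) \<Rightarrow> ('o \<Rightarrow> 'w \<Rightarrow> 'z) \<Rightarrow> ('o, 'm, 'v \<times> 'w) setfun" where
  "pullback F G \<phi> \<psi> =
     \<lparr>Fob = (\<lambda>e. {(x, y). x \<in> Fob F e \<and> y \<in> Fob G e \<and> \<phi> e x = \<psi> e y}),
      Fmap = (\<lambda>f. map_prod (Fmap F f) (Fmap G f))\<rparr>"

definition subfunctor ::
  "('o, 'm) cat \<Rightarrow> ('o, 'm, 'v) setfun \<Rightarrow> ('o \<Rightarrow> 'v set) \<Rightarrow> bool" where
  "subfunctor C F S \<longleftrightarrow>
     (\<forall>e \<in> Obj C. S e \<subseteq> Fob F e) \<and> (\<forall>e. e \<notin> Obj C \<longrightarrow> S e = {}) \<and>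
     (\<forall>f \<in> Arr C. \<forall>x \<in> S (Dom C f). Fmap F f x \<in> S (Cod C f))"

definition sub_fun ::
  "('o, 'm, 'v) setfun \<Rightarrow> ('o \<Rightarrow> 'v set) \<Rightarrow> ('o, 'm, 'v) setfun" where
  "sub_fun F S = \<lparr>Fob = S, Fmap = Fmap F\<rparr>"


section \<open>Equivalence relations and quotients\<close>

definition eqrel ::
  "('o, 'm) cat \<Rightarrow> ('o, 'm, 'v) setfun \<Rightarrow> ('o \<Rightarrow> ('v \<times> 'v) set) \<Rightarrow> bool" where
  "eqrel C F R \<longleftrightarrow>
     (\<forall>e \<in> Obj C. equiv (Fob F e) (R e)) \<and> (\<forall>e. e \<notin> Obj C \<longrightarrow> R e = {}) \<and>
     (\<forall>f \<in> Arr C. \<forall>(x, y) \<in> R (Dom C f). (Fmap F f x, Fmap F f y) \<in> R (Cod C f))"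

definition eqrel_generated :: "('o, 'm) cat \<Rightarrow> ('o, 'm, 'v) setfun \<Rightarrow>
    ('o \<Rightarrow> ('v \<times> 'v) set) \<Rightarrow> 'o \<Rightarrow> ('v \<times> 'v) set" where
  "eqrel_generated C F S e =
     {(x, y). e \<in> Obj C \<and> x \<in> Fob F e \<and> y \<in> Fob F e \<and>
        (\<forall>R. eqrel C F R \<and> (\<forall>e' \<in> Obj C. S e' \<subseteq> R e') \<longrightarrow> (x, y) \<in> R e)}"

definition quot :: "('o, 'm) cat \<Rightarrow> ('o, 'm, 'v) setfun \<Rightarrow> ('o \<Rightarrow> ('v \<times> 'v) set) \<Rightarrow>
    ('o, 'm, 'v set) setfun" where
  "quot C F R = \<lparr>Fob = (\<lambda>e. Fob F e // R e), Fmap = (\<lambda>f X. R (Cod C f) `` (Fmap F f ` X))\<rparr>"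

definition proj :: "('o \<Rightarrow> ('v \<times> 'v) set) \<Rightarrow> 'o \<Rightarrow> 'v \<Rightarrow> 'v set" where
  "proj R e x = R e `` {x}"

text \<open>The arrow out of a quotient induced by an arrow which is constant on the classes.\<close>

definition induced :: "('o \<Rightarrow> 'v \<Rightarrow> 'w) \<Rightarrow> 'o \<Rightarrow> 'v set \<Rightarrow> 'w" where
  "induced \<phi> e X = the_elem (\<phi> e ` X)"

text \<open>The canonical projection from the quotient by \<open>R\<close> to the quotient by a larger \<open>P\<close>;
  it does not depend on \<open>R\<close> as a function on classes.\<close>

definition quot_proj :: "('o \<Rightarrow> ('v \<times> 'v) set) \<Rightarrow> 'o \<Rightarrow> 'v set \<Rightarrow> 'v set" where
  "quot_proj P = induced (proj P)"

definition coeq_rel :: "('o, 'm) cat \<Rightarrow> ('o, 'm, 'l) setfun \<Rightarrow> ('o, 'm, 'v) setfun \<Rightarrow>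
    ('o \<Rightarrow> 'l \<Rightarrow> 'v) \<Rightarrow> ('o \<Rightarrow> 'l \<Rightarrow> 'v) \<Rightarrow> 'o \<Rightarrow> ('v \<times> 'v) set" where
  "coeq_rel C L F \<phi> \<psi> = eqrel_generated C F (\<lambda>e. (\<lambda>l. (\<phi> e l, \<psi> e l)) ` Fob L e)"

definition coequalizer :: "('o, 'm) cat \<Rightarrow> ('o, 'm, 'l) setfun \<Rightarrow> ('o, 'm, 'v) setfun \<Rightarrow>
    ('o \<Rightarrow> 'l \<Rightarrow> 'v) \<Rightarrow> ('o \<Rightarrow> 'l \<Rightarrow> 'v) \<Rightarrow> ('o, 'm, 'v set) setfun" where
  "coequalizer C L F \<phi> \<psi> = quot C F (coeq_rel C L F \<phi> \<psi>)"

definition at_closure :: "('o, 'm) cat \<Rightarrow> ('o, 'm, 'v) setfun \<Rightarrow>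
    ('o \<Rightarrow> ('v \<times> 'v) set) \<Rightarrow> 'o \<Rightarrow> ('v \<times> 'v) set" where
  "at_closure C F R e =
     {(x, y). x \<in> Fob F e \<and> y \<in> Fob F e \<and>
        (\<exists>h \<in> Arr C. Dom C h = e \<and> (Fmap F h x, Fmap F h y) \<in> R (Cod C h))}"

definition closed_eqrel ::
  "('o, 'm) cat \<Rightarrow> ('o, 'm, 'v) setfun \<Rightarrow> ('o \<Rightarrow> ('v \<times> 'v) set) \<Rightarrow> bool" where
  "closed_eqrel C F R \<longleftrightarrow> eqrel C F R \<and> at_closure C F R = R"


section \<open>Sheaves for the atomic topology on the dual category\<close>

text \<open>
  Presheaves on the dual of \<open>C\<close> are the covariant functors from \<open>C\<close> to sets, and a sieve on
  \<open>c\<close> in the dual of \<open>C\<close> is a set of arrows of \<open>C\<close> with domain \<open>c\<close> which is closed under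
  postcomposition. A topology \<open>J\<close> assigns to each object its set of covering sieves.
\<close>

definition is_sieve :: "('o, 'm) cat \<Rightarrow> 'o \<Rightarrow> 'm set \<Rightarrow> bool" where
  "is_sieve C c S \<longleftrightarrow> S \<subseteq> {f \<in> Arr C. Dom C f = c} \<and>
     (\<forall>f \<in> S. \<forall>g \<in> Arr C. Dom C g = Cod C f \<longrightarrow> g \<cdot>\<^bsub>C\<^esub> f \<in> S)"

definition J_at :: "('o, 'm) cat \<Rightarrow> 'o \<Rightarrow> 'm set set" where
  "J_at C c = {S. is_sieve C c S \<and> S \<noteq> {}}"

definition matching_family ::
  "('o, 'm) cat \<Rightarrow> ('o, 'm, 'v) setfun \<Rightarrow> 'm set \<Rightarrow> ('m \<Rightarrow> 'v) \<Rightarrow> bool" where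
  "matching_family C F S x \<longleftrightarrow> x \<in> extensional S \<and>
     (\<forall>f \<in> S. x f \<in> Fob F (Cod C f)) \<and>
     (\<forall>f \<in> S. \<forall>g \<in> Arr C. Dom C g = Cod C f \<longrightarrow> x (g \<cdot>\<^bsub>C\<^esub> f) = Fmap F g (x f))"

definition is_sheaf ::
  "('o, 'm) cat \<Rightarrow> ('o \<Rightarrow> 'm set set) \<Rightarrow> ('o, 'm, 'v) setfun \<Rightarrow> bool" where
  "is_sheaf C J F \<longleftrightarrow> set_functor C F \<and>
     (\<forall>c \<in> Obj C. \<forall>S \<in> J c. \<forall>x. matching_family C F S x \<longrightarrow>
        (\<exists>!z. z \<in> Fob F c \<and> (\<forall>f \<in> S. Fmap F f z = x f)))"

text \<open>
  The associated sheaf is obtained by applying the plus construction twice. The elements of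
  the plus construction at \<open>c\<close> are matching families on covering sieves of \<open>c\<close>, two of them
  being identified when they agree on a common covering refinement.
\<close>

definition local_sections :: "('o, 'm) cat \<Rightarrow> ('o \<Rightarrow> 'm set set) \<Rightarrow> ('o, 'm, 'v) setfun \<Rightarrow>
    'o \<Rightarrow> ('m set \<times> ('m \<Rightarrow> 'v)) set" where
  "local_sections C J F c = {(S, x). S \<in> J c \<and> matching_family C F S x}"

definition plus_rel :: "('o, 'm) cat \<Rightarrow> ('o \<Rightarrow> 'm set set) \<Rightarrow> ('o, 'm, 'v) setfun \<Rightarrow>
    'o \<Rightarrow> (('m set \<times> ('m \<Rightarrow> 'v)) \<times> ('m set \<times> ('m \<Rightarrow> 'v))) set" where
  "plus_rel C J F c =
     {((S, x), (T, y)). (S, x) \<in> local_sections C J F c \<and> (T, y) \<in> local_sections C J F c \<and>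
        (\<exists>U \<in> J c. U \<subseteq> S \<inter> T \<and> (\<forall>f \<in> U. x f = y f))}"

definition restrict_section ::
  "('o, 'm) cat \<Rightarrow> 'm \<Rightarrow> 'm set \<times> ('m \<Rightarrow> 'v) \<Rightarrow> 'm set \<times> ('m \<Rightarrow> 'v)" where
  "restrict_section C k = (\<lambda>(S, x).
     let T = {f \<in> Arr C. Dom C f = Cod C k \<and> f \<cdot>\<^bsub>C\<^esub> k \<in> S} in (T, \<lambda>f\<in>T. x (f \<cdot>\<^bsub>C\<^esub> k)))"

definition plus :: "('o, 'm) cat \<Rightarrow> ('o \<Rightarrow> 'm set set) \<Rightarrow> ('o, 'm, 'v) setfun \<Rightarrow>
    ('o, 'm, ('m set \<times> ('m \<Rightarrow> 'v)) set) setfun" where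
  "plus C J F =
     \<lparr>Fob = (\<lambda>c. local_sections C J F c // plus_rel C J F c),
      Fmap = (\<lambda>k X. plus_rel C J F (Cod C k) `` (restrict_section C k ` X))\<rparr>"

text \<open>The action of the plus construction on a natural transformation with codomain \<open>G\<close>.\<close>

definition plus_map :: "('o, 'm) cat \<Rightarrow> ('o \<Rightarrow> 'm set set) \<Rightarrow> ('o, 'm, 'w) setfun \<Rightarrow>
    ('o \<Rightarrow> 'v \<Rightarrow> 'w) \<Rightarrow> 'o \<Rightarrow> ('m set \<times> ('m \<Rightarrow> 'v)) set \<Rightarrow> ('m set \<times> ('m \<Rightarrow> 'w)) set" where
  "plus_map C J G \<eta> c X =
     plus_rel C J G c `` ((\<lambda>(S, x). (S, \<lambda>f\<in>S. \<eta> (Cod C f) (x f))) ` X)"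

type_synonym ('m, 'v) plus_elem = "('m set \<times> ('m \<Rightarrow> 'v)) set"
type_synonym ('m, 'v) sheaf_elem = "('m, ('m, 'v) plus_elem) plus_elem"

definition sheafify ::
  "('o, 'm) cat \<Rightarrow> ('o, 'm, 'v) setfun \<Rightarrow> ('o, 'm, ('m, 'v) sheaf_elem) setfun" where
  "sheafify C F = plus C (J_at C) (plus C (J_at C) F)"

definition sheafify_map :: "('o, 'm) cat \<Rightarrow> ('o, 'm, 'w) setfun \<Rightarrow>
    ('o \<Rightarrow> 'v \<Rightarrow> 'w) \<Rightarrow> 'o \<Rightarrow> ('m, 'v) sheaf_elem \<Rightarrow> ('m, 'w) sheaf_elem" where
  "sheafify_map C G \<eta> = plus_map C (J_at C) (plus C (J_at C) G) (plus_map C (J_at C) G \<eta>)"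


section \<open>The atomic completion\<close>

text \<open>
  Sets are the subsets of the type \<open>'u\<close>, which plays the role of the universe: smallness of \<open>C\<close>
  means that its arrows embed into \<open>'u\<close>. Only hom-sets, subobjects and atoms of sheaves are
  used, so \<open>'u\<close> is not required to be closed under power sets. Functors and natural transformations are
  normalised outside their domains, so that HOL equality is equality of functors and of
  natural transformations.
\<close>

type_synonym ('o, 'm, 'u) ntrans =
  "('o, 'm, 'u) setfun \<times> ('o \<Rightarrow> 'u \<Rightarrow> 'u) \<times> ('o, 'm, 'u) setfun"

definition extensional_setfun :: "('o, 'm) cat \<Rightarrow> ('o, 'm, 'u) setfun \<Rightarrow> bool" where
  "extensional_setfun C F \<longleftrightarrow> (\<forall>e. e \<notin> Obj C \<longrightarrow> Fob F e = {}) \<and>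
     (\<forall>f x. f \<notin> Arr C \<or> x \<notin> Fob F (Dom C f) \<longrightarrow> Fmap F f x = undefined)"

definition normalise ::
  "('o, 'm) cat \<Rightarrow> ('o, 'm, 'u) setfun \<Rightarrow> ('o \<Rightarrow> 'u \<Rightarrow> 'u) \<Rightarrow> 'o \<Rightarrow> 'u \<Rightarrow> 'u" where
  "normalise C F \<eta> = (\<lambda>e x. if e \<in> Obj C \<and> x \<in> Fob F e then \<eta> e x else undefined)"

definition Sh_at ::
  "('o, 'm) cat \<Rightarrow> (('o, 'm, 'u) setfun, ('o, 'm, 'u) ntrans) cat" where
  "Sh_at C =
     \<lparr>Obj = {F. is_sheaf C (J_at C) F \<and> extensional_setfun C F},
      Arr = {(F, \<eta>, G). is_sheaf C (J_at C) F \<and> extensional_setfun C F \<and>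
               is_sheaf C (J_at C) G \<and> extensional_setfun C G \<and>
               nat_trans C F G \<eta> \<and> normalise C F \<eta> = \<eta>},
      Dom = (\<lambda>(F, \<eta>, G). F),
      Cod = (\<lambda>(F, \<eta>, G). G),
      Id = (\<lambda>F. (F, normalise C F (\<lambda>e x. x), F)),
      Comp = (\<lambda>(G', \<theta>, H) (F, \<eta>, G). (F, normalise C F (\<lambda>e x. \<theta> e (\<eta> e x)), H))\<rparr>"

definition atomic_completion ::
  "('o, 'm) cat \<Rightarrow> (('o, 'm, 'u) setfun, ('o, 'm, 'u) ntrans) cat" where
  "atomic_completion C = dual (full_subcat (Sh_at C) {F. is_atom (Sh_at C) F})"


section \<open>The category of closed equivalence relations on representables\<close>

type_synonym ('o, 'm) rel_family = "'o \<Rightarrow> ('m \<times> 'm) set"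
type_synonym ('o, 'm) ce_obj = "'o \<times> ('o, 'm) rel_family"
type_synonym ('o, 'm) ce_triple = "('o, 'm) rel_family \<times> ('o \<Rightarrow> ('m set \<times> 'm set) set)"
type_synonym ('o, 'm) ce_arr = "('o, 'm) ce_obj \<times> ('o, 'm) ce_obj \<times> ('o, 'm) ce_triple set"

definition yquot :: "('o, 'm) cat \<Rightarrow> 'o \<Rightarrow> ('o, 'm) rel_family \<Rightarrow> ('o, 'm, 'm set) setfun" where
  "yquot C c R = quot C (yoneda C c) R"

definition ce_objects :: "('o, 'm) cat \<Rightarrow> ('o, 'm) ce_obj set" where
  "ce_objects C = {(c, R). c \<in> Obj C \<and> closed_eqrel C (yoneda C c) R}"

text \<open>
  A subobject of \<open>yc/P \<times> yc'/R'\<close> is represented by the corresponding subfunctor \<open>Q\<close>; then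
  the components \<open>\<alpha>\<close> and \<open>\<beta>\<close> are \<open>\<lambda>_. fst\<close> and \<open>\<lambda>_. snd\<close>, and the triple
  \<open>(P, \<alpha>, \<beta>)\<close> amounts to the pair \<open>(P, Q)\<close>.
\<close>

definition span_fun :: "('o, 'm) cat \<Rightarrow> 'o \<Rightarrow> 'o \<Rightarrow> ('o, 'm) rel_family \<Rightarrow>
    ('o, 'm) rel_family \<Rightarrow> ('o \<Rightarrow> ('m set \<times> 'm set) set) \<Rightarrow> ('o, 'm, 'm set \<times> 'm set) setfun" where
  "span_fun C c c' P R' Q = sub_fun (prod_fun (yquot C c P) (yquot C c' R')) Q"

definition ce_triples ::
  "('o, 'm) cat \<Rightarrow> ('o, 'm) ce_obj \<Rightarrow> ('o, 'm) ce_obj \<Rightarrow> ('o, 'm) ce_triple set" where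
  "ce_triples C = (\<lambda>(c', R') (c, R).
     {(P, Q). closed_eqrel C (yoneda C c) P \<and> (\<forall>e. R e \<subseteq> P e) \<and>
        subfunctor C (prod_fun (yquot C c P) (yquot C c' R')) Q \<and>
        (let QF = span_fun C c c' P R' Q in
           nat_iso C (sheafify C QF) (sheafify C (yquot C c P))
             (sheafify_map C (yquot C c P) (\<lambda>_. fst)) \<and>
           nat_iso C (sheafify C QF) (sheafify C (yquot C c' R'))
             (sheafify_map C (yquot C c' R') (\<lambda>_. snd)))})"

text \<open>The arrow \<open>a(\<beta>) \<circ> a(\<alpha>)\<^sup>-\<^sup>1\<close> from \<open>a(yc/P)\<close> to \<open>a(yc'/R')\<close>.\<close>

definition span_arrow :: "('o, 'm) cat \<Rightarrow> ('o, 'm) ce_obj \<Rightarrow> ('o, 'm) ce_obj \<Rightarrow>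
    ('o, 'm) ce_triple \<Rightarrow> 'o \<Rightarrow> ('m, 'm set) sheaf_elem \<Rightarrow> ('m, 'm set) sheaf_elem" where
  "span_arrow C = (\<lambda>(c', R') (c, R) (P, Q) e z.
     sheafify_map C (yquot C c' R') (\<lambda>_. snd) e
       (inv_into (Fob (sheafify C (span_fun C c c' P R' Q)) e)
          (sheafify_map C (yquot C c P) (\<lambda>_. fst) e) z))"

definition ce_triple_rel :: "('o, 'm) cat \<Rightarrow> ('o, 'm) ce_obj \<Rightarrow> ('o, 'm) ce_obj \<Rightarrow>
    (('o, 'm) ce_triple \<times> ('o, 'm) ce_triple) set" where
  "ce_triple_rel C A B =
     {((P, Q), (P', Q')). (P, Q) \<in> ce_triples C A B \<and> (P', Q') \<in> ce_triples C A B \<and> P = P' \<and>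
        (\<forall>e \<in> Obj C. \<forall>z \<in> Fob (sheafify C (yquot C (fst B) P)) e.
           span_arrow C A B (P, Q) e z = span_arrow C A B (P', Q') e z)}"

text \<open>
  \<open>ce_comp C (c'', R'') (c', R') (c, R) (P, Q) (P', Q')\<close> is the triple \<open>(P'', Q'')\<close> for the composite of
  \<open>(P, Q) : (c', R') \<rightarrow> (c, R)\<close> with \<open>(P', Q') : (c'', R'') \<rightarrow> (c', R')\<close>. All limits and
  colimits are computed in the category of functors from \<open>C\<close> to sets, that is, pointwise.
\<close>

definition ce_comp :: "('o, 'm) cat \<Rightarrow> ('o, 'm) ce_obj \<Rightarrow> ('o, 'm) ce_obj \<Rightarrow> ('o, 'm) ce_obj \<Rightarrow>
    ('o, 'm) ce_triple \<Rightarrow> ('o, 'm) ce_triple \<Rightarrow> ('o, 'm) ce_triple" where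
  "ce_comp C = (\<lambda>(c'', R'') (c', R') (c, R) (P, Q) (P', Q').
     let
       \<alpha> = (\<lambda>e. fst); \<beta> = (\<lambda>e. snd); \<alpha>' = (\<lambda>e. fst); \<beta>' = (\<lambda>e. snd);
       QF = span_fun C c c' P R' Q;
       QF' = span_fun C c' c'' P' R'' Q';
       ycR = yquot C c R;
       ycP = yquot C c P;
       \<pi> = quot_proj P;
       Pt' = (\<lambda>e. (\<lambda>(x, y). (proj R' e x, proj R' e y)) ` P' e);
       L = sub_fun (prod_fun QF QF)
             (\<lambda>e. {(s, t). s \<in> Q e \<and> t \<in> Q e \<and> (\<beta> e s, \<beta> e t) \<in> Pt' e});
       \<chi> = (\<lambda>e. fst); \<xi> = (\<lambda>e. snd);
       H = pullback L (prod_fun ycR ycR)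
             (\<lambda>e l. (\<alpha> e (\<chi> e l), \<alpha> e (\<xi> e l))) (\<lambda>e. map_prod (\<pi> e) (\<pi> e));
       S = eqrel_generated C ycR (\<lambda>e. snd ` Fob H e);
       P\<^sub>0 = (\<lambda>e. {(x, y). x \<in> hom C c e \<and> y \<in> hom C c e \<and> (proj R e x, proj R e y) \<in> S e});
       P'' = at_closure C (yoneda C c) P\<^sub>0;
       ycP\<^sub>0 = yquot C c P\<^sub>0;
       kr = coeq_rel C L ycP (\<lambda>e l. \<alpha> e (\<chi> e l)) (\<lambda>e l. \<alpha> e (\<xi> e l));
       K' = coequalizer C L QF \<chi> \<xi>;
       b\<^sub>1 = induced (\<lambda>e x. proj kr e (\<pi> e (proj R e x)));
       b\<^sub>2 = induced (\<lambda>e s. proj kr e (\<alpha> e s));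
       b\<^sub>3 = induced (\<lambda>e s. quot_proj P' e (\<beta> e s));
       M = pullback ycP\<^sub>0 K' b\<^sub>1 b\<^sub>2; p = (\<lambda>e. fst); q = (\<lambda>e. snd);
       W = pullback K' QF' b\<^sub>3 \<alpha>'; r = (\<lambda>e. fst); x = (\<lambda>e. snd);
       N = pullback M W q r; d = (\<lambda>e. fst); b = (\<lambda>e. snd);
       Q'' = (\<lambda>e. (\<lambda>n. (quot_proj P'' e (p e (d e n)), \<beta>' e (x e (b e n)))) ` Fob N e)
     in (P'', Q''))"

text \<open>
  Composition of classes takes all composites of representatives and saturates them under the
  identification of triples. The identity of \<open>(c, R)\<close> is the class of \<open>(R, 1, 1)\<close>.
\<close>

definition C_e :: "('o, 'm) cat \<Rightarrow> (('o, 'm) ce_obj, ('o, 'm) ce_arr) cat" where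
  "C_e C =
     \<lparr>Obj = ce_objects C,
      Arr = {(A, B, X). A \<in> ce_objects C \<and> B \<in> ce_objects C \<and>
               X \<in> ce_triples C A B // ce_triple_rel C A B},
      Dom = (\<lambda>(A, B, X). A),
      Cod = (\<lambda>(A, B, X). B),
      Id = (\<lambda>A. (A, A, ce_triple_rel C A A ``
               {(snd A, \<lambda>e. Id_on (Fob (yquot C (fst A) (snd A)) e))})),
      Comp = (\<lambda>(A', B, X) (A'', B'', X').
               (A'', B, ce_triple_rel C A'' B `` {ce_comp C A'' A' B t t' | t t'. t \<in> X \<and> t' \<in> X'}))\<rparr>"

end

theory Submission
  imports Defs
begin

text \<open>
  For a closed equivalence relation \<open>R\<close> on \<open>yc\<close>, the sheaf \<open>a(yc/R)\<close> is the sheaf generated by an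
  element \<open>t\<close> over \<open>c\<close> subject exactly to the relations in \<open>R\<close>: arrows from it to a sheaf \<open>G\<close> are the
  elements \<open>z \<in> G c\<close> whose kernel contains \<open>R\<close>. Over the atomic topology every such sheaf is an atom,
  because any non-empty subsheaf contains a translate of \<open>t\<close>, hence \<open>t\<close> by glueing; and every atom
  arises in this way from any of its elements. A span \<open>(P, Q)\<close> from \<open>yc/P\<close> to \<open>yc'/R'\<close> whose legs become
  invertible after sheafification amounts to an element \<open>z\<close> of \<open>a(yc'/R')\<close> over \<open>c\<close> with kernel \<open>P\<close>,
  and the explicit composite of two spans has as its element the image of \<open>z\<close> under the
  second arrow. So hom-sets of \<open>C_e\<close> and hom-sets between atoms are parametrised by the same elements,
  compatibly with composition.
\<close>

section \<open>Sheaves for the atomic topology\<close>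

text \<open>Two obstacles shape the development. The associated sheaf consists of classes of
  sections of classes of sections, over the type \<open>sheaf_elem\<close>, whereas the atoms must
  take values in the universe \<open>'u\<close>. So a(yc/R) is handled through the predicate
  \<open>generates\<close>, which makes sense for every value type and determines the maps out of
  the sheaf; a model over \<open>'u\<close> is obtained by copying along injections. The other
  obstacle is the composition of \<open>C_e\<close>: the relations in it are generated ones without
  a closed description. They are never computed. An upper bound (the kernel of a map to the target
  sheaf) and a supply of related pairs after restriction are enough, because the closure makes the
  two meet.

  Amalgamation always enters in the same way: two arrows out of an object have a common
  continuation, so two non-empty sieves meet, and a statement about covers can be tested on one
  arrow. The category laws of \<open>C_e\<close> are not checked on spans but reflected from sheaves
  along the faithful assignment on arrows.\<close>

locale amalg_category = category +
  assumes amalg: "amalgamation_property C"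
begin

lemma homD: "f \<in> hom C a b \<Longrightarrow> f \<in> Arr C \<and> Dom C f = a \<and> Cod C f = b \<and> a \<in> Obj C \<and> b \<in> Obj C"
  using dom_obj cod_obj by (auto simp: hom_def)

lemma arr_hom: "f \<in> Arr C \<Longrightarrow> f \<in> hom C (Dom C f) (Cod C f)"
  by (simp add: hom_def)

lemma amalgE:
  assumes "f \<in> hom C a b" "g \<in> hom C a c"
  obtains d f' g' where "f' \<in> hom C b d" "g' \<in> hom C c d" "f' \<cdot> f = g' \<cdot> g"
  using amalg assms unfolding amalgamation_property_def hom_def by fastforce

lemma sf_map: "set_functor C F \<Longrightarrow> f \<in> hom C a b \<Longrightarrow> x \<in> Fob F a \<Longrightarrow> Fmap F f x \<in> Fob F b"
  by (auto simp: set_functor_def hom_def)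

lemma sf_comp: "set_functor C F \<Longrightarrow> f \<in> hom C a b \<Longrightarrow> g \<in> hom C b d \<Longrightarrow> x \<in> Fob F a \<Longrightarrow>
    Fmap F (g \<cdot> f) x = Fmap F g (Fmap F f x)"
  by (auto simp: set_functor_def hom_def)

lemma sf_id: "set_functor C F \<Longrightarrow> a \<in> Obj C \<Longrightarrow> x \<in> Fob F a \<Longrightarrow> Fmap F (Id C a) x = x"
  by (auto simp: set_functor_def)

lemma set_functorI:
  assumes "\<And>f a b x. f \<in> hom C a b \<Longrightarrow> x \<in> Fob F a \<Longrightarrow> Fmap F f x \<in> Fob F b"
    and "\<And>a x. a \<in> Obj C \<Longrightarrow> x \<in> Fob F a \<Longrightarrow> Fmap F (Id C a) x = x"
    and "\<And>f g a b d x. f \<in> hom C a b \<Longrightarrow> g \<in> hom C b d \<Longrightarrow> x \<in> Fob F a \<Longrightarrow>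
      Fmap F (g \<cdot> f) x = Fmap F g (Fmap F f x)"
  shows "set_functor C F"
  unfolding set_functor_def using assms arr_hom by (metis Pi_I)

lemma nt_map: "nat_trans C F G \<phi> \<Longrightarrow> a \<in> Obj C \<Longrightarrow> x \<in> Fob F a \<Longrightarrow> \<phi> a x \<in> Fob G a"
  by (auto simp: nat_trans_def)

lemma nt_nat: "nat_trans C F G \<phi> \<Longrightarrow> f \<in> hom C a b \<Longrightarrow> x \<in> Fob F a \<Longrightarrow>
    \<phi> b (Fmap F f x) = Fmap G f (\<phi> a x)"
  by (auto simp: nat_trans_def hom_def)

lemma nat_transI:
  assumes "\<And>a x. a \<in> Obj C \<Longrightarrow> x \<in> Fob F a \<Longrightarrow> \<phi> a x \<in> Fob G a"
    and "\<And>f a b x. f \<in> hom C a b \<Longrightarrow> x \<in> Fob F a \<Longrightarrow> \<phi> b (Fmap F f x) = Fmap G f (\<phi> a x)"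
  shows "nat_trans C F G \<phi>"
  unfolding nat_trans_def using assms arr_hom by (metis Pi_I)

lemma nat_trans_id: "nat_trans C F F (\<lambda>e x. x)"
  by (rule nat_transI) simp_all

lemma nat_trans_comp:
  "nat_trans C F G \<phi> \<Longrightarrow> nat_trans C G H \<psi> \<Longrightarrow> nat_trans C F H (\<lambda>e x. \<psi> e (\<phi> e x))"
  by (rule nat_transI) (auto simp: nt_map nt_nat homD)

section \<open>Separated functors and the sheaf condition along a single arrow\<close>

definition separated :: "('a, 'b, 'v) setfun \<Rightarrow> bool" where
  "separated F \<longleftrightarrow> (\<forall>a b. \<forall>f \<in> hom C a b. \<forall>x \<in> Fob F a. \<forall>y \<in> Fob F a.
     Fmap F f x = Fmap F f y \<longrightarrow> x = y)"

text \<open>An element \<open>y\<close> over the codomain of \<open>f\<close> prescribes the value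
  \<open>F g y\<close> at each \<open>g \<cdot> f\<close>. The condition says that this value
  depends on the composite alone, that is, \<open>y\<close> is a matching family on the sieve
  generated by \<open>f\<close>.\<close>

definition at_compatible :: "('a, 'b, 'v) setfun \<Rightarrow> 'b \<Rightarrow> 'v \<Rightarrow> bool" where
  "at_compatible F f y \<longleftrightarrow>
     (\<forall>d. \<forall>h \<in> hom C (Cod C f) d. \<forall>k \<in> hom C (Cod C f) d.
       h \<cdot> f = k \<cdot> f \<longrightarrow> Fmap F h y = Fmap F k y)"

definition at_sheaf :: "('a, 'b, 'v) setfun \<Rightarrow> bool" where
  "at_sheaf F \<longleftrightarrow> set_functor C F \<and> separated F \<and>
     (\<forall>a b. \<forall>f \<in> hom C a b. \<forall>y \<in> Fob F b. at_compatible F f y \<longrightarrow> (\<exists>x \<in> Fob F a. Fmap F f x = y))"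

lemma separatedD: "separated F \<Longrightarrow> f \<in> hom C a b \<Longrightarrow> x \<in> Fob F a \<Longrightarrow> y \<in> Fob F a \<Longrightarrow>
    Fmap F f x = Fmap F f y \<Longrightarrow> x = y"
  unfolding separated_def by blast

lemma at_sheafD:
  assumes "at_sheaf F"
  shows "set_functor C F" "separated F"
  using assms by (auto simp: at_sheaf_def)

lemma at_sheaf_glue:
  assumes "at_sheaf F" "f \<in> hom C a b" "y \<in> Fob F b"
    and "\<And>d h k. h \<in> hom C b d \<Longrightarrow> k \<in> hom C b d \<Longrightarrow> h \<cdot> f = k \<cdot> f \<Longrightarrow> Fmap F h y = Fmap F k y"
  obtains x where "x \<in> Fob F a" "Fmap F f x = y"
proof -
  have "at_compatible F f y"
    unfolding at_compatible_def using assms homD by blast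
  then show ?thesis using assms that unfolding at_sheaf_def by blast
qed

lemma sieve_comp: "is_sieve C c S \<Longrightarrow> f \<in> S \<Longrightarrow> f \<in> hom C c b \<Longrightarrow> g \<in> hom C b d \<Longrightarrow> g \<cdot> f \<in> S"
  by (auto simp: is_sieve_def hom_def)

lemma sieve_hom: "is_sieve C c S \<Longrightarrow> f \<in> S \<Longrightarrow> f \<in> hom C c (Cod C f)"
  by (auto simp: is_sieve_def hom_def)

lemma mf_comp: "matching_family C F S m \<Longrightarrow> f \<in> S \<Longrightarrow> f \<in> hom C c b \<Longrightarrow> g \<in> hom C b d \<Longrightarrow>
    m (g \<cdot> f) = Fmap F g (m f)"
  by (auto simp: matching_family_def hom_def)

lemma mf_val: "matching_family C F S m \<Longrightarrow> f \<in> S \<Longrightarrow> f \<in> hom C c b \<Longrightarrow> m f \<in> Fob F b"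
  by (auto simp: matching_family_def hom_def)

section \<open>Principal sieves and the comparison with the atomic topology\<close>

definition gen_sieve :: "'b \<Rightarrow> 'b set" where
  "gen_sieve f = {g \<cdot> f | g. g \<in> Arr C \<and> Dom C g = Cod C f}"

lemma gen_sieveI: "f \<in> hom C a b \<Longrightarrow> g \<in> hom C b d \<Longrightarrow> g \<cdot> f \<in> gen_sieve f"
  by (auto simp: gen_sieve_def hom_def)

lemma gen_sieveE:
  assumes "m \<in> gen_sieve f" "f \<in> hom C a b"
  obtains g d where "g \<in> hom C b d" "m = g \<cdot> f" "m \<in> hom C a d"
  using assms comp_hom unfolding gen_sieve_def by (force simp: hom_def)

lemma gen_sieve_self: "f \<in> hom C a b \<Longrightarrow> f \<in> gen_sieve f"
  by (metis comp_id_left gen_sieveI homD id_hom)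

lemma gen_sieve_J: "f \<in> hom C a b \<Longrightarrow> gen_sieve f \<in> J_at C a"
proof -
  assume f: "f \<in> hom C a b"
  have "is_sieve C a (gen_sieve f)"
    unfolding is_sieve_def
  proof (intro conjI ballI impI subsetI)
    fix m assume "m \<in> gen_sieve f"
    then show "m \<in> {f \<in> Arr C. Dom C f = a}" using f by (auto elim!: gen_sieveE simp: hom_def)
  next
    fix m g assume m: "m \<in> gen_sieve f" and g: "g \<in> Arr C" "Dom C g = Cod C m"
    from m f obtain k d where k: "k \<in> hom C b d" "m = k \<cdot> f" "m \<in> hom C a d" by (elim gen_sieveE)
    have g': "g \<in> hom C d (Cod C g)" using g k by (auto simp: hom_def)
    have "g \<cdot> m = (g \<cdot> k) \<cdot> f" using comp_assoc[OF f k(1) g'] k by simp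
    then show "g \<cdot> m \<in> gen_sieve f" using gen_sieveI[OF f comp_hom[OF k(1) g']] by simp
  qed
  then show ?thesis using gen_sieve_self[OF f] by (auto simp: J_at_def)
qed

lemma gen_matching:
  assumes F: "set_functor C F" and f: "f \<in> hom C a b" and y: "y \<in> Fob F b"
    and c: "\<And>d h k. h \<in> hom C b d \<Longrightarrow> k \<in> hom C b d \<Longrightarrow> h \<cdot> f = k \<cdot> f \<Longrightarrow> Fmap F h y = Fmap F k y"
  obtains m where "matching_family C F (gen_sieve f) m"
    "\<And>g d. g \<in> hom C b d \<Longrightarrow> m (g \<cdot> f) = Fmap F g y"
proof -
  \<comment> \<open>The factor \<open>g\<close> of a member of the sieve is an arbitrary choice;
    assumption \<open>c\<close> makes the value independent of it.\<close>
  define m where "m = (\<lambda>k\<in>gen_sieve f. Fmap F (SOME g. g \<in> hom C b (Cod C k) \<and> k = g \<cdot> f) y)"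
  have m: "m (g \<cdot> f) = Fmap F g y" if g: "g \<in> hom C b d" for g d
  proof -
    have "Cod C (g \<cdot> f) = d" using comp_hom[OF f g] by (auto simp: hom_def)
    then have "\<exists>k. k \<in> hom C b (Cod C (g \<cdot> f)) \<and> g \<cdot> f = k \<cdot> f" using g by auto
    from someI_ex[OF this] g \<open>Cod C (g \<cdot> f) = d\<close> have
      "Fmap F (SOME k. k \<in> hom C b (Cod C (g \<cdot> f)) \<and> g \<cdot> f = k \<cdot> f) y = Fmap F g y"
      by (intro c[of _ d]) auto
    then show ?thesis using gen_sieveI[OF f g] by (simp add: m_def)
  qed
  have "matching_family C F (gen_sieve f) m"
    unfolding matching_family_def
  proof (intro conjI ballI impI)
    show "m \<in> extensional (gen_sieve f)" by (simp add: m_def)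
  next
    fix k assume "k \<in> gen_sieve f"
    then show "m k \<in> Fob F (Cod C k)"
      using f sf_map[OF F _ y] by (elim gen_sieveE) (auto simp: m homD)
  next
    fix k h assume k: "k \<in> gen_sieve f" and h: "h \<in> Arr C" "Dom C h = Cod C k"
    from k f obtain g d where g: "g \<in> hom C b d" "k = g \<cdot> f" "k \<in> hom C a d" by (elim gen_sieveE)
    have h': "h \<in> hom C d (Cod C h)" using g h by (auto simp: hom_def)
    have "h \<cdot> k = (h \<cdot> g) \<cdot> f" using comp_assoc[OF f g(1) h'] g by simp
    then show "m (h \<cdot> k) = Fmap F h (m k)"
      using m[OF comp_hom[OF g(1) h']] sf_comp[OF F g(1) h' y] m[OF g(1)] g by simp
  qed
  then show ?thesis using m that by blast
qed

text \<open>Any one member \<open>f\<close> of a covering sieve carries all the information. One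
  direction applies the sheaf condition to \<open>gen_sieve f\<close>. In the other an element is
  glued along \<open>f\<close> alone, and its value at another member \<open>g\<close> is checked
  after amalgamating \<open>f\<close> with \<open>g\<close>, which separatedness permits.\<close>

lemma sheaf_iff: "is_sheaf C (J_at C) F \<longleftrightarrow> at_sheaf F"
proof
  assume sh: "is_sheaf C (J_at C) F"
  then have F: "set_functor C F" by (simp add: is_sheaf_def)
  have sep: "separated F"
    unfolding separated_def
  proof (intro allI ballI impI)
    fix a b f x y
    assume f: "f \<in> hom C a b" and x: "x \<in> Fob F a" and y: "y \<in> Fob F a"
      and e: "Fmap F f x = Fmap F f y"
    have "Fmap F f x \<in> Fob F b" using F f x by (rule sf_map)
    moreover have "Fmap F h (Fmap F f x) = Fmap F k (Fmap F f x)"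
      if "h \<in> hom C b d" "k \<in> hom C b d" "h \<cdot> f = k \<cdot> f" for d h k
      using that sf_comp[OF F f _ x] by metis
    ultimately obtain m where m: "matching_family C F (gen_sieve f) m"
      "\<And>g d. g \<in> hom C b d \<Longrightarrow> m (g \<cdot> f) = Fmap F g (Fmap F f x)"
      using gen_matching[OF F f] by metis
    \<comment> \<open>Both \<open>x\<close> and \<open>y\<close> amalgamate the family
      \<open>m\<close>, so uniqueness in the sheaf condition yields separatedness.\<close>
    have "\<exists>!z. z \<in> Fob F a \<and> (\<forall>k \<in> gen_sieve f. Fmap F k z = m k)"
      using sh m(1) gen_sieve_J[OF f] homD[OF f] unfolding is_sheaf_def by blast
    moreover have "\<forall>k \<in> gen_sieve f. Fmap F k x = m k"
      by (metis f gen_sieveE m(2) sf_comp[OF F f _ x])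
    moreover have "\<forall>k \<in> gen_sieve f. Fmap F k y = m k"
      by (metis f e gen_sieveE m(2) sf_comp[OF F f _ y])
    ultimately show "x = y" using x y by blast
  qed
  show "at_sheaf F"
    unfolding at_sheaf_def
  proof (intro conjI allI ballI impI F sep)
    fix a b f y
    assume f: "f \<in> hom C a b" and y: "y \<in> Fob F b" and c: "at_compatible F f y"
    obtain m where m: "matching_family C F (gen_sieve f) m"
      "\<And>g d. g \<in> hom C b d \<Longrightarrow> m (g \<cdot> f) = Fmap F g y"
      using gen_matching[OF F f y] c homD[OF f] unfolding at_compatible_def by metis
    then obtain x where x: "x \<in> Fob F a" "\<forall>k \<in> gen_sieve f. Fmap F k x = m k"
      using sh gen_sieve_J[OF f] homD[OF f] unfolding is_sheaf_def by blast
    have "Fmap F f x = m (Id C b \<cdot> f)"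
      using x(2) gen_sieve_self[OF f] comp_id_left[OF f] by simp
    also have "\<dots> = y" using m(2)[OF id_hom] homD[OF f] sf_id[OF F _ y] by simp
    finally show "\<exists>x \<in> Fob F a. Fmap F f x = y" using x by blast
  qed
next
  assume sh: "at_sheaf F"
  note F = at_sheafD(1)[OF sh] and sep = at_sheafD(2)[OF sh]
  show "is_sheaf C (J_at C) F"
    unfolding is_sheaf_def
  proof (intro conjI F ballI allI impI)
    fix c S m
    assume c: "c \<in> Obj C" and S: "S \<in> J_at C c" and m: "matching_family C F S m"
    then obtain f where s: "is_sieve C c S" and fS: "f \<in> S" by (auto simp: J_at_def)
    define b where "b = Cod C f"
    have f: "f \<in> hom C c b" using sieve_hom[OF s fS] by (simp add: b_def)
    have y: "m f \<in> Fob F b" using mf_val[OF m fS f] .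
    obtain x where x: "x \<in> Fob F c" "Fmap F f x = m f"
      using at_sheaf_glue[OF sh f y] mf_comp[OF m fS f] by metis
    show "\<exists>!z. z \<in> Fob F c \<and> (\<forall>f \<in> S. Fmap F f z = m f)"
    proof (intro ex1I[of _ x] conjI ballI x(1))
      fix g assume gS: "g \<in> S"
      have g: "g \<in> hom C c (Cod C g)" using sieve_hom[OF s gS] .
      obtain d h k where hk: "h \<in> hom C b d" "k \<in> hom C (Cod C g) d" "h \<cdot> f = k \<cdot> g"
        using amalgE[OF f g] by metis
      have "Fmap F k (Fmap F g x) = Fmap F k (m g)"
        using sf_comp[OF F f hk(1) x(1)] sf_comp[OF F g hk(2) x(1)] hk(3) x(2)
          mf_comp[OF m fS f hk(1)] mf_comp[OF m gS g hk(2)] by simp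
      then show "Fmap F g x = m g"
        using separatedD[OF sep hk(2)] sf_map[OF F g x(1)] mf_val[OF m gS g] by blast
    next
      fix z assume "z \<in> Fob F c \<and> (\<forall>f \<in> S. Fmap F f z = m f)"
      then show "z = x" using separatedD[OF sep f] x fS by metis
    qed
  qed
qed

section \<open>Local surjectivity and local injectivity\<close>

definition locally_surj ::
  "('a, 'b, 'v) setfun \<Rightarrow> ('a, 'b, 'w) setfun \<Rightarrow> ('a \<Rightarrow> 'v \<Rightarrow> 'w) \<Rightarrow> bool" where
  "locally_surj F G \<phi> \<longleftrightarrow>
     (\<forall>e \<in> Obj C. \<forall>y \<in> Fob G e. \<exists>d. \<exists>h \<in> hom C e d. \<exists>x \<in> Fob F d. \<phi> d x = Fmap G h y)"

text \<open>Together with \<open>locally_surj\<close> this is the elementary form of inducing an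
  isomorphism of associated sheaves (\<open>sheafify_map_iso_iff\<close>); one arrow
  \<open>h\<close> replaces a covering sieve.\<close>

definition locally_inj :: "('a, 'b, 'v) setfun \<Rightarrow> ('a \<Rightarrow> 'v \<Rightarrow> 'w) \<Rightarrow> bool" where
  "locally_inj F \<phi> \<longleftrightarrow>
     (\<forall>e \<in> Obj C. \<forall>x \<in> Fob F e. \<forall>y \<in> Fob F e. \<phi> e x = \<phi> e y \<longrightarrow>
        (\<exists>d. \<exists>h \<in> hom C e d. Fmap F h x = Fmap F h y))"

lemma locally_surjE:
  assumes "locally_surj F G \<phi>" "e \<in> Obj C" "y \<in> Fob G e"
  obtains d h x where "h \<in> hom C e d" "x \<in> Fob F d" "\<phi> d x = Fmap G h y"
  using assms unfolding locally_surj_def by blast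

lemma locally_injE:
  assumes "locally_inj F \<phi>" "e \<in> Obj C" "x \<in> Fob F e" "y \<in> Fob F e" "\<phi> e x = \<phi> e y"
  obtains d h where "h \<in> hom C e d" "Fmap F h x = Fmap F h y"
  using assms unfolding locally_inj_def by blast

lemma locally_surj_comp:
  assumes H: "set_functor C H" and n: "nat_trans C G H \<psi>"
    and s: "locally_surj F G \<phi>" "locally_surj G H \<psi>"
  shows "locally_surj F H (\<lambda>e x. \<psi> e (\<phi> e x))"
  unfolding locally_surj_def
proof (intro ballI)
  fix e z assume e: "e \<in> Obj C" and z: "z \<in> Fob H e"
  obtain d h y where h: "h \<in> hom C e d" "y \<in> Fob G d" "\<psi> d y = Fmap H h z"
    using locally_surjE[OF s(2) e z] .
  have d: "d \<in> Obj C" using h homD by blast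
  obtain d' k x where k: "k \<in> hom C d d'" "x \<in> Fob F d'" "\<phi> d' x = Fmap G k y"
    using locally_surjE[OF s(1) d h(2)] .
  have "\<psi> d' (\<phi> d' x) = Fmap H (k \<cdot> h) z"
    using k(3) h(3) nt_nat[OF n k(1) h(2)] sf_comp[OF H h(1) k(1) z] by simp
  then show "\<exists>d. \<exists>h \<in> hom C e d. \<exists>x \<in> Fob F d. \<psi> d (\<phi> d x) = Fmap H h z"
    using comp_hom[OF h(1) k(1)] k(2) by blast
qed

lemma locally_inj_comp:
  assumes F: "set_functor C F" and n: "nat_trans C F G \<phi>"
    and s: "locally_inj F \<phi>" "locally_inj G \<psi>"
  shows "locally_inj F (\<lambda>e x. \<psi> e (\<phi> e x))"
  unfolding locally_inj_def
proof (intro ballI impI)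
  fix e x y assume e: "e \<in> Obj C" and x: "x \<in> Fob F e" and y: "y \<in> Fob F e"
    and eq: "\<psi> e (\<phi> e x) = \<psi> e (\<phi> e y)"
  obtain d h where h: "h \<in> hom C e d" "Fmap G h (\<phi> e x) = Fmap G h (\<phi> e y)"
    using locally_injE[OF s(2) e nt_map[OF n e x] nt_map[OF n e y] eq] .
  have d: "d \<in> Obj C" using h homD by blast
  have "\<phi> d (Fmap F h x) = \<phi> d (Fmap F h y)"
    using h nt_nat[OF n h(1)] x y by simp
  then obtain d' k where k: "k \<in> hom C d d'" "Fmap F k (Fmap F h x) = Fmap F k (Fmap F h y)"
    using locally_injE[OF s(1) d] sf_map[OF F h(1)] x y by metis
  then show "\<exists>d. \<exists>h \<in> hom C e d. Fmap F h x = Fmap F h y"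
    using comp_hom[OF h(1) k(1)] sf_comp[OF F h(1) k(1)] x y by metis
qed

text \<open>The value at \<open>w\<close> is found by restricting \<open>w\<close> along some
  \<open>h\<close> until it comes from an \<open>x\<close> in \<open>F\<close>, and gluing
  \<open>\<psi> x\<close> along \<open>h\<close>. The condition on kernels makes
  \<open>\<psi> x\<close> compatible, and amalgamation makes the result independent of
  \<open>h\<close> and \<open>x\<close>. Maps out of sheaves with a generator, and inverses of
  sheafified maps, are built by this lemma.\<close>

lemma extend_along_locally_surj:
  assumes F: "set_functor C F" and G: "set_functor C G" and H: "at_sheaf H"
    and \<phi>: "nat_trans C F G \<phi>" "locally_surj F G \<phi>" and \<psi>: "nat_trans C F H \<psi>"
    and ker: "\<And>e x y. e \<in> Obj C \<Longrightarrow> x \<in> Fob F e \<Longrightarrow> y \<in> Fob F e \<Longrightarrow> \<phi> e x = \<phi> e y \<Longrightarrow> \<psi> e x = \<psi> e y"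
  obtains \<theta> where "nat_trans C G H \<theta>"
    "\<And>e x. e \<in> Obj C \<Longrightarrow> x \<in> Fob F e \<Longrightarrow> \<theta> e (\<phi> e x) = \<psi> e x"
proof -
  note Hf = at_sheafD(1)[OF H] and Hs = at_sheafD(2)[OF H]
  \<comment> \<open>The condition constrains \<open>v\<close> at every local preimage of
    \<open>w\<close> at once; naturality of the chosen values is then read off at one common
    preimage.\<close>
  define ok where "ok e w v \<longleftrightarrow> v \<in> Fob H e \<and> (\<forall>d. \<forall>h \<in> hom C e d. \<forall>x \<in> Fob F d.
      \<phi> d x = Fmap G h w \<longrightarrow> Fmap H h v = \<psi> d x)" for e w v
  have ex: "\<exists>v. ok e w v" if e: "e \<in> Obj C" and w: "w \<in> Fob G e" for e w
  proof -
    obtain d h x where h: "h \<in> hom C e d" "x \<in> Fob F d" "\<phi> d x = Fmap G h w"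
      using locally_surjE[OF \<phi>(2) e w] .
    \<comment> \<open>Two local preimages that become comparable after \<open>k\<close> and
      \<open>k'\<close> have the same image in \<open>G\<close>, hence by \<open>ker\<close> in
      \<open>H\<close>. With the same preimage twice this is compatibility; with two preimages it is
      independence of the choice.\<close>
    have eq: "Fmap H k (\<psi> d x) = Fmap H k' (\<psi> d' x')"
      if "k \<in> hom C d b" "k' \<in> hom C d' b" "h' \<in> hom C e d'" "x' \<in> Fob F d'"
        "\<phi> d' x' = Fmap G h' w" "k \<cdot> h = k' \<cdot> h'" for k k' b d' h' x'
    proof -
      have "\<phi> b (Fmap F k x) = \<phi> b (Fmap F k' x')"
        using that h nt_nat[OF \<phi>(1)] sf_comp[OF G _ _ w] by metis
      then have "\<psi> b (Fmap F k x) = \<psi> b (Fmap F k' x')"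
        using that h homD by (intro ker sf_map[OF F]) auto
      then show ?thesis using that h nt_nat[OF \<psi>] by metis
    qed
    have "\<psi> d x \<in> Fob H d" using nt_map[OF \<psi>] h homD by blast
    then obtain v where v: "v \<in> Fob H e" "Fmap H h v = \<psi> d x"
      using at_sheaf_glue[OF H h(1)] eq[OF _ _ h(1,2,3)] by metis
    have "Fmap H h' v = \<psi> d' x'"
      if h': "h' \<in> hom C e d'" "x' \<in> Fob F d'" "\<phi> d' x' = Fmap G h' w" for d' h' x'
    proof -
      obtain b k k' where k: "k \<in> hom C d b" "k' \<in> hom C d' b" "k \<cdot> h = k' \<cdot> h'"
        using amalgE[OF h(1) h'(1)] by metis
      have "Fmap H k' (Fmap H h' v) = Fmap H k' (\<psi> d' x')"
        using eq[OF k(1,2) h' k(3)] v sf_comp[OF Hf h(1) k(1) v(1)] sf_comp[OF Hf h'(1) k(2) v(1)] k(3)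
        by simp
      then show ?thesis
        using separatedD[OF Hs k(2)] sf_map[OF Hf h'(1) v(1)] nt_map[OF \<psi>] h' homD by blast
    qed
    then show ?thesis unfolding ok_def using v by blast
  qed
  define \<theta> where "\<theta> e w = (SOME v. ok e w v)" for e w
  have ok: "ok e w (\<theta> e w)" if "e \<in> Obj C" "w \<in> Fob G e" for e w
    unfolding \<theta>_def using ex[OF that] by (rule someI_ex)
  have in_H: "\<theta> e w \<in> Fob H e" if "e \<in> Obj C" "w \<in> Fob G e" for e w
    using ok[OF that] by (simp add: ok_def)
  have loc: "Fmap H h (\<theta> e w) = \<psi> d x" if "h \<in> hom C e d" "w \<in> Fob G e" "x \<in> Fob F d"
    "\<phi> d x = Fmap G h w" for e w d h x
    using ok[of e w] that homD unfolding ok_def by blast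
  have "nat_trans C G H \<theta>"
  proof (rule nat_transI)
    fix f a b w assume f: "f \<in> hom C a b" and w: "w \<in> Fob G a"
    have fw: "Fmap G f w \<in> Fob G b" using G f w by (rule sf_map)
    obtain d h x where h: "h \<in> hom C b d" "x \<in> Fob F d" "\<phi> d x = Fmap G h (Fmap G f w)"
      using locally_surjE[OF \<phi>(2) _ fw] homD[OF f] by metis
    have "Fmap H (h \<cdot> f) (\<theta> a w) = \<psi> d x"
      using loc[OF comp_hom[OF f h(1)] w h(2)] h(3) sf_comp[OF G f h(1) w] by simp
    then have "Fmap H h (Fmap H f (\<theta> a w)) = Fmap H h (\<theta> b (Fmap G f w))"
      using loc[OF h(1) fw h(2,3)] sf_comp[OF Hf f h(1)] in_H w homD[OF f] by simp
    then show "\<theta> b (Fmap G f w) = Fmap H f (\<theta> a w)"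
      using separatedD[OF Hs h(1)] sf_map[OF Hf f] in_H fw w homD[OF f] by metis
  qed (rule in_H)
  moreover have "\<theta> e (\<phi> e x) = \<psi> e x" if "e \<in> Obj C" "x \<in> Fob F e" for e x
    using loc[OF id_hom, of e "\<phi> e x" x] that sf_id[OF G] sf_id[OF Hf] nt_map[OF \<phi>(1)] in_H by metis
  ultimately show ?thesis using that by blast
qed

lemma nat_trans_eq_if_locally_surj:
  assumes n: "nat_trans C G H \<theta>" "nat_trans C G H \<theta>'" and H: "separated H"
    and F: "locally_surj F G \<phi>"
    and eq: "\<And>e x. e \<in> Obj C \<Longrightarrow> x \<in> Fob F e \<Longrightarrow> \<theta> e (\<phi> e x) = \<theta>' e (\<phi> e x)"
    and e: "e \<in> Obj C" and w: "w \<in> Fob G e"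
  shows "\<theta> e w = \<theta>' e w"
proof -
  obtain d h x where h: "h \<in> hom C e d" "x \<in> Fob F d" "\<phi> d x = Fmap G h w"
    using locally_surjE[OF F e w] .
  have "Fmap H h (\<theta> e w) = Fmap H h (\<theta>' e w)"
    using eq[OF _ h(2)] h homD nt_nat[OF n(1) h(1) w] nt_nat[OF n(2) h(1) w] by metis
  then show ?thesis using separatedD[OF H h(1)] nt_map[OF n(1) e w] nt_map[OF n(2) e w] by blast
qed

end

section \<open>The associated sheaf\<close>

context amalg_category
begin

abbreviation sections :: "('a, 'b, 'v) setfun \<Rightarrow> 'a \<Rightarrow> ('b set \<times> ('b \<Rightarrow> 'v)) set" where
  "sections \<equiv> local_sections C (J_at C)"

abbreviation prel :: "('a, 'b, 'v) setfun \<Rightarrow> 'a \<Rightarrow>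
    (('b set \<times> ('b \<Rightarrow> 'v)) \<times> ('b set \<times> ('b \<Rightarrow> 'v))) set" where
  "prel \<equiv> plus_rel C (J_at C)"

abbreviation pfun :: "('a, 'b, 'v) setfun \<Rightarrow> ('a, 'b, ('b set \<times> ('b \<Rightarrow> 'v)) set) setfun" where
  "pfun \<equiv> plus C (J_at C)"

text \<open>The maximal covering sieve on \<open>c\<close>, seen in the dual category.\<close>

definition star :: "'a \<Rightarrow> 'b set" where
  "star c = {f \<in> Arr C. Dom C f = c}"

definition unit_section :: "('a, 'b, 'v) setfun \<Rightarrow> 'a \<Rightarrow> 'v \<Rightarrow> 'b set \<times> ('b \<Rightarrow> 'v)" where
  "unit_section F c x = (star c, \<lambda>f\<in>star c. Fmap F f x)"

definition plus_unit :: "('a, 'b, 'v) setfun \<Rightarrow> 'a \<Rightarrow> 'v \<Rightarrow> ('b set \<times> ('b \<Rightarrow> 'v)) set" where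
  "plus_unit F c x = prel F c `` {unit_section F c x}"

lemma sections_iff: "(S, m) \<in> sections F c \<longleftrightarrow> is_sieve C c S \<and> S \<noteq> {} \<and> matching_family C F S m"
  by (auto simp: local_sections_def J_at_def)

text \<open>Two matching families that agree at one common member \<open>f\<close> agree on
  everything that factors through \<open>f\<close>, and \<open>gen_sieve f\<close> is already a
  covering refinement.\<close>

lemma prel_iff: "((S, x), (T, y)) \<in> prel F c \<longleftrightarrow>
    (S, x) \<in> sections F c \<and> (T, y) \<in> sections F c \<and> (\<exists>f \<in> S \<inter> T. x f = y f)"
proof
  assume "((S, x), (T, y)) \<in> prel F c"
  then show "(S, x) \<in> sections F c \<and> (T, y) \<in> sections F c \<and> (\<exists>f \<in> S \<inter> T. x f = y f)"
    by (fastforce simp: plus_rel_def J_at_def)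
next
  assume a: "(S, x) \<in> sections F c \<and> (T, y) \<in> sections F c \<and> (\<exists>f \<in> S \<inter> T. x f = y f)"
  then obtain f where f: "f \<in> S" "f \<in> T" "x f = y f" by blast
  note a' = a[unfolded sections_iff]
  have fh: "f \<in> hom C c (Cod C f)" using a' f sieve_hom by blast
  have "gen_sieve f \<subseteq> S \<inter> T \<and> (\<forall>m \<in> gen_sieve f. x m = y m)"
  proof (intro conjI subsetI ballI)
    fix m assume "m \<in> gen_sieve f"
    then obtain g d where g: "g \<in> hom C (Cod C f) d" "m = g \<cdot> f"
      using fh by (elim gen_sieveE)
    show "m \<in> S \<inter> T" using a' f sieve_comp[OF _ _ fh g(1)] g(2) by blast
    show "x m = y m" using a' f mf_comp[OF _ _ fh g(1)] g(2) by metis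
  qed
  then show "((S, x), (T, y)) \<in> prel F c"
    using a gen_sieve_J[OF fh] unfolding plus_rel_def by blast
qed

lemma prelE:
  assumes "(s, t) \<in> prel F c"
  obtains S x T y f b where "s = (S, x)" "t = (T, y)" "s \<in> sections F c" "t \<in> sections F c"
    "f \<in> hom C c b" "f \<in> S" "f \<in> T" "x f = y f"
  using assms by (cases s; cases t) (metis IntD1 IntD2 prel_iff sections_iff sieve_hom)

lemma sectionsE:
  assumes "s \<in> sections F c"
  obtains S x f b where "s = (S, x)" "is_sieve C c S" "matching_family C F S x" "f \<in> S" "f \<in> hom C c b"
  using assms by (cases s) (metis ex_in_conv sections_iff sieve_hom)

text \<open>Transitivity needs amalgamation: \<open>s\<close> and \<open>t\<close> agree at
  \<open>f\<close>, \<open>t\<close> and \<open>u\<close> agree at \<open>g\<close>, and a common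
  continuation \<open>h \<cdot> f = k \<cdot> g\<close> is a member at which all three
  agree.\<close>

lemma equiv_prel:
  assumes F: "set_functor C F"
  shows "equiv (sections F c) (prel F c)"
proof (rule equivI)
  show "prel F c \<subseteq> sections F c \<times> sections F c"
    by (auto elim!: prelE)
  show "refl_on (sections F c) (prel F c)"
  proof (rule refl_onI)
    fix s assume "s \<in> sections F c"
    then obtain S x f where "s = (S, x)" "f \<in> S" "(S, x) \<in> sections F c"
      by (metis sectionsE)
    then show "(s, s) \<in> prel F c" by (auto simp: prel_iff)
  qed
  show "sym (prel F c)"
    by (rule symI) (clarsimp simp: prel_iff, metis IntI)
  show "trans (prel F c)"
  proof (rule transI)
    fix s t u assume st: "(s, t) \<in> prel F c" and tu: "(t, u) \<in> prel F c"
    obtain S x T y f b where 1: "s = (S, x)" "t = (T, y)" "s \<in> sections F c" "t \<in> sections F c"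
      "f \<in> hom C c b" "f \<in> S" "f \<in> T" "x f = y f" using st by (rule prelE)
    obtain U z g b' where 2: "u = (U, z)" "u \<in> sections F c"
      "g \<in> hom C c b'" "g \<in> T" "g \<in> U" "y g = z g" using tu 1(2) by (auto elim: prelE)
    obtain d h k where hk: "h \<in> hom C b d" "k \<in> hom C b' d" "h \<cdot> f = k \<cdot> g"
      using amalgE[OF 1(5) 2(3)] by metis
    have s: "is_sieve C c S" "matching_family C F S x" "matching_family C F T y"
      "is_sieve C c U" "matching_family C F U z" using 1 2 by (simp_all add: sections_iff)
    have "x (h \<cdot> f) = y (h \<cdot> f)"
      using 1 mf_comp[OF s(2) _ 1(5) hk(1)] mf_comp[OF s(3) _ 1(5) hk(1)] by simp
    also have "\<dots> = z (h \<cdot> f)"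
      using 2 mf_comp[OF s(3) _ 2(3) hk(2)] mf_comp[OF s(5) _ 2(3) hk(2)] hk(3) by simp
    finally show "(s, u) \<in> prel F c"
      using 1 2 sieve_comp[OF s(1) 1(6,5) hk(1)] sieve_comp[OF s(4) 2(5,3) hk(2)] hk(3)
      by (auto simp: prel_iff)
  qed
qed

lemma unit_section_in:
  assumes F: "set_functor C F" and c: "c \<in> Obj C" and x: "x \<in> Fob F c"
  shows "unit_section F c x \<in> sections F c"
proof -
  have "is_sieve C c (star c)"
    unfolding is_sieve_def star_def using comp_hom by (auto simp: hom_def)
  moreover have "Id C c \<in> star c" using id_hom[OF c] by (auto simp: star_def hom_def)
  moreover have "matching_family C F (star c) (\<lambda>f\<in>star c. Fmap F f x)"
    unfolding matching_family_def
  proof (intro conjI ballI impI)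
    fix f assume f: "f \<in> star c"
    then have fh: "f \<in> hom C c (Cod C f)" by (auto simp: star_def hom_def)
    then show "(\<lambda>f\<in>star c. Fmap F f x) f \<in> Fob F (Cod C f)"
      using f sf_map[OF F fh x] by simp
    fix g assume "g \<in> Arr C" "Dom C g = Cod C f"
    then have gh: "g \<in> hom C (Cod C f) (Cod C g)" by (auto simp: hom_def)
    then have "g \<cdot> f \<in> star c" using comp_hom[OF fh gh] by (auto simp: hom_def star_def)
    then show "(\<lambda>f\<in>star c. Fmap F f x) (g \<cdot> f) = Fmap F g ((\<lambda>f\<in>star c. Fmap F f x) f)"
      using f sf_comp[OF F fh gh x] by simp
  qed simp
  ultimately show ?thesis by (auto simp: unit_section_def sections_iff)
qed

lemma restrict_section_eq:
  "k \<in> hom C a b \<Longrightarrow> restrict_section C k (S, x) =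
    ({f \<in> star b. f \<cdot> k \<in> S}, \<lambda>f\<in>{f \<in> star b. f \<cdot> k \<in> S}. x (f \<cdot> k))"
  by (auto simp: restrict_section_def Let_def star_def hom_def)

text \<open>The point beyond bookkeeping is that the pulled-back sieve is non-empty: amalgamating
  \<open>k\<close> with a member of the original sieve supplies a member.\<close>

lemma restrict_section_in:
  assumes k: "k \<in> hom C a b" and s: "s \<in> sections F a"
  shows "restrict_section C k s \<in> sections F b"
proof -
  obtain S x f d where S: "s = (S, x)" "is_sieve C a S" "matching_family C F S x" "f \<in> S" "f \<in> hom C a d"
    using s by (rule sectionsE)
  define T where "T = {f \<in> star b. f \<cdot> k \<in> S}"
  have TI: "g \<in> T \<longleftrightarrow> g \<cdot> k \<in> S" if "g \<in> hom C b e" for g e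
    using that by (auto simp: T_def star_def hom_def)
  have Th: "g \<in> hom C b (Cod C g)" if "g \<in> T" for g
    using that by (auto simp: T_def star_def hom_def)
  have comp: "h \<cdot> g \<in> T \<and> (h \<cdot> g) \<cdot> k = h \<cdot> (g \<cdot> k) \<and> g \<cdot> k \<in> S \<and> g \<cdot> k \<in> hom C a (Cod C g) \<and>
      h \<in> hom C (Cod C g) (Cod C h)"
    if g: "g \<in> T" and h: "h \<in> Arr C" "Dom C h = Cod C g" for g h
  proof -
    have hh: "h \<in> hom C (Cod C g) (Cod C h)" using h by (auto simp: hom_def)
    have gk: "g \<cdot> k \<in> S" using g by (simp add: T_def)
    have gkh: "g \<cdot> k \<in> hom C a (Cod C g)" using comp_hom[OF k Th[OF g]] .
    have a: "(h \<cdot> g) \<cdot> k = h \<cdot> (g \<cdot> k)" using comp_assoc[OF k Th[OF g] hh] .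
    then show ?thesis
      using hh gk gkh TI[OF comp_hom[OF Th[OF g] hh]] sieve_comp[OF S(2) gk gkh hh] by simp
  qed
  obtain e p q where pq: "p \<in> hom C b e" "q \<in> hom C d e" "p \<cdot> k = q \<cdot> f"
    using amalgE[OF k S(5)] by metis
  then have "p \<in> T" using sieve_comp[OF S(2,4,5) pq(2)] TI by simp
  moreover have "is_sieve C b T"
    unfolding is_sieve_def using comp Th by (auto simp: hom_def)
  moreover have "matching_family C F T (\<lambda>f\<in>T. x (f \<cdot> k))"
    unfolding matching_family_def
  proof (intro conjI ballI impI)
    fix g assume g: "g \<in> T"
    then have "g \<cdot> k \<in> S" by (simp add: T_def)
    then show "(\<lambda>f\<in>T. x (f \<cdot> k)) g \<in> Fob F (Cod C g)"
      using g mf_val[OF S(3) _ comp_hom[OF k Th[OF g]]] by simp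
    fix h assume "h \<in> Arr C" "Dom C h = Cod C g"
    then show "(\<lambda>f\<in>T. x (f \<cdot> k)) (h \<cdot> g) = Fmap F h ((\<lambda>f\<in>T. x (f \<cdot> k)) g)"
      using comp[OF g, of h] mf_comp[OF S(3), of "g \<cdot> k" a "Cod C g" h "Cod C h"] g by simp
  qed simp
  moreover have "restrict_section C k s = (T, \<lambda>f\<in>T. x (f \<cdot> k))"
    unfolding S(1) T_def by (rule restrict_section_eq[OF k])
  ultimately show ?thesis by (auto simp: sections_iff)
qed

lemma restrict_section_rel:
  assumes k: "k \<in> hom C a b" and st: "(s, t) \<in> prel F a"
  shows "(restrict_section C k s, restrict_section C k t) \<in> prel F b"
proof -
  obtain S x T y f d where S: "s = (S, x)" "t = (T, y)" "s \<in> sections F a" "t \<in> sections F a"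
    "f \<in> hom C a d" "f \<in> S" "f \<in> T" "x f = y f" using st by (rule prelE)
  then have s: "is_sieve C a S" "matching_family C F S x" "is_sieve C a T" "matching_family C F T y"
    by (simp_all add: sections_iff)
  obtain e p q where pq: "p \<in> hom C b e" "q \<in> hom C d e" "p \<cdot> k = q \<cdot> f"
    using amalgE[OF k S(5)] by metis
  have "p \<in> star b" using pq(1) by (auto simp: star_def hom_def)
  moreover have "p \<cdot> k \<in> S" "p \<cdot> k \<in> T"
    using pq(3) sieve_comp[OF s(1) S(6,5) pq(2)] sieve_comp[OF s(3) S(7,5) pq(2)] by simp_all
  moreover have "x (p \<cdot> k) = y (p \<cdot> k)"
    using pq(3) mf_comp[OF s(2) S(6,5) pq(2)] mf_comp[OF s(4) S(7,5) pq(2)] S(8) by simp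
  ultimately show ?thesis
    using restrict_section_in[OF k S(3)] restrict_section_in[OF k S(4)] S(1,2)
    by (auto simp: restrict_section_eq[OF k] prel_iff)
qed

lemma pfun_Fob: "Fob (pfun F) c = sections F c // prel F c"
  by (simp add: plus_def)

lemma pfun_FobE:
  assumes "w \<in> Fob (pfun F) c"
  obtains s where "s \<in> sections F c" "w = prel F c `` {s}"
  using assms by (auto simp: pfun_Fob elim: quotientE)

lemma pfun_class: "s \<in> sections F c \<Longrightarrow> prel F c `` {s} \<in> Fob (pfun F) c"
  by (auto simp: pfun_Fob intro: quotientI)

text \<open>Both the plus construction and quotients define a map on classes as the saturated image
  of the class. For a map that respects the relations this is the class of the image of a
  representative.\<close>

lemma class_image:
  assumes e: "equiv A r" and e': "equiv B r'" and s: "s \<in> A"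
    and c: "\<And>s t. (s, t) \<in> r \<Longrightarrow> (\<phi> s, \<phi> t) \<in> r'"
  shows "r' `` (\<phi> ` (r `` {s})) = r' `` {\<phi> s}"
proof
  have "(s, s) \<in> r" using e s by (meson equiv_def refl_onD)
  then show "r' `` {\<phi> s} \<subseteq> r' `` (\<phi> ` (r `` {s}))" by blast
  show "r' `` (\<phi> ` (r `` {s})) \<subseteq> r' `` {\<phi> s}"
  proof
    fix y assume "y \<in> r' `` (\<phi> ` (r `` {s}))"
    then obtain t where "(s, t) \<in> r" "(\<phi> t, y) \<in> r'" by blast
    then show "y \<in> r' `` {\<phi> s}" using c[of s t] e' by (meson Image_singleton_iff equiv_def transD)
  qed
qed

lemma pfun_Fmap:
  assumes F: "set_functor C F" and k: "k \<in> hom C a b" and s: "s \<in> sections F a"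
  shows "Fmap (pfun F) k (prel F a `` {s}) = prel F b `` {restrict_section C k s}"
  using class_image[OF equiv_prel[OF F] equiv_prel[OF F] s restrict_section_rel[OF k]] homD[OF k]
  by (simp add: plus_def)

lemma pfun_class_eq:
  assumes F: "set_functor C F" and s: "s \<in> sections F c" "t \<in> sections F c"
  shows "prel F c `` {s} = prel F c `` {t} \<longleftrightarrow> (s, t) \<in> prel F c"
  using eq_equiv_class_iff[OF equiv_prel[OF F] s] .

lemma set_functor_pfun:
  assumes F: "set_functor C F"
  shows "set_functor C (pfun F)"
proof (rule set_functorI)
  fix f a b w assume f: "f \<in> hom C a b" and w: "w \<in> Fob (pfun F) a"
  then show "Fmap (pfun F) f w \<in> Fob (pfun F) b"
    by (auto elim!: pfun_FobE simp: pfun_Fmap[OF F f] intro!: pfun_class restrict_section_in)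
next
  fix a w assume a: "a \<in> Obj C" and w: "w \<in> Fob (pfun F) a"
  then obtain s where s: "s \<in> sections F a" "w = prel F a `` {s}" by (elim pfun_FobE)
  obtain S x where S: "s = (S, x)" "is_sieve C a S" "matching_family C F S x"
    using s(1) by (metis sectionsE)
  have "restrict_section C (Id C a) (S, x) = (S, x)"
  proof -
    have 1: "{f \<in> star a. f \<cdot> Id C a \<in> S} = S"
      using S(2) comp_id_right by (force simp: is_sieve_def star_def hom_def)
    have "(\<lambda>f\<in>S. x (f \<cdot> Id C a)) = x"
    proof
      fix f
      show "(\<lambda>f\<in>S. x (f \<cdot> Id C a)) f = x f"
        using S comp_id_right[OF sieve_hom[OF S(2)]]
        by (cases "f \<in> S") (auto simp: matching_family_def extensional_def)
    qed
    then show ?thesis using 1 by (simp add: restrict_section_eq[OF id_hom[OF a]])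
  qed
  then show "Fmap (pfun F) (Id C a) w = w"
    using pfun_Fmap[OF F id_hom[OF a] s(1)] s(2) S(1) by simp
next
  fix f g a b d w assume f: "f \<in> hom C a b" and g: "g \<in> hom C b d" and w: "w \<in> Fob (pfun F) a"
  then obtain s where s: "s \<in> sections F a" "w = prel F a `` {s}" by (elim pfun_FobE)
  obtain S x where S: "s = (S, x)" by (cases s)
  have *: "h \<in> star d \<Longrightarrow> h \<cdot> g \<in> star b \<and> (h \<cdot> g) \<cdot> f = h \<cdot> (g \<cdot> f)" for h
    using comp_hom[OF g, of h "Cod C h"] comp_assoc[OF f g, of h "Cod C h"]
    by (auto simp: star_def hom_def)
  have "restrict_section C (g \<cdot> f) s = restrict_section C g (restrict_section C f s)"
    by (auto simp: S restrict_section_eq[OF f] restrict_section_eq[OF g]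
        restrict_section_eq[OF comp_hom[OF f g]] * restrict_def fun_eq_iff)
  then show "Fmap (pfun F) (g \<cdot> f) w = Fmap (pfun F) g (Fmap (pfun F) f w)"
    using pfun_Fmap[OF F f s(1)] pfun_Fmap[OF F g restrict_section_in[OF f s(1)]]
      pfun_Fmap[OF F comp_hom[OF f g] s(1)] s(2) by simp
qed

lemma nat_trans_plus_unit:
  assumes F: "set_functor C F"
  shows "nat_trans C F (pfun F) (plus_unit F)"
proof (rule nat_transI)
  fix a x assume "a \<in> Obj C" "x \<in> Fob F a"
  then show "plus_unit F a x \<in> Fob (pfun F) a"
    unfolding plus_unit_def by (intro pfun_class unit_section_in F)
next
  fix f a b x assume f: "f \<in> hom C a b" and x: "x \<in> Fob F a"
  have *: "h \<in> star b \<Longrightarrow> h \<cdot> f \<in> star a \<and> Fmap F (h \<cdot> f) x = Fmap F h (Fmap F f x)" for h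
    using comp_hom[OF f, of h "Cod C h"] sf_comp[OF F f _ x, of h "Cod C h"]
    by (auto simp: star_def hom_def)
  have "restrict_section C f (unit_section F a x) = unit_section F b (Fmap F f x)"
    by (auto simp: unit_section_def restrict_section_eq[OF f] restrict_def fun_eq_iff *)
  then show "plus_unit F b (Fmap F f x) = Fmap (pfun F) f (plus_unit F a x)"
    using pfun_Fmap[OF F f unit_section_in[OF F _ x]] homD[OF f] by (simp add: plus_unit_def)
qed

lemma locally_inj_plus_unit:
  assumes F: "set_functor C F"
  shows "locally_inj F (plus_unit F)"
  unfolding locally_inj_def
proof (intro ballI impI)
  fix e x y assume e: "e \<in> Obj C" and x: "x \<in> Fob F e" and y: "y \<in> Fob F e"
    and "plus_unit F e x = plus_unit F e y"
  then have "(unit_section F e x, unit_section F e y) \<in> prel F e"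
    using pfun_class_eq[OF F] unit_section_in[OF F e] unfolding plus_unit_def by blast
  then obtain f b where "f \<in> hom C e b" "f \<in> star e" "Fmap F f x = Fmap F f y"
    by (elim prelE) (auto simp: unit_section_def)
  then show "\<exists>d. \<exists>h \<in> hom C e d. Fmap F h x = Fmap F h y" by blast
qed

text \<open>For a member \<open>f\<close> of \<open>S\<close> the sieve pulled back along
  \<open>f\<close> is the maximal one, and the family on it consists of the translates of
  \<open>m f\<close>. So a section becomes an element of \<open>F\<close> along each arrow of its
  own cover.\<close>

lemma pfun_restrict_member:
  assumes F: "set_functor C F" and s: "(S, m) \<in> sections F c" and f: "f \<in> S" "f \<in> hom C c b"
  shows "Fmap (pfun F) f (prel F c `` {(S, m)}) = plus_unit F b (m f)"
proof -
  have S: "is_sieve C c S" "matching_family C F S m" using s by (simp_all add: sections_iff)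
  have h: "h \<in> hom C b (Cod C h)" if "h \<in> star b" for h using that by (auto simp: star_def hom_def)
  have "h \<cdot> f \<in> S \<and> m (h \<cdot> f) = Fmap F h (m f)" if "h \<in> star b" for h
    using sieve_comp[OF S(1) f h[OF that]] mf_comp[OF S(2) f h[OF that]] by blast
  then have "restrict_section C f (S, m) = unit_section F b (m f)"
    by (auto simp: restrict_section_eq[OF f(2)] unit_section_def restrict_def fun_eq_iff)
  then show ?thesis using pfun_Fmap[OF F f(2) s] by (simp add: plus_unit_def)
qed

lemma locally_surj_plus_unit:
  assumes F: "set_functor C F"
  shows "locally_surj F (pfun F) (plus_unit F)"
  unfolding locally_surj_def
proof (intro ballI)
  fix e w assume "e \<in> Obj C" "w \<in> Fob (pfun F) e"
  then obtain s where s: "s \<in> sections F e" "w = prel F e `` {s}" by (elim pfun_FobE)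
  obtain S x f b where S: "s = (S, x)" "matching_family C F S x" "f \<in> S" "f \<in> hom C e b"
    using s(1) by (rule sectionsE)
  then show "\<exists>d. \<exists>h \<in> hom C e d. \<exists>x \<in> Fob F d. plus_unit F d x = Fmap (pfun F) h w"
    using pfun_restrict_member[OF F _ S(3,4)] s mf_val[OF S(2,3,4)] by metis
qed

text \<open>Restrictions along \<open>f\<close> that agree at \<open>g\<close> come from families
  that agree at \<open>g \<cdot> f\<close>, and by \<open>prel_iff\<close> this one member
  identifies the original sections.\<close>

lemma separated_pfun:
  assumes F: "set_functor C F"
  shows "separated (pfun F)"
  unfolding separated_def
proof (intro allI ballI impI)
  fix a b f v w assume f: "f \<in> hom C a b" and v: "v \<in> Fob (pfun F) a" and w: "w \<in> Fob (pfun F) a"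
    and eq: "Fmap (pfun F) f v = Fmap (pfun F) f w"
  obtain s where s: "s \<in> sections F a" "v = prel F a `` {s}" using v by (elim pfun_FobE)
  obtain t where t: "t \<in> sections F a" "w = prel F a `` {t}" using w by (elim pfun_FobE)
  obtain S x T y where ST: "s = (S, x)" "t = (T, y)" by (cases s; cases t)
  have "(restrict_section C f s, restrict_section C f t) \<in> prel F b"
    using pfun_Fmap[OF F f] s t eq pfun_class_eq[OF F] restrict_section_in[OF f] by metis
  then obtain g where "g \<cdot> f \<in> S \<inter> T" "x (g \<cdot> f) = y (g \<cdot> f)"
    by (elim prelE) (auto simp: ST restrict_section_eq[OF f])
  then have "(s, t) \<in> prel F a" using ST s t by (auto simp: prel_iff)
  then show "v = w" using s t pfun_class_eq[OF F] by blast
qed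

text \<open>A compatible \<open>y\<close> is a matching family on \<open>gen_sieve f\<close>, and
  the class of that family is the element \<open>w\<close>.\<close>

lemma pfun_glue:
  assumes F: "set_functor C F" and f: "f \<in> hom C a b" and y: "y \<in> Fob F b"
    and c: "\<And>d h k. h \<in> hom C b d \<Longrightarrow> k \<in> hom C b d \<Longrightarrow> h \<cdot> f = k \<cdot> f \<Longrightarrow> Fmap F h y = Fmap F k y"
  obtains w where "w \<in> Fob (pfun F) a" "Fmap (pfun F) f w = plus_unit F b y"
proof -
  obtain m where m: "matching_family C F (gen_sieve f) m"
    "\<And>g d. g \<in> hom C b d \<Longrightarrow> m (g \<cdot> f) = Fmap F g y"
    using gen_matching[OF F f y] c by metis
  have b: "b \<in> Obj C" using f homD by blast
  have s: "(gen_sieve f, m) \<in> sections F a"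
    using m(1) gen_sieve_J[OF f] by (auto simp: local_sections_def)
  have "m f = y" using m(2)[OF id_hom[OF b]] comp_id_left[OF f] sf_id[OF F b y] by simp
  then show ?thesis
    using that[OF pfun_class[OF s]] pfun_restrict_member[OF F s gen_sieve_self[OF f] f] by simp
qed

text \<open>The element \<open>w\<close> to be glued need not come from \<open>F\<close>, so it is
  restricted along some \<open>k\<close> to an element \<open>y\<close> of \<open>F\<close>.
  Separatedness of \<open>F\<close> makes the unit injective, which turns compatibility of
  \<open>w\<close> along \<open>f\<close> into compatibility of \<open>y\<close> along
  \<open>k \<cdot> f\<close>. The glued element restricts to \<open>w\<close> because
  \<open>k\<close> can be cancelled.\<close>

lemma at_sheaf_pfun:
  assumes F: "set_functor C F" and sep: "separated F"
  shows "at_sheaf (pfun F)"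
  unfolding at_sheaf_def
proof (intro conjI allI ballI impI set_functor_pfun separated_pfun F)
  fix a b f w assume f: "f \<in> hom C a b" and w: "w \<in> Fob (pfun F) b" and c: "at_compatible (pfun F) f w"
  note P = set_functor_pfun[OF F] and n = nat_trans_plus_unit[OF F]
  have b: "b \<in> Obj C" using f homD by blast
  have inj: "x = y" if "e \<in> Obj C" "x \<in> Fob F e" "y \<in> Fob F e" "plus_unit F e x = plus_unit F e y" for e x y
    using locally_injE[OF locally_inj_plus_unit[OF F] that] separatedD[OF sep _ that(2,3)] by metis
  obtain d k y where k: "k \<in> hom C b d" "y \<in> Fob F d" "plus_unit F d y = Fmap (pfun F) k w"
    using locally_surjE[OF locally_surj_plus_unit[OF F] b w] .
  have kf: "k \<cdot> f \<in> hom C a d" using comp_hom[OF f k(1)] .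
  have "Fmap F g y = Fmap F h y"
    if g: "g \<in> hom C d e" and h: "h \<in> hom C d e" and eq: "g \<cdot> (k \<cdot> f) = h \<cdot> (k \<cdot> f)" for e g h
  proof -
    have "(g \<cdot> k) \<cdot> f = (h \<cdot> k) \<cdot> f" using eq comp_assoc[OF f k(1)] g h by simp
    then have "Fmap (pfun F) (g \<cdot> k) w = Fmap (pfun F) (h \<cdot> k) w"
      using c comp_hom[OF k(1) g] comp_hom[OF k(1) h] homD[OF f] unfolding at_compatible_def by blast
    then have "plus_unit F e (Fmap F g y) = plus_unit F e (Fmap F h y)"
      using sf_comp[OF P k(1) g w] sf_comp[OF P k(1) h w] k(3) nt_nat[OF n g k(2)] nt_nat[OF n h k(2)]
      by simp
    then show ?thesis using inj sf_map[OF F g k(2)] sf_map[OF F h k(2)] homD[OF g] by blast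
  qed
  then obtain z where z: "z \<in> Fob (pfun F) a" "Fmap (pfun F) (k \<cdot> f) z = plus_unit F d y"
    using pfun_glue[OF F kf k(2)] by metis
  then have "Fmap (pfun F) f z = w"
    using separatedD[OF separated_pfun[OF F] k(1) sf_map[OF P f z(1)] w] k(3) sf_comp[OF P f k(1) z(1)]
    by simp
  then show "\<exists>x \<in> Fob (pfun F) a. Fmap (pfun F) f x = w" using z(1) by blast
qed

section \<open>The plus construction on natural transformations\<close>

definition section_map :: "('a \<Rightarrow> 'v \<Rightarrow> 'w) \<Rightarrow> 'b set \<times> ('b \<Rightarrow> 'v) \<Rightarrow> 'b set \<times> ('b \<Rightarrow> 'w)" where
  "section_map \<phi> = (\<lambda>(S, x). (S, \<lambda>f\<in>S. \<phi> (Cod C f) (x f)))"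

lemma section_map_in:
  assumes n: "nat_trans C F G \<phi>" and s: "s \<in> sections F c"
  shows "section_map \<phi> s \<in> sections G c"
proof -
  obtain S x f d where S: "s = (S, x)" "is_sieve C c S" "matching_family C F S x" "f \<in> S"
    using s by (rule sectionsE)
  have "matching_family C G S (\<lambda>f\<in>S. \<phi> (Cod C f) (x f))"
    unfolding matching_family_def
  proof (intro conjI ballI impI)
    fix f assume f: "f \<in> S"
    note fh = sieve_hom[OF S(2) f]
    then show "(\<lambda>f\<in>S. \<phi> (Cod C f) (x f)) f \<in> Fob G (Cod C f)"
      using nt_map[OF n _ mf_val[OF S(3) f fh]] f homD[OF fh] by simp
    fix g assume g: "g \<in> Arr C" "Dom C g = Cod C f"
    then have gh: "g \<in> hom C (Cod C f) (Cod C g)" by (auto simp: hom_def)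
    have "Cod C (g \<cdot> f) = Cod C g" using comp_hom[OF fh gh] by (auto simp: hom_def)
    then show "(\<lambda>f\<in>S. \<phi> (Cod C f) (x f)) (g \<cdot> f) = Fmap G g ((\<lambda>f\<in>S. \<phi> (Cod C f) (x f)) f)"
      using f sieve_comp[OF S(2) f fh gh] mf_comp[OF S(3) f fh gh]
        nt_nat[OF n gh mf_val[OF S(3) f fh]] by simp
  qed simp
  then show ?thesis using S by (auto simp: section_map_def sections_iff)
qed

lemma plus_map_class:
  assumes F: "set_functor C F" and G: "set_functor C G" and n: "nat_trans C F G \<phi>"
    and s: "s \<in> sections F c"
  shows "plus_map C (J_at C) G \<phi> c (prel F c `` {s}) = prel G c `` {section_map \<phi> s}"
proof -
  have "(section_map \<phi> s, section_map \<phi> t) \<in> prel G c" if st: "(s, t) \<in> prel F c" for s t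
  proof -
    obtain S x T y f b where "s = (S, x)" "t = (T, y)" "s \<in> sections F c" "t \<in> sections F c"
      "f \<in> S" "f \<in> T" "x f = y f" using st by (rule prelE)
    then show ?thesis using section_map_in[OF n, of s c] section_map_in[OF n, of t c]
      by (simp add: section_map_def prel_iff) (metis IntI)
  qed
  then show ?thesis
    using class_image[OF equiv_prel[OF F] equiv_prel[OF G] s]
    by (simp add: plus_map_def section_map_def)
qed

lemma nat_trans_plus_map:
  assumes F: "set_functor C F" and G: "set_functor C G" and n: "nat_trans C F G \<phi>"
  shows "nat_trans C (pfun F) (pfun G) (plus_map C (J_at C) G \<phi>)"
proof (rule nat_transI)
  fix a w assume "w \<in> Fob (pfun F) a"
  then show "plus_map C (J_at C) G \<phi> a w \<in> Fob (pfun G) a"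
    by (elim pfun_FobE) (auto simp: plus_map_class[OF F G n] intro!: pfun_class section_map_in[OF n])
next
  fix f a b w assume f: "f \<in> hom C a b" and w: "w \<in> Fob (pfun F) a"
  then obtain s where s: "s \<in> sections F a" "w = prel F a `` {s}" by (elim pfun_FobE)
  obtain S x where S: "s = (S, x)" by (cases s)
  have *: "h \<in> star b \<Longrightarrow> Cod C (h \<cdot> f) = Cod C h" for h
    using comp_hom[OF f, of h "Cod C h"] by (auto simp: star_def hom_def)
  have "section_map \<phi> (restrict_section C f s) = restrict_section C f (section_map \<phi> s)"
    by (auto simp: section_map_def S restrict_section_eq[OF f] restrict_def fun_eq_iff *)
  then show "plus_map C (J_at C) G \<phi> b (Fmap (pfun F) f w) =
      Fmap (pfun G) f (plus_map C (J_at C) G \<phi> a w)"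
    using pfun_Fmap[OF F f s(1)] pfun_Fmap[OF G f section_map_in[OF n s(1)]] s(2)
      plus_map_class[OF F G n s(1)] plus_map_class[OF F G n restrict_section_in[OF f s(1)]] by simp
qed

lemma plus_map_unit:
  assumes F: "set_functor C F" and G: "set_functor C G" and n: "nat_trans C F G \<phi>"
    and c: "c \<in> Obj C" and x: "x \<in> Fob F c"
  shows "plus_map C (J_at C) G \<phi> c (plus_unit F c x) = plus_unit G c (\<phi> c x)"
proof -
  have "\<phi> (Cod C h) (Fmap F h x) = Fmap G h (\<phi> c x)" if "h \<in> star c" for h
    using that nt_nat[OF n _ x, of h "Cod C h"] by (auto simp: star_def hom_def)
  then have "section_map \<phi> (unit_section F c x) = unit_section G c (\<phi> c x)"
    by (auto simp: section_map_def unit_section_def restrict_def fun_eq_iff)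
  then show ?thesis
    unfolding plus_unit_def using plus_map_class[OF F G n unit_section_in[OF F c x]] by simp
qed

section \<open>The associated sheaf and its unit\<close>

abbreviation shf :: "('a, 'b, 'v) setfun \<Rightarrow> ('a, 'b, ('b, 'v) sheaf_elem) setfun" where
  "shf \<equiv> sheafify C"

definition sheaf_unit :: "('a, 'b, 'v) setfun \<Rightarrow> 'a \<Rightarrow> 'v \<Rightarrow> ('b, 'v) sheaf_elem" where
  "sheaf_unit F e x = plus_unit (pfun F) e (plus_unit F e x)"

text \<open>The first plus construction makes a functor separated, the second makes a separated
  functor a sheaf. Later arguments see the associated sheaf only through these facts and through the
  naturality of \<open>sheafify_map\<close> and its effect on units.\<close>

lemma sheafify_facts:
  assumes F: "set_functor C F"
  shows "at_sheaf (shf F)" "nat_trans C F (shf F) (sheaf_unit F)"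
    "locally_inj F (sheaf_unit F)" "locally_surj F (shf F) (sheaf_unit F)"
proof -
  note P = set_functor_pfun[OF F]
  show "at_sheaf (shf F)"
    unfolding sheafify_def by (rule at_sheaf_pfun[OF P separated_pfun[OF F]])
  show "nat_trans C F (shf F) (sheaf_unit F)"
    unfolding sheafify_def sheaf_unit_def
    by (rule nat_trans_comp[OF nat_trans_plus_unit[OF F] nat_trans_plus_unit[OF P]])
  show "locally_inj F (sheaf_unit F)" "locally_surj F (shf F) (sheaf_unit F)"
    unfolding sheafify_def sheaf_unit_def
    using locally_inj_comp[OF F nat_trans_plus_unit[OF F] locally_inj_plus_unit[OF F]
        locally_inj_plus_unit[OF P]]
      locally_surj_comp[OF set_functor_pfun[OF P] nat_trans_plus_unit[OF P]
        locally_surj_plus_unit[OF F] locally_surj_plus_unit[OF P]] by simp_all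
qed

lemma nat_trans_sheafify_map:
  assumes F: "set_functor C F" and G: "set_functor C G" and n: "nat_trans C F G \<phi>"
  shows "nat_trans C (shf F) (shf G) (sheafify_map C G \<phi>)"
  unfolding sheafify_def sheafify_map_def
  by (intro nat_trans_plus_map set_functor_pfun F G n)

lemma sheafify_map_unit:
  assumes F: "set_functor C F" and G: "set_functor C G" and n: "nat_trans C F G \<phi>"
    and c: "c \<in> Obj C" and x: "x \<in> Fob F c"
  shows "sheafify_map C G \<phi> c (sheaf_unit F c x) = sheaf_unit G c (\<phi> c x)"
  unfolding sheaf_unit_def sheafify_map_def
  using plus_map_unit[OF set_functor_pfun[OF F] set_functor_pfun[OF G] nat_trans_plus_map[OF F G n] c
      nt_map[OF nat_trans_plus_unit[OF F] c x]] plus_map_unit[OF F G n c x] by simp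

text \<open>This removes sheafification from the conditions on triples. From left to right,
  equations between units become equations in \<open>F\<close> and \<open>G\<close> after a further
  restriction, because units are locally injective. From right to left, the inverse is the extension
  of the unit of \<open>F\<close> along the composite of \<phi> with the unit of \<open>G\<close>;
  both round trips are identities because they fix the images of elements of
  \<open>F\<close>.\<close>

lemma sheafify_map_iso_iff:
  assumes F: "set_functor C F" and G: "set_functor C G" and n: "nat_trans C F G \<phi>"
  shows "nat_iso C (shf F) (shf G) (sheafify_map C G \<phi>) \<longleftrightarrow> locally_inj F \<phi> \<and> locally_surj F G \<phi>"
proof
  note SF = sheafify_facts[OF F] and SG = sheafify_facts[OF G] and sm = nat_trans_sheafify_map[OF F G n]
    and smu = sheafify_map_unit[OF F G n]
  note SFf = at_sheafD[OF SF(1)] and SGf = at_sheafD[OF SG(1)]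
  {
    assume "nat_iso C (shf F) (shf G) (sheafify_map C G \<phi>)"
    then obtain \<theta> where \<theta>: "nat_trans C (shf G) (shf F) \<theta>"
      "\<And>a x. a \<in> Obj C \<Longrightarrow> x \<in> Fob (shf F) a \<Longrightarrow> \<theta> a (sheafify_map C G \<phi> a x) = x"
      "\<And>a x. a \<in> Obj C \<Longrightarrow> x \<in> Fob (shf G) a \<Longrightarrow> sheafify_map C G \<phi> a (\<theta> a x) = x"
      unfolding nat_iso_def by metis
    show "locally_inj F \<phi> \<and> locally_surj F G \<phi>"
      unfolding locally_inj_def locally_surj_def
    proof (intro conjI ballI impI)
      fix e x y assume e: "e \<in> Obj C" and x: "x \<in> Fob F e" and y: "y \<in> Fob F e" and eq: "\<phi> e x = \<phi> e y"
      then have "sheaf_unit F e x = sheaf_unit F e y"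
        using smu[OF e] \<theta>(2)[OF e] nt_map[OF SF(2) e] by metis
      then show "\<exists>d. \<exists>h \<in> hom C e d. Fmap F h x = Fmap F h y"
        using locally_injE[OF SF(3) e x y] by metis
    next
      fix e y assume e: "e \<in> Obj C" and y: "y \<in> Fob G e"
      have uy: "sheaf_unit G e y \<in> Fob (shf G) e" using nt_map[OF SG(2) e y] .
      define w where "w = \<theta> e (sheaf_unit G e y)"
      have w: "w \<in> Fob (shf F) e" "sheafify_map C G \<phi> e w = sheaf_unit G e y"
        using nt_map[OF \<theta>(1) e uy] \<theta>(3)[OF e uy] by (simp_all add: w_def)
      obtain d h x where h: "h \<in> hom C e d" "x \<in> Fob F d" "sheaf_unit F d x = Fmap (shf F) h w"
        using locally_surjE[OF SF(4) e w(1)] .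
      have d: "d \<in> Obj C" using h(1) homD by blast
      have "sheaf_unit G d (\<phi> d x) = sheaf_unit G d (Fmap G h y)"
        using smu[OF d h(2)] h(3) nt_nat[OF sm h(1) w(1)] w(2) nt_nat[OF SG(2) h(1) y] by simp
      then obtain b k where k: "k \<in> hom C d b" "Fmap G k (\<phi> d x) = Fmap G k (Fmap G h y)"
        using locally_injE[OF SG(3) d nt_map[OF n d h(2)] sf_map[OF G h(1) y]] by metis
      then have "\<phi> b (Fmap F k x) = Fmap G (k \<cdot> h) y"
        using nt_nat[OF n k(1) h(2)] sf_comp[OF G h(1) k(1) y] by simp
      then show "\<exists>d. \<exists>h \<in> hom C e d. \<exists>x \<in> Fob F d. \<phi> d x = Fmap G h y"
        using comp_hom[OF h(1) k(1)] sf_map[OF F k(1) h(2)] by blast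
    qed
  }
  assume "locally_inj F \<phi> \<and> locally_surj F G \<phi>"
  then have li: "locally_inj F \<phi>" and ls: "locally_surj F G \<phi>" by auto
  have LI: "locally_inj F (\<lambda>e x. sheaf_unit G e (\<phi> e x))"
    using locally_inj_comp[OF F n li SG(3)] .
  have LS: "locally_surj F (shf G) (\<lambda>e x. sheaf_unit G e (\<phi> e x))"
    using locally_surj_comp[OF SGf(1) SG(2) ls SG(4)] .
  have N: "nat_trans C F (shf G) (\<lambda>e x. sheaf_unit G e (\<phi> e x))"
    using nat_trans_comp[OF n SG(2)] .
  have ker: "sheaf_unit F e x = sheaf_unit F e y" if "e \<in> Obj C" "x \<in> Fob F e" "y \<in> Fob F e"
    "sheaf_unit G e (\<phi> e x) = sheaf_unit G e (\<phi> e y)" for e x y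
  proof -
    note xy = that
    obtain d h where h: "h \<in> hom C e d" "Fmap F h x = Fmap F h y"
      using locally_injE[OF LI xy] .
    then show ?thesis
      using separatedD[OF SFf(2) h(1)] nt_map[OF SF(2) xy(1)] nt_nat[OF SF(2) h(1)] xy(2,3) by metis
  qed
  obtain \<theta> where \<theta>: "nat_trans C (shf G) (shf F) \<theta>"
    "\<And>e x. e \<in> Obj C \<Longrightarrow> x \<in> Fob F e \<Longrightarrow> \<theta> e (sheaf_unit G e (\<phi> e x)) = sheaf_unit F e x"
    using extend_along_locally_surj[OF F SGf(1) SF(1) N LS SF(2) ker] by blast
  have "\<theta> a (sheafify_map C G \<phi> a w) = w" if "a \<in> Obj C" "w \<in> Fob (shf F) a" for a w
    by (rule nat_trans_eq_if_locally_surj[OF nat_trans_comp[OF sm \<theta>(1)] nat_trans_id SFf(2) SF(4)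
          _ that]) (simp add: smu \<theta>(2))
  moreover have "sheafify_map C G \<phi> a (\<theta> a w) = w" if "a \<in> Obj C" "w \<in> Fob (shf G) a" for a w
    by (rule nat_trans_eq_if_locally_surj[OF nat_trans_comp[OF \<theta>(1) sm] nat_trans_id SGf(2) LS
          _ that]) (simp add: smu \<theta>(2))
  ultimately show "nat_iso C (shf F) (shf G) (sheafify_map C G \<phi>)"
    unfolding nat_iso_def using sm \<theta>(1) by blast
qed

end

section \<open>Quotients of representables and sheaves with a generator\<close>

context amalg_category
begin

section \<open>Equivalence relations: kernels, closure, generation\<close>

lemma eqrel_equiv: "eqrel C F R \<Longrightarrow> e \<in> Obj C \<Longrightarrow> equiv (Fob F e) (R e)"
  by (simp add: eqrel_def)

lemma eqrel_map: "eqrel C F R \<Longrightarrow> f \<in> hom C a b \<Longrightarrow> (x, y) \<in> R a \<Longrightarrow> (Fmap F f x, Fmap F f y) \<in> R b"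
  by (force simp: eqrel_def hom_def)

lemma eqrel_in:
  assumes "eqrel C F R" "(x, y) \<in> R e"
  shows "e \<in> Obj C" "x \<in> Fob F e" "y \<in> Fob F e"
proof -
  show e: "e \<in> Obj C" using assms unfolding eqrel_def by blast
  show "x \<in> Fob F e" "y \<in> Fob F e"
    using equiv_type[OF eqrel_equiv[OF assms(1) e]] assms(2) by auto
qed

lemma eqrel_refl: "eqrel C F R \<Longrightarrow> e \<in> Obj C \<Longrightarrow> x \<in> Fob F e \<Longrightarrow> (x, x) \<in> R e"
  using eqrel_equiv by (meson equiv_def refl_onD)

lemma eqrel_sym: "eqrel C F R \<Longrightarrow> (x, y) \<in> R e \<Longrightarrow> (y, x) \<in> R e"
  using eqrel_equiv eqrel_in(1) by (meson equiv_def symD)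

lemma eqrel_trans: "eqrel C F R \<Longrightarrow> (x, y) \<in> R e \<Longrightarrow> (y, z) \<in> R e \<Longrightarrow> (x, z) \<in> R e"
  using eqrel_equiv eqrel_in(1) by (meson equiv_def transD)

lemma eqrelI:
  assumes "\<And>e x y. (x, y) \<in> R e \<Longrightarrow> e \<in> Obj C \<and> x \<in> Fob F e \<and> y \<in> Fob F e"
    and "\<And>e x. e \<in> Obj C \<Longrightarrow> x \<in> Fob F e \<Longrightarrow> (x, x) \<in> R e"
    and "\<And>e x y. (x, y) \<in> R e \<Longrightarrow> (y, x) \<in> R e"
    and "\<And>e x y z. (x, y) \<in> R e \<Longrightarrow> (y, z) \<in> R e \<Longrightarrow> (x, z) \<in> R e"
    and "\<And>f a b x y. f \<in> hom C a b \<Longrightarrow> (x, y) \<in> R a \<Longrightarrow> (Fmap F f x, Fmap F f y) \<in> R b"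
  shows "eqrel C F R"
  unfolding eqrel_def
proof (intro conjI ballI allI impI)
  fix e assume "e \<in> Obj C"
  then show "equiv (Fob F e) (R e)"
    by (intro equivI refl_onI symI transI subrelI) (simp_all add: assms(1,2), (blast intro: assms(3,4))+)
next
  fix e assume "e \<notin> Obj C"
  then show "R e = {}" using assms(1) by auto
next
  fix f p assume "f \<in> Arr C" "p \<in> R (Dom C f)"
  then show "case p of (x, y) \<Rightarrow> (Fmap F f x, Fmap F f y) \<in> R (Cod C f)"
    using assms(5)[OF arr_hom] by (cases p) simp
qed

text \<open>The clause \<open>e \<in> Obj C\<close> is there because \<open>eqrel\<close> demands
  the empty relation outside the objects.\<close>

definition ker_rel :: "('a, 'b, 'v) setfun \<Rightarrow> ('a \<Rightarrow> 'v \<Rightarrow> 'w) \<Rightarrow> 'a \<Rightarrow> ('v \<times> 'v) set" where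
  "ker_rel F \<phi> e = {(x, y). e \<in> Obj C \<and> x \<in> Fob F e \<and> y \<in> Fob F e \<and> \<phi> e x = \<phi> e y}"

lemma ker_rel_iff: "(x, y) \<in> ker_rel F \<phi> e \<longleftrightarrow> e \<in> Obj C \<and> x \<in> Fob F e \<and> y \<in> Fob F e \<and> \<phi> e x = \<phi> e y"
  by (simp add: ker_rel_def)

text \<open>Preimages of equivalence relations serve as test relations: a generated relation lies in
  a preimage as soon as its generators do.\<close>

lemma eqrel_vimage:
  assumes F: "set_functor C F" and n: "nat_trans C F G \<phi>" and E: "eqrel C G E"
  shows "eqrel C F (\<lambda>e. {(x, y). e \<in> Obj C \<and> x \<in> Fob F e \<and> y \<in> Fob F e \<and> (\<phi> e x, \<phi> e y) \<in> E e})"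
proof (rule eqrelI)
  fix f a b x y
  assume f: "f \<in> hom C a b"
    and xy: "(x, y) \<in> {(x, y). a \<in> Obj C \<and> x \<in> Fob F a \<and> y \<in> Fob F a \<and> (\<phi> a x, \<phi> a y) \<in> E a}"
  then have "(Fmap G f (\<phi> a x), Fmap G f (\<phi> a y)) \<in> E b" using eqrel_map[OF E f] by simp
  then show "(Fmap F f x, Fmap F f y) \<in>
      {(x, y). b \<in> Obj C \<and> x \<in> Fob F b \<and> y \<in> Fob F b \<and> (\<phi> b x, \<phi> b y) \<in> E b}"
    using xy sf_map[OF F f] homD[OF f] nt_nat[OF n f] by simp
qed (auto intro: eqrel_refl[OF E] nt_map[OF n] eqrel_sym[OF E] eqrel_trans[OF E])

lemma eqrel_ker_rel:
  assumes F: "set_functor C F" and n: "nat_trans C F G \<phi>"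
  shows "eqrel C F (ker_rel F \<phi>)"
  by (rule eqrelI) (auto simp: ker_rel_iff sf_map[OF F] nt_nat[OF n] homD)

lemma at_closure_iff: "(x, y) \<in> at_closure C F R e \<longleftrightarrow>
    x \<in> Fob F e \<and> y \<in> Fob F e \<and> (\<exists>d. \<exists>h \<in> hom C e d. (Fmap F h x, Fmap F h y) \<in> R d)"
  by (auto simp: at_closure_def hom_def)

lemma closed_eqrelD:
  assumes R: "closed_eqrel C F R" and h: "h \<in> hom C e d" and x: "x \<in> Fob F e" "y \<in> Fob F e"
    and r: "(Fmap F h x, Fmap F h y) \<in> R d"
  shows "(x, y) \<in> R e"
proof -
  have "(x, y) \<in> at_closure C F R e" using assms by (auto simp: at_closure_iff)
  then show ?thesis using R by (simp add: closed_eqrel_def)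
qed

lemma closed_eqrelI:
  assumes F: "set_functor C F" and R: "eqrel C F R"
    and c: "\<And>h e d x y. h \<in> hom C e d \<Longrightarrow> x \<in> Fob F e \<Longrightarrow> y \<in> Fob F e \<Longrightarrow>
      (Fmap F h x, Fmap F h y) \<in> R d \<Longrightarrow> (x, y) \<in> R e"
  shows "closed_eqrel C F R"
proof -
  have "(x, y) \<in> at_closure C F R e \<longleftrightarrow> (x, y) \<in> R e" for e x y
  proof
    assume "(x, y) \<in> at_closure C F R e" then show "(x, y) \<in> R e"
      using c by (auto simp: at_closure_iff)
  next
    assume a: "(x, y) \<in> R e"
    note i = eqrel_in[OF R a]
    show "(x, y) \<in> at_closure C F R e"
      unfolding at_closure_iff using a i id_hom[OF i(1)] sf_id[OF F i(1)] by metis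
  qed
  then have "at_closure C F R = R" by (intro ext) auto
  then show ?thesis using R by (simp add: closed_eqrel_def)
qed

text \<open>In a separated functor equality after restriction along \<open>h\<close> is equality, so
  the closure of a kernel adds no pairs.\<close>

lemma closed_ker_rel:
  assumes F: "set_functor C F" and n: "nat_trans C F G \<phi>" and G: "separated G"
  shows "closed_eqrel C F (ker_rel F \<phi>)"
proof (rule closed_eqrelI[OF F eqrel_ker_rel[OF F n]])
  fix h e d x y assume h: "h \<in> hom C e d" and xy: "x \<in> Fob F e" "y \<in> Fob F e"
    and "(Fmap F h x, Fmap F h y) \<in> ker_rel F \<phi> d"
  then show "(x, y) \<in> ker_rel F \<phi> e"
    using separatedD[OF G h nt_map[OF n _ xy(1)] nt_map[OF n _ xy(2)]] nt_nat[OF n h] homD[OF h]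
    by (simp add: ker_rel_iff)
qed

lemma eqrel_generated_eqrel:
  assumes F: "set_functor C F"
  shows "eqrel C F (eqrel_generated C F S)"
proof (rule eqrelI)
  fix f a b x y assume f: "f \<in> hom C a b" and "(x, y) \<in> eqrel_generated C F S a"
  then show "(Fmap F f x, Fmap F f y) \<in> eqrel_generated C F S b"
    using sf_map[OF F f] homD[OF f] eqrel_map[OF _ f, of F _ x y]
    unfolding eqrel_generated_def by blast
next
  fix e x y z assume "(x, y) \<in> eqrel_generated C F S e" "(y, z) \<in> eqrel_generated C F S e"
  then show "(x, z) \<in> eqrel_generated C F S e"
    by (simp add: eqrel_generated_def) (metis eqrel_trans)
qed (auto simp: eqrel_generated_def intro: eqrel_refl eqrel_sym)

lemma eqrel_generated_incl:
  "e \<in> Obj C \<Longrightarrow> (x, y) \<in> S e \<Longrightarrow> x \<in> Fob F e \<Longrightarrow> y \<in> Fob F e \<Longrightarrow> (x, y) \<in> eqrel_generated C F S e"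
  by (auto simp: eqrel_generated_def)

lemma eqrel_generated_least:
  assumes E: "eqrel C F E" and S: "\<And>e x y. e \<in> Obj C \<Longrightarrow> (x, y) \<in> S e \<Longrightarrow> (x, y) \<in> E e"
    and r: "(x, y) \<in> eqrel_generated C F S e"
  shows "(x, y) \<in> E e"
proof -
  have "\<forall>e \<in> Obj C. S e \<subseteq> E e" using S by auto
  then show ?thesis using r E by (auto simp: eqrel_generated_def)
qed

section \<open>Quotients and the arrows induced on them\<close>

lemma quot_Fob: "Fob (quot C F R) e = Fob F e // R e"
  by (simp add: quot_def)

lemma proj_in: "x \<in> Fob F e \<Longrightarrow> proj R e x \<in> Fob (quot C F R) e"
  by (auto simp: quot_Fob proj_def intro: quotientI)

lemma quot_FobE:
  assumes "X \<in> Fob (quot C F R) e"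
  obtains x where "x \<in> Fob F e" "X = proj R e x"
  using assms by (auto simp: quot_Fob proj_def elim: quotientE)

lemma proj_eq_iff: "eqrel C F R \<Longrightarrow> e \<in> Obj C \<Longrightarrow> x \<in> Fob F e \<Longrightarrow> y \<in> Fob F e \<Longrightarrow>
    proj R e x = proj R e y \<longleftrightarrow> (x, y) \<in> R e"
  unfolding proj_def using eq_equiv_class_iff[OF eqrel_equiv] .

lemma quot_Fmap:
  assumes F: "set_functor C F" and R: "eqrel C F R" and f: "f \<in> hom C a b" and x: "x \<in> Fob F a"
  shows "Fmap (quot C F R) f (proj R a x) = proj R b (Fmap F f x)"
proof -
  have "a \<in> Obj C" "b \<in> Obj C" "Cod C f = b" using homD[OF f] by auto
  then show ?thesis
    using class_image[OF eqrel_equiv[OF R] eqrel_equiv[OF R] x eqrel_map[OF R f]]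
    by (simp add: quot_def proj_def)
qed

lemma set_functor_quot:
  assumes F: "set_functor C F" and R: "eqrel C F R"
  shows "set_functor C (quot C F R)"
proof (rule set_functorI)
  fix f a b X assume f: "f \<in> hom C a b" and "X \<in> Fob (quot C F R) a"
  then show "Fmap (quot C F R) f X \<in> Fob (quot C F R) b"
    by (auto elim!: quot_FobE simp: quot_Fmap[OF F R f] intro!: proj_in sf_map[OF F f])
next
  fix a X assume a: "a \<in> Obj C" and "X \<in> Fob (quot C F R) a"
  then show "Fmap (quot C F R) (Id C a) X = X"
    by (auto elim!: quot_FobE simp: quot_Fmap[OF F R id_hom[OF a]] sf_id[OF F a])
next
  fix f g a b d X assume f: "f \<in> hom C a b" and g: "g \<in> hom C b d" and "X \<in> Fob (quot C F R) a"
  then show "Fmap (quot C F R) (g \<cdot> f) X = Fmap (quot C F R) g (Fmap (quot C F R) f X)"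
    by (auto elim!: quot_FobE simp: quot_Fmap[OF F R f] quot_Fmap[OF F R g]
        quot_Fmap[OF F R comp_hom[OF f g]] sf_comp[OF F f g] sf_map[OF F f])
qed

lemma nat_trans_proj:
  assumes "set_functor C F" "eqrel C F R"
  shows "nat_trans C F (quot C F R) (proj R)"
  by (rule nat_transI) (auto simp: quot_Fmap[OF assms] intro: proj_in)

lemma separated_quot:
  assumes F: "set_functor C F" and R: "closed_eqrel C F R"
  shows "separated (quot C F R)"
  unfolding separated_def
proof (intro allI ballI impI)
  fix a b f X Y assume f: "f \<in> hom C a b" and X: "X \<in> Fob (quot C F R) a" and Y: "Y \<in> Fob (quot C F R) a"
    and eq: "Fmap (quot C F R) f X = Fmap (quot C F R) f Y"
  have E: "eqrel C F R" using R by (simp add: closed_eqrel_def)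
  obtain x where x: "x \<in> Fob F a" "X = proj R a x" using X by (elim quot_FobE)
  obtain y where y: "y \<in> Fob F a" "Y = proj R a y" using Y by (elim quot_FobE)
  have ab: "a \<in> Obj C" "b \<in> Obj C" using homD[OF f] by auto
  have "(Fmap F f x, Fmap F f y) \<in> R b"
    using eq x y quot_Fmap[OF F E f] proj_eq_iff[OF E ab(2)] sf_map[OF F f] by simp
  then show "X = Y" using closed_eqrelD[OF R f x(1) y(1)] x y proj_eq_iff[OF E ab(1)] by simp
qed

text \<open>Constancy on the class makes its image a singleton, so that the \<open>the_elem\<close>
  inside \<open>induced\<close> is meaningful.\<close>

lemma induced_proj:
  assumes R: "eqrel C F R" and e: "e \<in> Obj C" and x: "x \<in> Fob F e"
    and c: "\<And>y. (x, y) \<in> R e \<Longrightarrow> \<phi> e x = \<phi> e y"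
  shows "induced \<phi> e (proj R e x) = \<phi> e x"
proof -
  have "(x, x) \<in> R e" using eqrel_refl[OF R e x] .
  moreover have "z = \<phi> e x" if z: "z \<in> \<phi> e ` (R e `` {x})" for z
  proof -
    obtain y where "(x, y) \<in> R e" "z = \<phi> e y" using z by blast
    then show ?thesis using c[of y] by simp
  qed
  ultimately have "\<phi> e ` (R e `` {x}) = {\<phi> e x}" by blast
  then show ?thesis by (simp add: induced_def proj_def)
qed

lemma nat_trans_induced:
  assumes F: "set_functor C F" and R: "eqrel C F R" and n: "nat_trans C F G \<phi>"
    and c: "\<And>e x y. (x, y) \<in> R e \<Longrightarrow> \<phi> e x = \<phi> e y"
  shows "nat_trans C (quot C F R) G (induced \<phi>)"
proof (rule nat_transI)
  fix a X assume "a \<in> Obj C" "X \<in> Fob (quot C F R) a"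
  then show "induced \<phi> a X \<in> Fob G a"
    by (auto elim!: quot_FobE simp: induced_proj[where \<phi> = \<phi>, OF R _ _ c] intro: nt_map[OF n])
next
  fix f a b X assume f: "f \<in> hom C a b" and "X \<in> Fob (quot C F R) a"
  then obtain x where x: "x \<in> Fob F a" "X = proj R a x" by (elim quot_FobE)
  have ab: "a \<in> Obj C" "b \<in> Obj C" using homD[OF f] by auto
  show "induced \<phi> b (Fmap (quot C F R) f X) = Fmap G f (induced \<phi> a X)"
    using quot_Fmap[OF F R f x(1)] induced_proj[where \<phi> = \<phi>, OF R ab(1) x(1) c] sf_map[OF F f x(1)]
      induced_proj[where \<phi> = \<phi>, OF R ab(2) sf_map[OF F f x(1)] c] nt_nat[OF n f x(1)] x(2) by simp
qed

section \<open>Representables, evaluation and generators\<close>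

lemma yoneda_simps [simp]: "Fob (yoneda C c) e = hom C c e" "Fmap (yoneda C c) f \<chi> = f \<cdot> \<chi>"
  by (simp_all add: yoneda_def)

lemma set_functor_yoneda: "set_functor C (yoneda C c)"
  by (rule set_functorI) (auto intro: comp_hom comp_id_left comp_assoc)

text \<open>The natural transformation from the representable functor to \<open>T\<close> that
  corresponds to \<open>t\<close> under the Yoneda lemma.\<close>

definition ev :: "('a, 'b, 'v) setfun \<Rightarrow> 'v \<Rightarrow> 'a \<Rightarrow> 'b \<Rightarrow> 'v" where
  "ev T t e \<chi> = Fmap T \<chi> t"

lemma nat_trans_ev:
  assumes T: "set_functor C T" and t: "t \<in> Fob T c"
  shows "nat_trans C (yoneda C c) T (ev T t)"
  by (rule nat_transI) (auto simp: ev_def sf_map[OF T _ t] sf_comp[OF T _ _ t])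

definition ev_ker :: "'a \<Rightarrow> ('a, 'b, 'v) setfun \<Rightarrow> 'v \<Rightarrow> ('a, 'b) rel_family" where
  "ev_ker c T t = ker_rel (yoneda C c) (ev T t)"

lemma ev_ker_iff: "(\<chi>, \<xi>) \<in> ev_ker c T t e \<longleftrightarrow>
    \<chi> \<in> hom C c e \<and> \<xi> \<in> hom C c e \<and> Fmap T \<chi> t = Fmap T \<xi> t"
  using homD by (auto simp: ev_ker_def ker_rel_iff ev_def)

lemma closed_ev_ker:
  assumes T: "set_functor C T" "separated T" and t: "t \<in> Fob T c"
  shows "closed_eqrel C (yoneda C c) (ev_ker c T t)"
  unfolding ev_ker_def by (rule closed_ker_rel[OF set_functor_yoneda nat_trans_ev[OF T(1) t] T(2)])

text \<open>Sheaves with a generator: \<open>T\<close> is the sheaf associated to \<open>yc/R\<close>, and \<open>t\<close> is the image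
  of the identity of \<open>c\<close>.\<close>

definition generates :: "'a \<Rightarrow> ('a, 'b) rel_family \<Rightarrow> ('a, 'b, 'v) setfun \<Rightarrow> 'v \<Rightarrow> bool" where
  "generates c R T t \<longleftrightarrow> at_sheaf T \<and> c \<in> Obj C \<and> t \<in> Fob T c \<and> R = ev_ker c T t \<and>
     locally_surj (yoneda C c) T (ev T t)"

lemma generatesD:
  assumes "generates c R T t"
  shows "at_sheaf T" "set_functor C T" "separated T" "c \<in> Obj C" "t \<in> Fob T c" "R = ev_ker c T t"
    "locally_surj (yoneda C c) T (ev T t)"
  using assms at_sheafD by (auto simp: generates_def)

lemma generates_loc:
  assumes "generates c R T t" "e \<in> Obj C" "w \<in> Fob T e"
  obtains d h \<chi> where "h \<in> hom C e d" "\<chi> \<in> hom C c d" "Fmap T \<chi> t = Fmap T h w"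
  using generatesD(7)[OF assms(1)] assms(2,3) unfolding locally_surj_def ev_def
  by (metis yoneda_simps(1))

text \<open>Evaluation at \<open>z\<close> extends along evaluation at \<open>t\<close>, which is
  locally surjective with kernel exactly \<open>R\<close>. This is the universal property of a sheaf
  presented by one generator and the relations \<open>R\<close>.\<close>

lemma generates_map:
  assumes g: "generates c R T t" and G: "at_sheaf G" and z: "z \<in> Fob G c"
    and R: "\<And>e \<chi> \<xi>. (\<chi>, \<xi>) \<in> R e \<Longrightarrow> Fmap G \<chi> z = Fmap G \<xi> z"
  obtains \<phi> where "nat_trans C T G \<phi>" "\<phi> c t = z"
proof -
  note gD = generatesD[OF g] and Gf = at_sheafD(1)[OF G]
  obtain \<phi> where \<phi>: "nat_trans C T G \<phi>"
    "\<And>e \<chi>. e \<in> Obj C \<Longrightarrow> \<chi> \<in> Fob (yoneda C c) e \<Longrightarrow> \<phi> e (ev T t e \<chi>) = ev G z e \<chi>"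
  proof (rule extend_along_locally_surj[OF set_functor_yoneda gD(2) G
        nat_trans_ev[OF gD(2,5)] gD(7) nat_trans_ev[OF Gf z]])
    fix e \<chi> \<xi> assume "\<chi> \<in> Fob (yoneda C c) e" "\<xi> \<in> Fob (yoneda C c) e" "ev T t e \<chi> = ev T t e \<xi>"
    then have "(\<chi>, \<xi>) \<in> R e" by (simp add: gD(6) ev_ker_iff ev_def)
    then show "ev G z e \<chi> = ev G z e \<xi>" using R by (simp add: ev_def)
  qed blast
  have "\<phi> c t = z"
    using \<phi>(2)[OF gD(4), of "Id C c"] id_hom[OF gD(4)] sf_id[OF gD(2,4,5)] sf_id[OF Gf gD(4) z]
    by (simp add: ev_def)
  with \<phi>(1) show ?thesis using that by blast
qed

lemma generates_map_unique:
  assumes g: "generates c R T t" and G: "separated G"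
    and n: "nat_trans C T G \<phi>" "nat_trans C T G \<psi>" and eq: "\<phi> c t = \<psi> c t"
    and e: "e \<in> Obj C" "w \<in> Fob T e"
  shows "\<phi> e w = \<psi> e w"
proof -
  note gD = generatesD[OF g]
  show ?thesis
  proof (rule nat_trans_eq_if_locally_surj[OF n G gD(7) _ e])
    fix e \<chi> assume "e \<in> Obj C" "\<chi> \<in> Fob (yoneda C c) e"
    then show "\<phi> e (ev T t e \<chi>) = \<psi> e (ev T t e \<chi>)"
      using nt_nat[OF n(1) _ gD(5)] nt_nat[OF n(2) _ gD(5)] eq by (simp add: ev_def)
  qed
qed

lemma ev_ker_incl:
  assumes n: "nat_trans C T G \<phi>" and t: "t \<in> Fob T c" and r: "(\<chi>, \<xi>) \<in> ev_ker c T t e"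
  shows "Fmap G \<chi> (\<phi> c t) = Fmap G \<xi> (\<phi> c t)"
  using r nt_nat[OF n _ t] by (metis ev_ker_iff)

text \<open>A copy of \<open>G\<close> along maps \<open>j e\<close>, meant to be injective, into
  another value type. The default values, empty sets off the objects and \<open>undefined\<close>
  off the domains, are those required by \<open>extensional_setfun\<close>.\<close>

definition transport_fun :: "('a, 'b, 'v) setfun \<Rightarrow> ('a \<Rightarrow> 'v \<Rightarrow> 'w) \<Rightarrow> ('a, 'b, 'w) setfun" where
  "transport_fun G j = \<lparr>Fob = (\<lambda>e. if e \<in> Obj C then j e ` Fob G e else {}),
     Fmap = (\<lambda>f y. if f \<in> Arr C \<and> y \<in> j (Dom C f) ` Fob G (Dom C f)
       then j (Cod C f) (Fmap G f (inv_into (Fob G (Dom C f)) (j (Dom C f)) y)) else undefined)\<rparr>"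

lemma transport_fun_Fmap:
  assumes "inj_on (j a) (Fob G a)" "f \<in> hom C a b" "x \<in> Fob G a"
  shows "Fmap (transport_fun G j) f (j a x) = j b (Fmap G f x)"
  using assms homD[OF assms(2)] by (simp add: transport_fun_def)

lemma transport_fun_Fob: "e \<in> Obj C \<Longrightarrow> Fob (transport_fun G j) e = j e ` Fob G e"
  by (simp add: transport_fun_def)

lemma extensional_transport_fun: "extensional_setfun C (transport_fun G j)"
  using dom_obj by (auto simp: extensional_setfun_def transport_fun_def)

lemma at_sheaf_transport_fun:
  assumes G: "at_sheaf G" and j: "\<And>e. e \<in> Obj C \<Longrightarrow> inj_on (j e) (Fob G e)"
  shows "at_sheaf (transport_fun G j)"
proof -
  note Gf = at_sheafD(1)[OF G] and Gs = at_sheafD(2)[OF G]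
  have map: "Fmap (transport_fun G j) f (j a x) = j b (Fmap G f x)"
    if "f \<in> hom C a b" "x \<in> Fob G a" for f a b x
    by (rule transport_fun_Fmap) (use j that homD[OF that(1)] in auto)
  have elem: "\<exists>x \<in> Fob G e. y = j e x" if "e \<in> Obj C" "y \<in> Fob (transport_fun G j) e" for e y
    using that by (auto simp: transport_fun_Fob)
  have "set_functor C (transport_fun G j)"
  proof (rule set_functorI)
    fix f a b y assume f: "f \<in> hom C a b" and y: "y \<in> Fob (transport_fun G j) a"
    then obtain x where "x \<in> Fob G a" "y = j a x" using elem homD by blast
    then show "Fmap (transport_fun G j) f y \<in> Fob (transport_fun G j) b"
      using map[OF f] sf_map[OF Gf f] homD[OF f] by (simp add: transport_fun_Fob)
  next
    fix a y assume a: "a \<in> Obj C" and y: "y \<in> Fob (transport_fun G j) a"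
    then obtain x where "x \<in> Fob G a" "y = j a x" using elem by blast
    then show "Fmap (transport_fun G j) (Id C a) y = y"
      using map[OF id_hom[OF a]] sf_id[OF Gf a] by simp
  next
    fix f g a b d y
    assume f: "f \<in> hom C a b" and g: "g \<in> hom C b d" and y: "y \<in> Fob (transport_fun G j) a"
    then obtain x where "x \<in> Fob G a" "y = j a x" using elem homD by blast
    then show "Fmap (transport_fun G j) (g \<cdot> f) y =
        Fmap (transport_fun G j) g (Fmap (transport_fun G j) f y)"
      using map[OF f] map[OF g] map[OF comp_hom[OF f g]] sf_map[OF Gf f] sf_comp[OF Gf f g] by simp
  qed
  moreover have "separated (transport_fun G j)"
    unfolding separated_def
  proof (intro allI ballI impI)
    fix a b f y z assume f: "f \<in> hom C a b" and y: "y \<in> Fob (transport_fun G j) a"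
      and z: "z \<in> Fob (transport_fun G j) a"
      and eq: "Fmap (transport_fun G j) f y = Fmap (transport_fun G j) f z"
    have ab: "a \<in> Obj C" "b \<in> Obj C" using homD[OF f] by auto
    obtain x where x: "x \<in> Fob G a" "y = j a x" using elem[OF ab(1) y] by blast
    obtain x' where x': "x' \<in> Fob G a" "z = j a x'" using elem[OF ab(1) z] by blast
    have "Fmap G f x = Fmap G f x'"
      using eq x x' map[OF f] inj_onD[OF j[OF ab(2)]] sf_map[OF Gf f] by simp
    then show "y = z" using separatedD[OF Gs f] x x' by blast
  qed
  moreover have "\<exists>x \<in> Fob (transport_fun G j) a. Fmap (transport_fun G j) f x = y"
    if f: "f \<in> hom C a b" and y: "y \<in> Fob (transport_fun G j) b"
      and c: "at_compatible (transport_fun G j) f y" for a b f y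
  proof -
    have ab: "a \<in> Obj C" "b \<in> Obj C" "Cod C f = b" using homD[OF f] by auto
    obtain x where x: "x \<in> Fob G b" "y = j b x" using elem[OF ab(2) y] by blast
    have "Fmap G h x = Fmap G k x" if h: "h \<in> hom C b d" and k: "k \<in> hom C b d" and eq: "h \<cdot> f = k \<cdot> f" for d h k
    proof -
      have "Fmap (transport_fun G j) h y = Fmap (transport_fun G j) k y"
        using c h k eq ab(3) unfolding at_compatible_def by blast
      then show ?thesis
        using map[OF h x(1)] map[OF k x(1)] x(2) inj_onD[OF j, of d] homD[OF h] sf_map[OF Gf h x(1)]
          sf_map[OF Gf k x(1)] by simp
    qed
    then obtain v where "v \<in> Fob G a" "Fmap G f v = x" using at_sheaf_glue[OF G f x(1)] by blast
    then show ?thesis using map[OF f, of v] x(2) ab(1) by (auto simp: transport_fun_Fob)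
  qed
  ultimately show ?thesis by (auto simp: at_sheaf_def)
qed

lemma generates_transport_fun:
  assumes g: "generates c R T t" and j: "\<And>e. e \<in> Obj C \<Longrightarrow> inj_on (j e) (Fob T e)"
  shows "generates c R (transport_fun T j) (j c t)"
proof -
  note gD = generatesD[OF g]
  have map: "Fmap (transport_fun T j) f (j a x) = j b (Fmap T f x)"
    if "f \<in> hom C a b" "x \<in> Fob T a" for f a b x
    by (rule transport_fun_Fmap) (use j that homD[OF that(1)] in auto)
  have "(\<chi>, \<xi>) \<in> R e \<longleftrightarrow> (\<chi>, \<xi>) \<in> ev_ker c (transport_fun T j) (j c t) e" for \<chi> \<xi> e
  proof (cases "\<chi> \<in> hom C c e \<and> \<xi> \<in> hom C c e")
    case True
    then show ?thesis
      using map[OF _ gD(5), of _ e] inj_on_eq_iff[OF j[of e]] sf_map[OF gD(2) _ gD(5), of _ e] homD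
      unfolding gD(6) ev_ker_iff by metis
  qed (auto simp: gD(6) ev_ker_iff)
  then have R: "R = ev_ker c (transport_fun T j) (j c t)" by (intro ext) auto
  have "locally_surj (yoneda C c) (transport_fun T j) (ev (transport_fun T j) (j c t))"
    unfolding locally_surj_def
  proof (intro ballI)
    fix e y assume e: "e \<in> Obj C" and "y \<in> Fob (transport_fun T j) e"
    then obtain w where w: "w \<in> Fob T e" "y = j e w" by (auto simp: transport_fun_Fob)
    obtain d h \<chi> where h: "h \<in> hom C e d" "\<chi> \<in> hom C c d" "Fmap T \<chi> t = Fmap T h w"
      using generates_loc[OF g e w(1)] .
    then have "ev (transport_fun T j) (j c t) d \<chi> = Fmap (transport_fun T j) h y"
      using map[OF h(1) w(1)] map[OF h(2) gD(5)] w(2) by (simp add: ev_def)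
    then show "\<exists>d. \<exists>h \<in> hom C e d. \<exists>x \<in> Fob (yoneda C c) d.
        ev (transport_fun T j) (j c t) d x = Fmap (transport_fun T j) h y"
      using h by auto
  qed
  then show ?thesis
    using R gD(4,5) at_sheaf_transport_fun[OF gD(1) j] by (simp add: generates_def transport_fun_Fob)
qed

section \<open>Associated sheaves of quotients of representables, and their size\<close>

lemma ce_objectsD: "(c, R) \<in> ce_objects C \<Longrightarrow> c \<in> Obj C \<and> closed_eqrel C (yoneda C c) R \<and> eqrel C (yoneda C c) R"
  by (auto simp: ce_objects_def closed_eqrel_def)

lemma set_functor_yquot: "eqrel C (yoneda C c) R \<Longrightarrow> set_functor C (yquot C c R)"
  unfolding yquot_def by (rule set_functor_quot[OF set_functor_yoneda])

lemma sheaf_unit_inj: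
  assumes F: "set_functor C F" "separated F" and e: "e \<in> Obj C" and x: "x \<in> Fob F e" "y \<in> Fob F e"
    and eq: "sheaf_unit F e x = sheaf_unit F e y"
  shows "x = y"
  using locally_injE[OF sheafify_facts(3)[OF F(1)] e x eq] separatedD[OF F(2) _ x] by metis

text \<open>Closedness of \<open>R\<close> makes yc/R separated, so its unit is injective and the
  generator satisfies no relations beyond those in \<open>R\<close>. Every element of the associated
  sheaf is locally the class of an arrow, which is local surjectivity of evaluation.\<close>

lemma generates_sheafify:
  assumes o: "(c, R) \<in> ce_objects C"
  shows "generates c R (shf (yquot C c R)) (sheaf_unit (yquot C c R) c (proj R c (Id C c)))"
    (is "generates c R ?T ?t")
proof -
  have c: "c \<in> Obj C" and R: "closed_eqrel C (yoneda C c) R" "eqrel C (yoneda C c) R"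
    using ce_objectsD[OF o] by auto
  note Y = set_functor_yoneda[of c]
  note Q = set_functor_yquot[OF R(2)]
  have sep: "separated (yquot C c R)" unfolding yquot_def by (rule separated_quot[OF Y R(1)])
  note S = sheafify_facts[OF Q] and Sf = at_sheafD(1)[OF sheafify_facts(1)[OF Q]]
  have n: "nat_trans C (yoneda C c) (yquot C c R) (proj R)"
    unfolding yquot_def by (rule nat_trans_proj[OF Y R(2)])
  have pid: "proj R c (Id C c) \<in> Fob (yquot C c R) c" using nt_map[OF n c] id_hom[OF c] by simp
  have t: "?t \<in> Fob ?T c" using nt_map[OF S(2) c pid] .
  have act: "Fmap ?T \<chi> ?t = sheaf_unit (yquot C c R) e (proj R e \<chi>)" if \<chi>: "\<chi> \<in> hom C c e" for \<chi> e
    using nt_nat[OF S(2) \<chi> pid] nt_nat[OF n \<chi>, of "Id C c"] id_hom[OF c] comp_id_right[OF \<chi>] by simp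
  have pin: "proj R e \<chi> \<in> Fob (yquot C c R) e" if "\<chi> \<in> hom C c e" for e \<chi>
    using nt_map[OF n, of e \<chi>] that homD[OF that] by simp
  have "(\<chi>, \<xi>) \<in> R e \<longleftrightarrow> (\<chi>, \<xi>) \<in> ev_ker c ?T ?t e" for \<chi> \<xi> e
  proof (cases "\<chi> \<in> hom C c e \<and> \<xi> \<in> hom C c e")
    case True
    then have e: "e \<in> Obj C" using homD by blast
    have "Fmap ?T \<chi> ?t = Fmap ?T \<xi> ?t \<longleftrightarrow> proj R e \<chi> = proj R e \<xi>"
      using act True sheaf_unit_inj[OF Q sep e pin pin] by metis
    then show ?thesis using True proj_eq_iff[OF R(2) e] by (simp add: ev_ker_iff)
  next
    case False
    then show ?thesis using eqrel_in[OF R(2)] by (fastforce simp: ev_ker_iff)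
  qed
  then have Req: "R = ev_ker c ?T ?t" by (intro ext) auto
  have "locally_surj (yoneda C c) ?T (ev ?T ?t)"
    unfolding locally_surj_def
  proof (intro ballI)
    fix e y assume e: "e \<in> Obj C" and y: "y \<in> Fob ?T e"
    obtain d h X where h: "h \<in> hom C e d" "X \<in> Fob (yquot C c R) d"
      "sheaf_unit (yquot C c R) d X = Fmap ?T h y"
      using locally_surjE[OF S(4) e y] .
    obtain \<chi> where \<chi>: "\<chi> \<in> hom C c d" "X = proj R d \<chi>"
      using h(2) unfolding yquot_def by (auto elim: quot_FobE)
    then show "\<exists>d. \<exists>h \<in> hom C e d. \<exists>x \<in> Fob (yoneda C c) d. ev ?T ?t d x = Fmap ?T h y"
      using h act by (auto simp: ev_def)
  qed
  then show ?thesis using S(1) c t Req by (simp add: generates_def)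
qed

text \<open>An infinite cardinal equals its square. The pairing codes the two arrows that determine
  an element of a generated sheaf.\<close>

lemma pair_injection:
  assumes "infinite (UNIV :: 'u set)"
  obtains \<kappa> :: "'u \<times> 'u \<Rightarrow> 'u" where "inj \<kappa>"
proof -
  obtain \<kappa> where "bij_betw \<kappa> (UNIV \<times> UNIV :: ('u \<times> 'u) set) (UNIV :: 'u set)"
    using card_of_Times_same_infinite[OF assms] card_of_ordIso by blast
  then show ?thesis using that[of \<kappa>] by (simp add: bij_betw_def)
qed

text \<open>An element of the associated sheaf of \<open>yc/R\<close> is determined by a pair of arrows, so that
  this sheaf fits into the universe.\<close>

lemma generates_embeds:
  fixes \<iota> :: "'b \<Rightarrow> 'u"
  assumes g: "generates c R T t" and \<iota>: "inj_on \<iota> (Arr C)" and inf: "infinite (UNIV :: 'u set)"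
  obtains j :: "'a \<Rightarrow> 'v \<Rightarrow> 'u" where "\<And>e. e \<in> Obj C \<Longrightarrow> inj_on (j e) (Fob T e)"
proof -
  obtain \<kappa> :: "'u \<times> 'u \<Rightarrow> 'u" where \<kappa>: "inj \<kappa>" using pair_injection[OF inf] .
  note gD = generatesD[OF g]
  \<comment> \<open>A pair \<open>(h, \<chi>)\<close> describes \<open>w\<close> when the
    restriction of \<open>w\<close> along \<open>h\<close> is the translate of \<open>t\<close>
    along \<chi>; such a pair exists because \<open>t\<close> generates.\<close>
  define P where "P e w p \<longleftrightarrow> (\<exists>d. fst p \<in> hom C e d \<and> snd p \<in> hom C c d \<and>
    Fmap T (snd p) t = Fmap T (fst p) w)" for e w p
  define s where "s e w = (SOME p. P e w p)" for e w
  have s: "P e w (s e w)" if "e \<in> Obj C" "w \<in> Fob T e" for e w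
  proof -
    have "\<exists>p. P e w p" using generates_loc[OF g that] unfolding P_def by (metis fst_conv snd_conv)
    then show ?thesis unfolding s_def by (rule someI_ex)
  qed
  define j where "j e w = \<kappa> (map_prod \<iota> \<iota> (s e w))" for e w
  have "inj_on (j e) (Fob T e)" if e: "e \<in> Obj C" for e
  proof (rule inj_onI)
    fix v w assume v: "v \<in> Fob T e" and w: "w \<in> Fob T e"
      and "j e v = j e w"
    then have "map_prod \<iota> \<iota> (s e v) = map_prod \<iota> \<iota> (s e w)"
      using injD[OF \<kappa>] by (simp add: j_def)
    then have "\<iota> (fst (s e v)) = \<iota> (fst (s e w))" "\<iota> (snd (s e v)) = \<iota> (snd (s e w))"
      by (metis fst_map_prod, metis snd_map_prod)
    moreover have "fst (s e v) \<in> Arr C" "fst (s e w) \<in> Arr C" "snd (s e v) \<in> Arr C" "snd (s e w) \<in> Arr C"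
      using s[OF e v] s[OF e w] unfolding P_def hom_def by auto
    ultimately have "s e v = s e w" using inj_onD[OF \<iota>] by (metis prod_eqI)
    \<comment> \<open>Equal codes mean that one pair of arrows describes both \<open>v\<close> and
      \<open>w\<close>. Their restrictions along its first component are then the same translate of
      \<open>t\<close>, and separatedness cancels that component.\<close>
    then obtain d where "fst (s e v) \<in> hom C e d" "Fmap T (fst (s e v)) v = Fmap T (fst (s e v)) w"
      using s[OF e v] s[OF e w] unfolding P_def by metis
    then show "v = w" using separatedD[OF gD(3) _ v w] by blast
  qed
  then show ?thesis by (rule that)
qed

text \<open>Provides the sheaf as an object over \<open>'u\<close>; the associated sheaf itself has
  its values in an iterated set type.\<close>

lemma exists_generates:
  fixes \<iota> :: "'b \<Rightarrow> 'u"
  assumes o: "(c, R) \<in> ce_objects C" and \<iota>: "inj_on \<iota> (Arr C)" and inf: "infinite (UNIV :: 'u set)"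
  obtains T :: "('a, 'b, 'u) setfun" and t where "generates c R T t" "extensional_setfun C T"
proof -
  note g = generates_sheafify[OF o]
  obtain j :: "'a \<Rightarrow> ('b, 'b set) sheaf_elem \<Rightarrow> 'u" where
    "\<And>e. e \<in> Obj C \<Longrightarrow> inj_on (j e) (Fob (shf (yquot C c R)) e)"
    using generates_embeds[OF g \<iota> inf] by blast
  from generates_transport_fun[OF g this] extensional_transport_fun show ?thesis by (rule that)
qed

end

section \<open>Spans between quotients of representables\<close>

context amalg_category
begin

section \<open>Classes of arrows and subfunctors of products\<close>

lemma yquot_proj_in: "\<chi> \<in> hom C c e \<Longrightarrow> proj R e \<chi> \<in> Fob (yquot C c R) e"
  unfolding yquot_def by (rule proj_in) simp

lemma yquot_FobE:
  assumes "X \<in> Fob (yquot C c R) e"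
  obtains \<chi> where "\<chi> \<in> hom C c e" "X = proj R e \<chi>"
  using assms unfolding yquot_def by (auto elim: quot_FobE)

lemma yquot_Fmap:
  assumes "eqrel C (yoneda C c) R" "f \<in> hom C a b" "\<chi> \<in> hom C c a"
  shows "Fmap (yquot C c R) f (proj R a \<chi>) = proj R b (f \<cdot> \<chi>)"
  using quot_Fmap[OF set_functor_yoneda assms(1,2), of \<chi>] assms(3) by (simp add: yquot_def)

lemma yquot_proj_eq:
  assumes "eqrel C (yoneda C c) R" "\<chi> \<in> hom C c e" "\<xi> \<in> hom C c e"
  shows "proj R e \<chi> = proj R e \<xi> \<longleftrightarrow> (\<chi>, \<xi>) \<in> R e"
  using proj_eq_iff[OF assms(1), of e \<chi> \<xi>] assms(2,3) homD[OF assms(2)] by simp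

lemma separated_yquot: "closed_eqrel C (yoneda C c) R \<Longrightarrow> separated (yquot C c R)"
  unfolding yquot_def by (rule separated_quot[OF set_functor_yoneda])

lemma closed_eqrel_imp_eqrel: "closed_eqrel C F R \<Longrightarrow> eqrel C F R"
  by (simp add: closed_eqrel_def)

lemma quot_proj_proj:
  assumes R: "eqrel C (yoneda C c) R" and P: "eqrel C (yoneda C c) P" and RP: "\<And>e. R e \<subseteq> P e"
    and \<chi>: "\<chi> \<in> hom C c e"
  shows "quot_proj P e (proj R e \<chi>) = proj P e \<chi>"
  unfolding quot_proj_def
proof (rule induced_proj[OF R])
  fix \<xi> assume "(\<chi>, \<xi>) \<in> R e"
  then have "(\<chi>, \<xi>) \<in> P e" "\<xi> \<in> hom C c e" using RP eqrel_in[OF R] by auto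
  then show "proj P e \<chi> = proj P e \<xi>" using yquot_proj_eq[OF P \<chi>] by blast
qed (use \<chi> homD[OF \<chi>] in auto)

lemma nat_trans_quot_proj:
  assumes R: "eqrel C (yoneda C c) R" and P: "eqrel C (yoneda C c) P" and RP: "\<And>e. R e \<subseteq> P e"
  shows "nat_trans C (yquot C c R) (yquot C c P) (quot_proj P)"
  unfolding quot_proj_def yquot_def
proof (rule nat_trans_induced[OF set_functor_yoneda R nat_trans_proj[OF set_functor_yoneda P]])
  fix e \<chi> \<xi> assume r: "(\<chi>, \<xi>) \<in> R e"
  then have "(\<chi>, \<xi>) \<in> P e" "\<chi> \<in> hom C c e" "\<xi> \<in> hom C c e" using RP eqrel_in[OF R r] by auto
  then show "proj P e \<chi> = proj P e \<xi>" using yquot_proj_eq[OF P] by blast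
qed

lemma set_functor_sub_prod:
  assumes F: "set_functor C F" and G: "set_functor C G" and Q: "subfunctor C (prod_fun F G) Q"
  shows "set_functor C (sub_fun (prod_fun F G) Q)"
    "nat_trans C (sub_fun (prod_fun F G) Q) F (\<lambda>_. fst)"
    "nat_trans C (sub_fun (prod_fun F G) Q) G (\<lambda>_. snd)"
proof -
  have QF: "fst s \<in> Fob F e \<and> snd s \<in> Fob G e \<and> e \<in> Obj C" if "s \<in> Q e" for s e
  proof -
    have e: "e \<in> Obj C" using Q that unfolding subfunctor_def by blast
    then have "s \<in> Fob (prod_fun F G) e" using Q that unfolding subfunctor_def by blast
    then show ?thesis using e by (auto simp: prod_fun_def)
  qed
  have Qm: "map_prod (Fmap F f) (Fmap G f) s \<in> Q b" if "f \<in> hom C a b" "s \<in> Q a" for f a b s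
    using Q that homD[OF that(1)] by (auto simp: subfunctor_def prod_fun_def)
  show "set_functor C (sub_fun (prod_fun F G) Q)"
  proof (rule set_functorI)
    fix f a b s assume "f \<in> hom C a b" "s \<in> Fob (sub_fun (prod_fun F G) Q) a"
    then show "Fmap (sub_fun (prod_fun F G) Q) f s \<in> Fob (sub_fun (prod_fun F G) Q) b"
      using Qm by (simp add: sub_fun_def prod_fun_def)
  next
    fix a s assume "a \<in> Obj C" "s \<in> Fob (sub_fun (prod_fun F G) Q) a"
    then show "Fmap (sub_fun (prod_fun F G) Q) (Id C a) s = s"
      using QF[of s a] by (simp add: sub_fun_def prod_fun_def sf_id[OF F] sf_id[OF G] prod_eq_iff)
  next
    fix f g a b d s assume "f \<in> hom C a b" "g \<in> hom C b d" "s \<in> Fob (sub_fun (prod_fun F G) Q) a"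
    then show "Fmap (sub_fun (prod_fun F G) Q) (g \<cdot> f) s =
        Fmap (sub_fun (prod_fun F G) Q) g (Fmap (sub_fun (prod_fun F G) Q) f s)"
      using QF[of s a] by (simp add: sub_fun_def prod_fun_def sf_comp[OF F] sf_comp[OF G] prod_eq_iff)
  qed
  show "nat_trans C (sub_fun (prod_fun F G) Q) F (\<lambda>_. fst)"
    "nat_trans C (sub_fun (prod_fun F G) Q) G (\<lambda>_. snd)"
    by (rule nat_transI; simp add: sub_fun_def prod_fun_def QF)+
qed

lemma span_elem:
  assumes Q: "subfunctor C (prod_fun (yquot C c P) (yquot C c' R')) Q" and s: "s \<in> Q e"
  obtains \<chi> \<xi> where "e \<in> Obj C" "\<chi> \<in> hom C c e" "\<xi> \<in> hom C c' e" "s = (proj P e \<chi>, proj R' e \<xi>)"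
proof -
  have e: "e \<in> Obj C" using Q s unfolding subfunctor_def by blast
  then have "s \<in> Fob (prod_fun (yquot C c P) (yquot C c' R')) e"
    using Q s unfolding subfunctor_def by blast
  then have "fst s \<in> Fob (yquot C c P) e" "snd s \<in> Fob (yquot C c' R') e"
    by (auto simp: prod_fun_def)
  then show ?thesis using that e by (elim yquot_FobE) (metis prod.collapse)
qed

lemma span_stable:
  assumes Q: "subfunctor C (prod_fun (yquot C c P) (yquot C c' R')) Q"
    and P: "eqrel C (yoneda C c) P" and R': "eqrel C (yoneda C c') R'"
    and h: "h \<in> hom C e d" and \<chi>: "\<chi> \<in> hom C c e" and \<xi>: "\<xi> \<in> hom C c' e"
    and s: "(proj P e \<chi>, proj R' e \<xi>) \<in> Q e"
  shows "(proj P d (h \<cdot> \<chi>), proj R' d (h \<cdot> \<xi>)) \<in> Q d"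
proof -
  have "Fmap (prod_fun (yquot C c P) (yquot C c' R')) h (proj P e \<chi>, proj R' e \<xi>) \<in> Q d"
    using Q s homD[OF h] unfolding subfunctor_def by blast
  then show ?thesis using yquot_Fmap[OF P h \<chi>] yquot_Fmap[OF R' h \<xi>] by (simp add: prod_fun_def)
qed

text \<open>The triples of \<open>C_e\<close> without reference to the associated sheaf functor.\<close>

definition is_span :: "'a \<Rightarrow> ('a, 'b) rel_family \<Rightarrow> 'a \<Rightarrow> ('a, 'b) rel_family \<Rightarrow>
    ('a, 'b) rel_family \<Rightarrow> ('a \<Rightarrow> ('b set \<times> 'b set) set) \<Rightarrow> bool" where
  "is_span c' R' c R P Q \<longleftrightarrow>
     closed_eqrel C (yoneda C c) P \<and> (\<forall>e. R e \<subseteq> P e) \<and>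
     subfunctor C (prod_fun (yquot C c P) (yquot C c' R')) Q \<and>
     (\<forall>e X Y Y'. (X, Y) \<in> Q e \<and> (X, Y') \<in> Q e \<longrightarrow> Y = Y') \<and>
     (\<forall>e X X' Y. (X, Y) \<in> Q e \<and> (X', Y) \<in> Q e \<longrightarrow> X = X') \<and>
     (\<forall>e. \<forall>\<chi> \<in> hom C c e. \<exists>d. \<exists>h \<in> hom C e d. \<exists>\<xi> \<in> hom C c' d.
        (proj P d (h \<cdot> \<chi>), proj R' d \<xi>) \<in> Q d) \<and>
     (\<forall>e. \<forall>\<xi> \<in> hom C c' e. \<exists>d. \<exists>h \<in> hom C e d. \<exists>\<chi> \<in> hom C c d.
        (proj P d \<chi>, proj R' d (h \<cdot> \<xi>)) \<in> Q d)"

lemma is_spanD: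
  assumes "is_span c' R' c R P Q"
  shows "closed_eqrel C (yoneda C c) P" "R e \<subseteq> P e"
    "subfunctor C (prod_fun (yquot C c P) (yquot C c' R')) Q"
    "(X, Y) \<in> Q e \<Longrightarrow> (X, Y') \<in> Q e \<Longrightarrow> Y = Y'"
    "(X, Y) \<in> Q e \<Longrightarrow> (X', Y) \<in> Q e \<Longrightarrow> X = X'"
    "eqrel C (yoneda C c) P"
proof -
  note s = assms[unfolded is_span_def]
  show P: "closed_eqrel C (yoneda C c) P" using s by (elim conjE)
  then show "eqrel C (yoneda C c) P" by (rule closed_eqrel_imp_eqrel)
  have "\<forall>e. R e \<subseteq> P e" using s by (elim conjE)
  then show "R e \<subseteq> P e" by blast
  show "subfunctor C (prod_fun (yquot C c P) (yquot C c' R')) Q" using s by (elim conjE)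
  have "\<forall>e X Y Y'. (X, Y) \<in> Q e \<and> (X, Y') \<in> Q e \<longrightarrow> Y = Y'" using s by (elim conjE)
  then show "(X, Y) \<in> Q e \<Longrightarrow> (X, Y') \<in> Q e \<Longrightarrow> Y = Y'" by blast
  have "\<forall>e X X' Y. (X, Y) \<in> Q e \<and> (X', Y) \<in> Q e \<longrightarrow> X = X'" using s by (elim conjE)
  then show "(X, Y) \<in> Q e \<Longrightarrow> (X', Y) \<in> Q e \<Longrightarrow> X = X'" by blast
qed

lemma is_spanI:
  assumes "closed_eqrel C (yoneda C c) P" "\<And>e. R e \<subseteq> P e"
    "subfunctor C (prod_fun (yquot C c P) (yquot C c' R')) Q"
    "\<And>e X Y Y'. (X, Y) \<in> Q e \<Longrightarrow> (X, Y') \<in> Q e \<Longrightarrow> Y = Y'"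
    "\<And>e X X' Y. (X, Y) \<in> Q e \<Longrightarrow> (X', Y) \<in> Q e \<Longrightarrow> X = X'"
    "\<And>e \<chi>. \<chi> \<in> hom C c e \<Longrightarrow> \<exists>d. \<exists>h \<in> hom C e d. \<exists>\<xi> \<in> hom C c' d.
      (proj P d (h \<cdot> \<chi>), proj R' d \<xi>) \<in> Q d"
    "\<And>e \<xi>. \<xi> \<in> hom C c' e \<Longrightarrow> \<exists>d. \<exists>h \<in> hom C e d. \<exists>\<chi> \<in> hom C c d.
      (proj P d \<chi>, proj R' d (h \<cdot> \<xi>)) \<in> Q d"
  shows "is_span c' R' c R P Q"
  unfolding is_span_def
  by (intro conjI allI ballI impI assms(1,2,3,6,7); (elim conjE)?; (rule assms(4) assms(5))?; assumption)

lemma is_span_left: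
  assumes "is_span c' R' c R P Q" "\<chi> \<in> hom C c e"
  obtains d h \<xi> where "h \<in> hom C e d" "\<xi> \<in> hom C c' d" "(proj P d (h \<cdot> \<chi>), proj R' d \<xi>) \<in> Q d"
proof -
  have "\<forall>e. \<forall>\<chi> \<in> hom C c e. \<exists>d. \<exists>h \<in> hom C e d. \<exists>\<xi> \<in> hom C c' d.
      (proj P d (h \<cdot> \<chi>), proj R' d \<xi>) \<in> Q d"
    using assms(1) unfolding is_span_def by (elim conjE)
  then show ?thesis using assms(2) that by blast
qed

lemma is_span_right:
  assumes "is_span c' R' c R P Q" "\<xi> \<in> hom C c' e"
  obtains d h \<chi> where "h \<in> hom C e d" "\<chi> \<in> hom C c d" "(proj P d \<chi>, proj R' d (h \<cdot> \<xi>)) \<in> Q d"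
proof -
  have "\<forall>e. \<forall>\<xi> \<in> hom C c' e. \<exists>d. \<exists>h \<in> hom C e d. \<exists>\<chi> \<in> hom C c d.
      (proj P d \<chi>, proj R' d (h \<cdot> \<xi>)) \<in> Q d"
    using assms(1) unfolding is_span_def by (elim conjE)
  then show ?thesis using assms(2) that by blast
qed

text \<open>By \<open>sheafify_map_iso_iff\<close> each leg has to be locally injective and locally
  surjective. Both quotients are by closed relations, hence separated, so local injectivity is plain
  injectivity: \<open>Q\<close> is a one-to-one correspondence between classes, which every class
  enters after restriction.\<close>

lemma ce_triples_iff:
  assumes o': "(c', R') \<in> ce_objects C" and o: "(c, R) \<in> ce_objects C"
  shows "(P, Q) \<in> ce_triples C (c', R') (c, R) \<longleftrightarrow> is_span c' R' c R P Q"
proof (cases "closed_eqrel C (yoneda C c) P \<and> (\<forall>e. R e \<subseteq> P e) \<and>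
    subfunctor C (prod_fun (yquot C c P) (yquot C c' R')) Q")
  case False
  then show ?thesis by (auto simp: ce_triples_def is_span_def)
next
  case True
  then have P: "closed_eqrel C (yoneda C c) P" and PE: "eqrel C (yoneda C c) P"
    and Q: "subfunctor C (prod_fun (yquot C c P) (yquot C c' R')) Q"
    using closed_eqrel_imp_eqrel by auto
  have R': "closed_eqrel C (yoneda C c') R'" "eqrel C (yoneda C c') R'"
    using ce_objectsD[OF o'] by auto
  define QF where "QF = span_fun C c c' P R' Q"
  note Y = set_functor_yquot[OF PE] and Y' = set_functor_yquot[OF R'(2)]
  have QF: "set_functor C QF" "nat_trans C QF (yquot C c P) (\<lambda>_. fst)"
    "nat_trans C QF (yquot C c' R') (\<lambda>_. snd)"
    unfolding QF_def span_fun_def using set_functor_sub_prod[OF Y Y' Q] by auto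
  have Fob: "Fob QF e = Q e" for e by (simp add: QF_def span_fun_def sub_fun_def)
  have Fmap: "Fmap QF h (X, X') = (Fmap (yquot C c P) h X, Fmap (yquot C c' R') h X')" for h X X'
    by (simp add: QF_def span_fun_def sub_fun_def prod_fun_def)
  have Qe: "e \<in> Obj C \<and> X \<in> Fob (yquot C c P) e \<and> Z \<in> Fob (yquot C c' R') e" if "(X, Z) \<in> Q e" for X Z e
    by (rule span_elem[OF Q that]) (auto intro: yquot_proj_in)
  \<comment> \<open>Two pairs with the same first component differ only in yc'/R', so the
    separatedness that matters for the left leg is that of the right-hand quotient.\<close>
  have 1: "locally_inj QF (\<lambda>_. fst) \<longleftrightarrow> (\<forall>e X Y Y'. (X, Y) \<in> Q e \<and> (X, Y') \<in> Q e \<longrightarrow> Y = Y')"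
  proof (intro iffI allI impI)
    fix e X Z Z' assume l: "locally_inj QF (\<lambda>_. fst)" and z: "(X, Z) \<in> Q e \<and> (X, Z') \<in> Q e"
    then have e: "e \<in> Obj C" using Qe by blast
    obtain d h where "h \<in> hom C e d" "Fmap QF h (X, Z) = Fmap QF h (X, Z')"
      using locally_injE[OF l e, of "(X, Z)" "(X, Z')"] z unfolding Fob fst_conv by blast
    then show "Z = Z'"
      using separatedD[OF separated_yquot[OF R'(1)], of h e d Z Z'] Qe z by (auto simp: Fmap)
  next
    assume "\<forall>e X Y Y'. (X, Y) \<in> Q e \<and> (X, Y') \<in> Q e \<longrightarrow> Y = Y'"
    then show "locally_inj QF (\<lambda>_. fst)"
      unfolding locally_inj_def Fob using id_hom by (metis prod.collapse)
  qed
  have 2: "locally_inj QF (\<lambda>_. snd) \<longleftrightarrow> (\<forall>e X X' Y. (X, Y) \<in> Q e \<and> (X', Y) \<in> Q e \<longrightarrow> X = X')"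
  proof (intro iffI allI impI)
    fix e X X' Z assume l: "locally_inj QF (\<lambda>_. snd)" and z: "(X, Z) \<in> Q e \<and> (X', Z) \<in> Q e"
    then have e: "e \<in> Obj C" using Qe by blast
    obtain d h where "h \<in> hom C e d" "Fmap QF h (X, Z) = Fmap QF h (X', Z)"
      using locally_injE[OF l e, of "(X, Z)" "(X', Z)"] z unfolding Fob snd_conv by blast
    then show "X = X'"
      using separatedD[OF separated_yquot[OF P], of h e d X X'] Qe z by (auto simp: Fmap)
  next
    assume "\<forall>e X X' Y. (X, Y) \<in> Q e \<and> (X', Y) \<in> Q e \<longrightarrow> X = X'"
    then show "locally_inj QF (\<lambda>_. snd)"
      unfolding locally_inj_def Fob using id_hom by (metis prod.collapse)
  qed
  have 3: "locally_surj QF (yquot C c P) (\<lambda>_. fst) \<longleftrightarrow>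
    (\<forall>e. \<forall>\<chi> \<in> hom C c e. \<exists>d. \<exists>h \<in> hom C e d. \<exists>\<xi> \<in> hom C c' d. (proj P d (h \<cdot> \<chi>), proj R' d \<xi>) \<in> Q d)"
  proof (intro iffI allI ballI)
    fix e \<chi> assume l: "locally_surj QF (yquot C c P) (\<lambda>_. fst)" and \<chi>: "\<chi> \<in> hom C c e"
    have e: "e \<in> Obj C" using homD[OF \<chi>] by blast
    obtain d h s where h: "h \<in> hom C e d" "s \<in> Q d" "fst s = Fmap (yquot C c P) h (proj P e \<chi>)"
      using locally_surjE[OF l e yquot_proj_in[OF \<chi>], unfolded Fob] .
    obtain \<zeta> \<xi> where "\<xi> \<in> hom C c' d" "s = (proj P d \<zeta>, proj R' d \<xi>)" using span_elem[OF Q h(2)] .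
    then show "\<exists>d. \<exists>h \<in> hom C e d. \<exists>\<xi> \<in> hom C c' d. (proj P d (h \<cdot> \<chi>), proj R' d \<xi>) \<in> Q d"
      using h yquot_Fmap[OF PE h(1) \<chi>] by auto
  next
    assume a: "\<forall>e. \<forall>\<chi> \<in> hom C c e. \<exists>d. \<exists>h \<in> hom C e d. \<exists>\<xi> \<in> hom C c' d.
      (proj P d (h \<cdot> \<chi>), proj R' d \<xi>) \<in> Q d"
    show "locally_surj QF (yquot C c P) (\<lambda>_. fst)"
      unfolding locally_surj_def
    proof (intro ballI)
      fix e X assume "X \<in> Fob (yquot C c P) e"
      then obtain \<chi> where \<chi>: "\<chi> \<in> hom C c e" "X = proj P e \<chi>" by (elim yquot_FobE)
      then obtain d h \<xi> where h: "h \<in> hom C e d" "(proj P d (h \<cdot> \<chi>), proj R' d \<xi>) \<in> Q d"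
        using a by blast
      then have "fst (proj P d (h \<cdot> \<chi>), proj R' d \<xi>) = Fmap (yquot C c P) h X"
        using yquot_Fmap[OF PE h(1) \<chi>(1)] \<chi>(2) by simp
      then show "\<exists>d. \<exists>h \<in> hom C e d. \<exists>x \<in> Fob QF d. fst x = Fmap (yquot C c P) h X"
        using h unfolding Fob by blast
    qed
  qed
  have 4: "locally_surj QF (yquot C c' R') (\<lambda>_. snd) \<longleftrightarrow>
    (\<forall>e. \<forall>\<xi> \<in> hom C c' e. \<exists>d. \<exists>h \<in> hom C e d. \<exists>\<chi> \<in> hom C c d. (proj P d \<chi>, proj R' d (h \<cdot> \<xi>)) \<in> Q d)"
  proof (intro iffI allI ballI)
    fix e \<xi> assume l: "locally_surj QF (yquot C c' R') (\<lambda>_. snd)" and \<xi>: "\<xi> \<in> hom C c' e"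
    have e: "e \<in> Obj C" using homD[OF \<xi>] by blast
    obtain d h s where h: "h \<in> hom C e d" "s \<in> Q d" "snd s = Fmap (yquot C c' R') h (proj R' e \<xi>)"
      using locally_surjE[OF l e yquot_proj_in[OF \<xi>], unfolded Fob] .
    obtain \<chi> \<zeta> where "\<chi> \<in> hom C c d" "s = (proj P d \<chi>, proj R' d \<zeta>)" using span_elem[OF Q h(2)] .
    then show "\<exists>d. \<exists>h \<in> hom C e d. \<exists>\<chi> \<in> hom C c d. (proj P d \<chi>, proj R' d (h \<cdot> \<xi>)) \<in> Q d"
      using h yquot_Fmap[OF R'(2) h(1) \<xi>] by auto
  next
    assume a: "\<forall>e. \<forall>\<xi> \<in> hom C c' e. \<exists>d. \<exists>h \<in> hom C e d. \<exists>\<chi> \<in> hom C c d.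
      (proj P d \<chi>, proj R' d (h \<cdot> \<xi>)) \<in> Q d"
    show "locally_surj QF (yquot C c' R') (\<lambda>_. snd)"
      unfolding locally_surj_def
    proof (intro ballI)
      fix e X assume "X \<in> Fob (yquot C c' R') e"
      then obtain \<xi> where \<xi>: "\<xi> \<in> hom C c' e" "X = proj R' e \<xi>" by (elim yquot_FobE)
      then obtain d h \<chi> where h: "h \<in> hom C e d" "(proj P d \<chi>, proj R' d (h \<cdot> \<xi>)) \<in> Q d"
        using a by blast
      then have "snd (proj P d \<chi>, proj R' d (h \<cdot> \<xi>)) = Fmap (yquot C c' R') h X"
        using yquot_Fmap[OF R'(2) h(1) \<xi>(1)] \<xi>(2) by simp
      then show "\<exists>d. \<exists>h \<in> hom C e d. \<exists>x \<in> Fob QF d. snd x = Fmap (yquot C c' R') h X"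
        using h unfolding Fob by blast
    qed
  qed
  have "(P, Q) \<in> ce_triples C (c', R') (c, R) \<longleftrightarrow>
      nat_iso C (shf QF) (shf (yquot C c P)) (sheafify_map C (yquot C c P) (\<lambda>_. fst)) \<and>
      nat_iso C (shf QF) (shf (yquot C c' R')) (sheafify_map C (yquot C c' R') (\<lambda>_. snd))"
    using True by (simp add: ce_triples_def QF_def Let_def)
  also have "\<dots> \<longleftrightarrow> (locally_inj QF (\<lambda>_. fst) \<and> locally_surj QF (yquot C c P) (\<lambda>_. fst)) \<and>
      (locally_inj QF (\<lambda>_. snd) \<and> locally_surj QF (yquot C c' R') (\<lambda>_. snd))"
    by (simp only: sheafify_map_iso_iff[OF QF(1) Y QF(2)] sheafify_map_iso_iff[OF QF(1) Y' QF(3)])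
  also have "\<dots> \<longleftrightarrow> is_span c' R' c R P Q"
    unfolding is_span_def 1 2 3 4 using True by argo
  finally show ?thesis .
qed

text \<open>\<open>z\<close> is the image of the generator of \<open>a(yc/R)\<close> under the arrow to \<open>a(yc'/R')\<close> given by
  \<open>(P, Q)\<close>; here \<open>T'\<close> stands for \<open>a(yc'/R')\<close>, with generator \<open>t'\<close>.\<close>

definition represents :: "'a \<Rightarrow> ('a, 'b) rel_family \<Rightarrow> 'a \<Rightarrow> ('a, 'b, 'v) setfun \<Rightarrow> 'v \<Rightarrow>
    ('a, 'b) ce_triple \<Rightarrow> 'v \<Rightarrow> bool" where
  "represents c' R' c T' t' = (\<lambda>(P, Q) z. z \<in> Fob T' c \<and> P = ev_ker c T' z \<and>
     (\<forall>e. \<forall>\<chi> \<in> hom C c e. \<forall>\<xi> \<in> hom C c' e.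
        (proj P e \<chi>, proj R' e \<xi>) \<in> Q e \<longrightarrow> Fmap T' \<chi> z = Fmap T' \<xi> t'))"

lemma representsD:
  assumes "represents c' R' c T' t' (P, Q) z"
  shows "z \<in> Fob T' c" "P = ev_ker c T' z"
    "\<chi> \<in> hom C c e \<Longrightarrow> \<xi> \<in> hom C c' e \<Longrightarrow> (proj P e \<chi>, proj R' e \<xi>) \<in> Q e \<Longrightarrow>
      Fmap T' \<chi> z = Fmap T' \<xi> t'"
  using assms by (auto simp: represents_def)

text \<open>The class of \<chi> in yc/P and the value \<open>T' \<chi> z\<close> determine each
  other, and so do the class of \<xi> in yc'/R' and \<open>T' \<xi> t'\<close>. In a pair of
  \<open>Q\<close> the two values are equal, so each component fixes the other.\<close>

lemma represents_inj:
  assumes g: "generates c' R' T' t'" and r: "represents c' R' c T' t' (P, Q) z"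
    and Q: "subfunctor C (prod_fun (yquot C c P) (yquot C c' R')) Q"
  shows "(X, Y) \<in> Q e \<Longrightarrow> (X, Y') \<in> Q e \<Longrightarrow> Y = Y'" "(X, Y) \<in> Q e \<Longrightarrow> (X', Y) \<in> Q e \<Longrightarrow> X = X'"
proof -
  note gD = generatesD[OF g] and rD = representsD[OF r]
  have P: "eqrel C (yoneda C c) P" and R': "eqrel C (yoneda C c') R'"
    unfolding rD(2) gD(6) using closed_ev_ker[OF gD(2,3)] rD(1) gD(5) closed_eqrel_imp_eqrel by blast+
  have iff: "proj P e \<chi> = proj P e \<chi>' \<longleftrightarrow> proj R' e \<xi> = proj R' e \<xi>'"
    if "\<chi> \<in> hom C c e" "\<chi>' \<in> hom C c e" "\<xi> \<in> hom C c' e" "\<xi>' \<in> hom C c' e"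
      "(proj P e \<chi>, proj R' e \<xi>) \<in> Q e" "(proj P e \<chi>', proj R' e \<xi>') \<in> Q e" for \<chi> \<chi>' \<xi> \<xi>'
  proof -
    have "(\<chi>, \<chi>') \<in> P e \<longleftrightarrow> Fmap T' \<chi> z = Fmap T' \<chi>' z"
      using that by (simp add: rD(2) ev_ker_iff)
    also have "\<dots> \<longleftrightarrow> Fmap T' \<xi> t' = Fmap T' \<xi>' t'" using rD(3) that by metis
    also have "\<dots> \<longleftrightarrow> (\<xi>, \<xi>') \<in> R' e" using that by (simp add: gD(6) ev_ker_iff)
    finally show ?thesis using yquot_proj_eq[OF P that(1,2)] yquot_proj_eq[OF R' that(3,4)] by simp
  qed
  show "Y = Y'" if a: "(X, Y) \<in> Q e" "(X, Y') \<in> Q e"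
  proof -
    obtain \<chi> \<xi> where 1: "\<chi> \<in> hom C c e" "\<xi> \<in> hom C c' e" "(X, Y) = (proj P e \<chi>, proj R' e \<xi>)"
      using span_elem[OF Q a(1)] .
    obtain \<chi>' \<xi>' where 2: "\<chi>' \<in> hom C c e" "\<xi>' \<in> hom C c' e" "(X, Y') = (proj P e \<chi>', proj R' e \<xi>')"
      using span_elem[OF Q a(2)] .
    show ?thesis using iff[OF 1(1) 2(1) 1(2) 2(2)] a 1(3) 2(3) by simp
  qed
  show "X = X'" if a: "(X, Y) \<in> Q e" "(X', Y) \<in> Q e"
  proof -
    obtain \<chi> \<xi> where 1: "\<chi> \<in> hom C c e" "\<xi> \<in> hom C c' e" "(X, Y) = (proj P e \<chi>, proj R' e \<xi>)"
      using span_elem[OF Q a(1)] .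
    obtain \<chi>' \<xi>' where 2: "\<chi>' \<in> hom C c e" "\<xi>' \<in> hom C c' e" "(X', Y) = (proj P e \<chi>', proj R' e \<xi>')"
      using span_elem[OF Q a(2)] .
    show ?thesis using iff[OF 1(1) 2(1) 1(2) 2(2)] a 1(3) 2(3) by simp
  qed
qed

text \<open>A single local partner of the identity of \<open>c\<close> fixes a restriction of
  \<open>z\<close>, and separatedness then fixes \<open>z\<close>.\<close>

lemma represents_unique:
  assumes g: "generates c' R' T' t'" and c: "c \<in> Obj C" and s: "is_span c' R' c R P Q"
    and r: "represents c' R' c T' t' (P, Q) z" "represents c' R' c T' t' (P, Q) z'"
  shows "z = z'"
proof -
  obtain d h \<xi> where h: "h \<in> hom C c d" "\<xi> \<in> hom C c' d" "(proj P d (h \<cdot> Id C c), proj R' d \<xi>) \<in> Q d"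
    using is_span_left[OF s id_hom[OF c]] .
  then have "Fmap T' h z = Fmap T' h z'"
    using representsD(3)[OF r(1) h(1,2)] representsD(3)[OF r(2) h(1,2)] comp_id_right[OF h(1)] by simp
  then show ?thesis
    using separatedD[OF generatesD(3)[OF g] h(1)] representsD(1)[OF r(1)] representsD(1)[OF r(2)] by blast
qed

text \<open>The element is glued along an arrow \<open>f\<close> at which the identity of
  \<open>c\<close> has a partner \<zeta> in \<open>Q\<close>: its restriction along \<open>f\<close>
  has to be \<open>T' \<zeta> t'\<close>. Single-valuedness of \<open>Q\<close> gives compatibility;
  its injectivity and the closedness of \<open>P\<close> keep the kernel of the glued element inside
  \<open>P\<close>.\<close>

lemma represents_exists:
  assumes g: "generates c' R' T' t'" and c: "c \<in> Obj C" and s: "is_span c' R' c R P Q"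
  obtains z where "represents c' R' c T' t' (P, Q) z"
proof -
  note gD = generatesD[OF g] and sD = is_spanD[OF s]
  have R': "eqrel C (yoneda C c') R'"
    unfolding gD(6) using closed_ev_ker[OF gD(2,3,5)] closed_eqrel_imp_eqrel by blast
  have t': "Fmap T' \<xi> t' \<in> Fob T' e" if "\<xi> \<in> hom C c' e" for \<xi> e using sf_map[OF gD(2) that gD(5)] .
  have eq: "Fmap T' \<xi> t' = Fmap T' \<xi>' t' \<longleftrightarrow> proj R' e \<xi> = proj R' e \<xi>'"
    if "\<xi> \<in> hom C c' e" "\<xi>' \<in> hom C c' e" for \<xi> \<xi>' e
    using yquot_proj_eq[OF R' that] that by (simp add: gD(6) ev_ker_iff)
  obtain b f \<zeta> where f: "f \<in> hom C c b" "\<zeta> \<in> hom C c' b" "(proj P b (f \<cdot> Id C c), proj R' b \<zeta>) \<in> Q b"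
    using is_span_left[OF s id_hom[OF c]] .
  then have f3: "(proj P b f, proj R' b \<zeta>) \<in> Q b" using comp_id_right[OF f(1)] by simp
  have act: "Fmap T' h (Fmap T' \<zeta> t') = Fmap T' \<xi> t'"
    if "h \<in> hom C b d" "\<xi> \<in> hom C c' d" "(proj P d (h \<cdot> f), proj R' d \<xi>) \<in> Q d" for h d \<xi>
  proof -
    have "proj R' d \<xi> = proj R' d (h \<cdot> \<zeta>)"
      using sD(4)[OF that(3) span_stable[OF sD(3,6) R' that(1) f(1,2) f3]] .
    then have "Fmap T' \<xi> t' = Fmap T' (h \<cdot> \<zeta>) t'" using eq that(2) comp_hom[OF f(2) that(1)] by blast
    then show ?thesis using sf_comp[OF gD(2) f(2) that(1) gD(5)] by simp
  qed
  have "Fmap T' h (Fmap T' \<zeta> t') = Fmap T' k (Fmap T' \<zeta> t')"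
    if h: "h \<in> hom C b d" and k: "k \<in> hom C b d" and hk: "h \<cdot> f = k \<cdot> f" for d h k
    using act[OF h comp_hom[OF f(2) k]] span_stable[OF sD(3,6) R' k f(1,2) f3] hk
      sf_comp[OF gD(2) f(2) k gD(5)] by simp
  then obtain z where z: "z \<in> Fob T' c" "Fmap T' f z = Fmap T' \<zeta> t'"
    using at_sheaf_glue[OF gD(1) f(1) t'[OF f(2)]] by blast
  \<comment> \<open>For an arbitrary pair of \<open>Q\<close> the arrow \<chi> is amalgamated with
    \<open>f\<close>, where the value of \<open>z\<close> is known; the remaining factor
    \<open>k\<close> is cancelled.\<close>
  have rep: "Fmap T' \<chi> z = Fmap T' \<xi> t'"
    if \<chi>: "\<chi> \<in> hom C c e" and \<xi>: "\<xi> \<in> hom C c' e" and q: "(proj P e \<chi>, proj R' e \<xi>) \<in> Q e" for e \<chi> \<xi>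
  proof -
    obtain d h k where hk: "h \<in> hom C b d" "k \<in> hom C e d" "h \<cdot> f = k \<cdot> \<chi>"
      using amalgE[OF f(1) \<chi>] by metis
    have "Fmap T' (k \<cdot> \<chi>) z = Fmap T' (k \<cdot> \<xi>) t'"
      using act[OF hk(1) comp_hom[OF \<xi> hk(2)]] span_stable[OF sD(3,6) R' hk(2) \<chi> \<xi> q] hk(3) z(2)
        sf_comp[OF gD(2) f(1) hk(1) z(1)] by simp
    then have "Fmap T' k (Fmap T' \<chi> z) = Fmap T' k (Fmap T' \<xi> t')"
      using sf_comp[OF gD(2) \<chi> hk(2) z(1)] sf_comp[OF gD(2) \<xi> hk(2) gD(5)] by simp
    then show ?thesis using separatedD[OF gD(3) hk(2)] t'[OF \<xi>] sf_map[OF gD(2) \<chi> z(1)] by blast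
  qed
  have "(\<chi>, \<chi>') \<in> P e \<longleftrightarrow> (\<chi>, \<chi>') \<in> ev_ker c T' z e" for e \<chi> \<chi>'
  proof (cases "\<chi> \<in> hom C c e \<and> \<chi>' \<in> hom C c e")
    case False
    then show ?thesis using eqrel_in[OF sD(6)] by (fastforce simp: ev_ker_iff)
  next
    case True
    then have \<chi>: "\<chi> \<in> hom C c e" and \<chi>': "\<chi>' \<in> hom C c e" by auto
    \<comment> \<open>Both arrows are moved to a common stage where they have partners. There
      membership in \<open>P\<close>, equality of the partners and equality of the values at
      \<open>z\<close> are equivalent.\<close>
    obtain d h \<xi> where h: "h \<in> hom C e d" "\<xi> \<in> hom C c' d" "(proj P d (h \<cdot> \<chi>), proj R' d \<xi>) \<in> Q d"
      using is_span_left[OF s \<chi>] .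
    obtain d' k \<xi>' where k: "k \<in> hom C d d'" "\<xi>' \<in> hom C c' d'"
      "(proj P d' (k \<cdot> (h \<cdot> \<chi>')), proj R' d' \<xi>') \<in> Q d'"
      using is_span_left[OF s comp_hom[OF \<chi>' h(1)]] .
    note h\<chi> = comp_hom[OF \<chi> h(1)] and h\<chi>' = comp_hom[OF \<chi>' h(1)]
    note k' = span_stable[OF sD(3,6) R' k(1) h\<chi> h(2,3)]
    note kh = comp_hom[OF h(1) k(1)]
    have a: "k \<cdot> (h \<cdot> \<chi>) = (k \<cdot> h) \<cdot> \<chi>" "k \<cdot> (h \<cdot> \<chi>') = (k \<cdot> h) \<cdot> \<chi>'"
      using comp_assoc[OF _ h(1) k(1)] \<chi> \<chi>' by auto
    have "(\<chi>, \<chi>') \<in> P e \<longleftrightarrow> ((k \<cdot> h) \<cdot> \<chi>, (k \<cdot> h) \<cdot> \<chi>') \<in> P d'"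
      using closed_eqrelD[OF sD(1) kh, of \<chi> \<chi>'] eqrel_map[OF sD(6) kh, of \<chi> \<chi>'] \<chi> \<chi>' by auto
    also have "\<dots> \<longleftrightarrow> proj P d' (k \<cdot> (h \<cdot> \<chi>)) = proj P d' (k \<cdot> (h \<cdot> \<chi>'))"
      using yquot_proj_eq[OF sD(6) comp_hom[OF h\<chi> k(1)] comp_hom[OF h\<chi>' k(1)]] a by simp
    also have "\<dots> \<longleftrightarrow> proj R' d' (k \<cdot> \<xi>) = proj R' d' \<xi>'"
      using sD(4,5) k' k(3) by metis
    also have "\<dots> \<longleftrightarrow> Fmap T' (k \<cdot> \<xi>) t' = Fmap T' \<xi>' t'"
      using eq[OF comp_hom[OF h(2) k(1)] k(2)] by simp
    also have "\<dots> \<longleftrightarrow> Fmap T' (k \<cdot> (h \<cdot> \<chi>)) z = Fmap T' (k \<cdot> (h \<cdot> \<chi>')) z"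
      using rep[OF comp_hom[OF h\<chi> k(1)] comp_hom[OF h(2) k(1)] k']
        rep[OF comp_hom[OF h\<chi>' k(1)] k(2,3)] by simp
    also have "\<dots> \<longleftrightarrow> Fmap T' (k \<cdot> h) (Fmap T' \<chi> z) = Fmap T' (k \<cdot> h) (Fmap T' \<chi>' z)"
      using a sf_comp[OF gD(2) \<chi> kh z(1)] sf_comp[OF gD(2) \<chi>' kh z(1)] by simp
    also have "\<dots> \<longleftrightarrow> Fmap T' \<chi> z = Fmap T' \<chi>' z"
      using separatedD[OF gD(3) kh] sf_map[OF gD(2) \<chi> z(1)] sf_map[OF gD(2) \<chi>' z(1)] by metis
    finally show ?thesis using True by (simp add: ev_ker_iff)
  qed
  then have "P = ev_ker c T' z" by (intro ext) auto
  then have "represents c' R' c T' t' (P, Q) z" using z(1) rep by (auto simp: represents_def)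
  then show ?thesis by (rule that)
qed

text \<open>\<open>Q\<close> is the pullback of evaluation at \<open>z\<close> and evaluation at
  \<open>t'\<close> over \<open>T'\<close>, taken on classes. Its left leg is locally surjective
  because \<open>t'\<close> generates \<open>T'\<close>. For the right leg a translate of
  \<open>z\<close> has to meet a given translate of \<open>t'\<close>, a concrete form of
  \<open>T'\<close> being an atom.\<close>

lemma span_exists:
  assumes g: "generates c' R' T' t'" and c: "c \<in> Obj C" and z: "z \<in> Fob T' c"
    and R: "\<And>e. R e \<subseteq> ev_ker c T' z e"
  obtains P Q where "is_span c' R' c R P Q" "represents c' R' c T' t' (P, Q) z"
proof -
  note gD = generatesD[OF g]
  define P where "P = ev_ker c T' z"
  define Q where "Q e = {(proj P e \<chi>, proj R' e \<xi>) | \<chi> \<xi>. \<chi> \<in> hom C c e \<and> \<xi> \<in> hom C c' e \<and>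
    Fmap T' \<chi> z = Fmap T' \<xi> t'}" for e
  have P: "closed_eqrel C (yoneda C c) P" "eqrel C (yoneda C c) P"
    unfolding P_def using closed_ev_ker[OF gD(2,3) z] closed_eqrel_imp_eqrel by blast+
  have R': "eqrel C (yoneda C c') R'"
    unfolding gD(6) using closed_ev_ker[OF gD(2,3,5)] closed_eqrel_imp_eqrel by blast
  have QI: "(proj P e \<chi>, proj R' e \<xi>) \<in> Q e"
    if "\<chi> \<in> hom C c e" "\<xi> \<in> hom C c' e" "Fmap T' \<chi> z = Fmap T' \<xi> t'" for e \<chi> \<xi>
    using that unfolding Q_def by blast
  have sub: "subfunctor C (prod_fun (yquot C c P) (yquot C c' R')) Q"
    unfolding subfunctor_def
  proof (intro conjI ballI allI impI subsetI)
    fix e s assume "s \<in> Q e"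
    then show "s \<in> Fob (prod_fun (yquot C c P) (yquot C c' R')) e"
      unfolding Q_def prod_fun_def using yquot_proj_in by auto
  next
    fix e assume "e \<notin> Obj C"
    then show "Q e = {}" using homD unfolding Q_def by blast
  next
    fix f s assume f: "f \<in> Arr C" and "s \<in> Q (Dom C f)"
    then obtain \<chi> \<xi> where s: "\<chi> \<in> hom C c (Dom C f)" "\<xi> \<in> hom C c' (Dom C f)"
      "Fmap T' \<chi> z = Fmap T' \<xi> t'" "s = (proj P (Dom C f) \<chi>, proj R' (Dom C f) \<xi>)"
      unfolding Q_def by blast
    note fh = arr_hom[OF f]
    show "Fmap (prod_fun (yquot C c P) (yquot C c' R')) f s \<in> Q (Cod C f)"
      using QI[OF comp_hom[OF s(1) fh] comp_hom[OF s(2) fh]] sf_comp[OF gD(2) s(1) fh z]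
        sf_comp[OF gD(2) s(2) fh gD(5)] s(3,4) yquot_Fmap[OF P(2) fh s(1)] yquot_Fmap[OF R' fh s(2)]
      by (simp add: prod_fun_def)
  qed
  have rep: "represents c' R' c T' t' (P, Q) z"
    unfolding represents_def
  proof (clarsimp simp: z P_def[symmetric])
    fix e \<chi> \<xi> assume \<chi>: "\<chi> \<in> hom C c e" and \<xi>: "\<xi> \<in> hom C c' e" and "(proj P e \<chi>, proj R' e \<xi>) \<in> Q e"
    then obtain \<chi>' \<xi>' where q: "proj P e \<chi> = proj P e \<chi>'" "proj R' e \<xi> = proj R' e \<xi>'"
      "\<chi>' \<in> hom C c e" "\<xi>' \<in> hom C c' e" "Fmap T' \<chi>' z = Fmap T' \<xi>' t'" unfolding Q_def by blast
    then have "(\<chi>, \<chi>') \<in> P e" "(\<xi>, \<xi>') \<in> R' e"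
      using yquot_proj_eq[OF P(2) \<chi>] yquot_proj_eq[OF R' \<xi>] by blast+
    then show "Fmap T' \<chi> z = Fmap T' \<xi> t'" using q(5) by (simp add: P_def gD(6) ev_ker_iff)
  qed
  have left: "\<exists>d. \<exists>h \<in> hom C e d. \<exists>\<xi> \<in> hom C c' d. (proj P d (h \<cdot> \<chi>), proj R' d \<xi>) \<in> Q d"
    if \<chi>: "\<chi> \<in> hom C c e" for e \<chi>
  proof -
    obtain d h \<xi> where h: "h \<in> hom C e d" "\<xi> \<in> hom C c' d" "Fmap T' \<xi> t' = Fmap T' h (Fmap T' \<chi> z)"
      using generates_loc[OF g _ sf_map[OF gD(2) \<chi> z]] homD[OF \<chi>] by metis
    then have "(proj P d (h \<cdot> \<chi>), proj R' d \<xi>) \<in> Q d"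
      using QI[OF comp_hom[OF \<chi> h(1)] h(2)] sf_comp[OF gD(2) \<chi> h(1) z] by simp
    then show ?thesis using h by blast
  qed
  have right: "\<exists>d. \<exists>h \<in> hom C e d. \<exists>\<chi> \<in> hom C c d. (proj P d \<chi>, proj R' d (h \<cdot> \<xi>)) \<in> Q d"
    if \<xi>: "\<xi> \<in> hom C c' e" for e \<xi>
  proof -
    \<comment> \<open>Some restriction of \<open>z\<close> is the translate of \<open>t'\<close>
      along \<zeta>; a common continuation of \<xi> and \<zeta> makes a translate of
      \<open>z\<close> meet the given \<xi>.\<close>
    obtain b f \<zeta> where f: "f \<in> hom C c b" "\<zeta> \<in> hom C c' b" "Fmap T' \<zeta> t' = Fmap T' f z"
      using generates_loc[OF g c z] .
    obtain d h k where hk: "h \<in> hom C e d" "k \<in> hom C b d" "h \<cdot> \<xi> = k \<cdot> \<zeta>" using amalgE[OF \<xi> f(2)] by metis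
    have "(proj P d (k \<cdot> f), proj R' d (h \<cdot> \<xi>)) \<in> Q d"
      using QI[OF comp_hom[OF f(1) hk(2)] comp_hom[OF \<xi> hk(1)]] sf_comp[OF gD(2) f(1) hk(2) z]
        sf_comp[OF gD(2) f(2) hk(2) gD(5)] f(3) hk(3) by simp
    then show ?thesis using hk comp_hom[OF f(1) hk(2)] by blast
  qed
  have "is_span c' R' c R P Q"
    by (rule is_spanI[OF P(1) R[folded P_def] sub represents_inj[OF g rep sub] left right])
  then show ?thesis using rep by (rule that)
qed

text \<open>The left leg is invertible after sheafification, so \<open>inv_into\<close> in
  \<open>span_arrow\<close> computes a natural inverse \<theta>, and naturality is inherited. The
  rule on units is what ties arrows of sheaves to the elements in \<open>represents\<close>.\<close>

lemma span_arrow_facts: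
  assumes o': "(c', R') \<in> ce_objects C" and o: "(c, R) \<in> ce_objects C"
    and s: "(P, Q) \<in> ce_triples C (c', R') (c, R)"
  shows "nat_trans C (shf (yquot C c P)) (shf (yquot C c' R')) (span_arrow C (c', R') (c, R) (P, Q))"
    and "(X, Z) \<in> Q e \<Longrightarrow> span_arrow C (c', R') (c, R) (P, Q) e (sheaf_unit (yquot C c P) e X) =
      sheaf_unit (yquot C c' R') e Z"
proof -
  note sD = is_spanD[OF s[unfolded ce_triples_iff[OF o' o]]]
  have R': "eqrel C (yoneda C c') R'" using ce_objectsD[OF o'] by auto
  define QF where "QF = span_fun C c c' P R' Q"
  note Y = set_functor_yquot[OF sD(6)] and Y' = set_functor_yquot[OF R']
  have QF: "set_functor C QF" "nat_trans C QF (yquot C c P) (\<lambda>_. fst)"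
    "nat_trans C QF (yquot C c' R') (\<lambda>_. snd)"
    unfolding QF_def span_fun_def using set_functor_sub_prod[OF Y Y' sD(3)] by auto
  define \<alpha> where "\<alpha> = sheafify_map C (yquot C c P) (\<lambda>_. fst :: 'b set \<times> 'b set \<Rightarrow> 'b set)"
  define \<beta> where "\<beta> = sheafify_map C (yquot C c' R') (\<lambda>_. snd :: 'b set \<times> 'b set \<Rightarrow> 'b set)"
  have \<beta>: "nat_trans C (shf QF) (shf (yquot C c' R')) \<beta>"
    unfolding \<beta>_def by (rule nat_trans_sheafify_map[OF QF(1) Y' QF(3)])
  have "nat_iso C (shf QF) (shf (yquot C c P)) \<alpha>"
    using s by (simp add: ce_triples_def QF_def \<alpha>_def Let_def)
  then obtain \<theta> where \<theta>: "nat_trans C (shf (yquot C c P)) (shf QF) \<theta>"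
    "\<And>e w. e \<in> Obj C \<Longrightarrow> w \<in> Fob (shf QF) e \<Longrightarrow> \<theta> e (\<alpha> e w) = w"
    "\<And>e w. e \<in> Obj C \<Longrightarrow> w \<in> Fob (shf (yquot C c P)) e \<Longrightarrow> \<alpha> e (\<theta> e w) = w"
    unfolding nat_iso_def by metis
  have sa: "span_arrow C (c', R') (c, R) (P, Q) e w = \<beta> e (\<theta> e w)"
    if e: "e \<in> Obj C" and w: "w \<in> Fob (shf (yquot C c P)) e" for e w
  proof -
    have "inj_on (\<alpha> e) (Fob (shf QF) e)" by (rule inj_on_inverseI[where g = "\<theta> e"]) (rule \<theta>(2)[OF e])
    then have "inv_into (Fob (shf QF) e) (\<alpha> e) (\<alpha> e (\<theta> e w)) = \<theta> e w"
      by (rule inv_into_f_f) (rule nt_map[OF \<theta>(1) e w])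
    then show ?thesis using \<theta>(3)[OF e w] by (simp add: span_arrow_def QF_def \<alpha>_def \<beta>_def)
  qed
  have comp: "nat_trans C (shf (yquot C c P)) (shf (yquot C c' R')) (\<lambda>e w. \<beta> e (\<theta> e w))"
    by (rule nat_trans_comp[OF \<theta>(1) \<beta>])
  show "nat_trans C (shf (yquot C c P)) (shf (yquot C c' R')) (span_arrow C (c', R') (c, R) (P, Q))"
  proof (rule nat_transI)
    fix a w assume "a \<in> Obj C" "w \<in> Fob (shf (yquot C c P)) a"
    then show "span_arrow C (c', R') (c, R) (P, Q) a w \<in> Fob (shf (yquot C c' R')) a"
      using sa nt_map[OF comp] by simp
  next
    fix f a b w assume f: "f \<in> hom C a b" and w: "w \<in> Fob (shf (yquot C c P)) a"
    have ab: "a \<in> Obj C" "b \<in> Obj C" using homD[OF f] by auto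
    note S = at_sheafD(1)[OF sheafify_facts(1)[OF Y]]
    show "span_arrow C (c', R') (c, R) (P, Q) b (Fmap (shf (yquot C c P)) f w) =
        Fmap (shf (yquot C c' R')) f (span_arrow C (c', R') (c, R) (P, Q) a w)"
      using sa[OF ab(1) w] sa[OF ab(2) sf_map[OF S f w]] nt_nat[OF comp f w] by simp
  qed
  assume q: "(X, Z) \<in> Q e"
  then have e: "e \<in> Obj C" by (rule span_elem[OF sD(3)])
  have q': "(X, Z) \<in> Fob QF e" using q by (simp add: QF_def span_fun_def sub_fun_def)
  note uq = nt_map[OF sheafify_facts(2)[OF QF(1)] e q']
  have X: "X \<in> Fob (yquot C c P) e" using nt_map[OF QF(2) e q'] by simp
  have 1: "\<alpha> e (sheaf_unit QF e (X, Z)) = sheaf_unit (yquot C c P) e X"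
    unfolding \<alpha>_def using sheafify_map_unit[OF QF(1) Y QF(2) e q'] by simp
  have 2: "\<beta> e (sheaf_unit QF e (X, Z)) = sheaf_unit (yquot C c' R') e Z"
    unfolding \<beta>_def using sheafify_map_unit[OF QF(1) Y' QF(3) e q'] by simp
  show "span_arrow C (c', R') (c, R) (P, Q) e (sheaf_unit (yquot C c P) e X) =
      sheaf_unit (yquot C c' R') e Z"
    using sa[OF e nt_map[OF sheafify_facts(2)[OF Y] e X]] \<theta>(2)[OF e uq] 1 2 by simp
qed

text \<open>Arrows out of a(yc/P) are compared on units at stages where both spans have partners;
  there, equality of the partners is equality of restrictions of \<open>z\<close> and
  \<open>z2\<close>. Equality of \<open>P\<close> and \<open>P2\<close> follows from that of the
  elements, whose kernels they are.\<close>

lemma ce_triple_rel_iff: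
  assumes o': "(c', R') \<in> ce_objects C" and o: "(c, R) \<in> ce_objects C"
    and g: "generates c' R' T' t'"
    and s1: "(P, Q) \<in> ce_triples C (c', R') (c, R)" and s2: "(P2, Q2) \<in> ce_triples C (c', R') (c, R)"
    and r1: "represents c' R' c T' t' (P, Q) z" and r2: "represents c' R' c T' t' (P2, Q2) z2"
  shows "((P, Q), (P2, Q2)) \<in> ce_triple_rel C (c', R') (c, R) \<longleftrightarrow> z = z2"
proof -
  note sp1 = s1[unfolded ce_triples_iff[OF o' o]] and sp2 = s2[unfolded ce_triples_iff[OF o' o]]
  note sD = is_spanD[OF sp1] and gD = generatesD[OF g]
  note a1 = span_arrow_facts[OF o' o s1] and a2 = span_arrow_facts[OF o' o s2]
  have c: "c \<in> Obj C" and R': "closed_eqrel C (yoneda C c') R'" "eqrel C (yoneda C c') R'"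
    using ce_objectsD[OF o'] ce_objectsD[OF o] by auto
  note Y = set_functor_yquot[OF sD(6)] and Y' = set_functor_yquot[OF R'(2)]
  note sep' = separated_yquot[OF R'(1)]
  have both: "\<exists>d. \<exists>h \<in> hom C e d. \<exists>\<xi> \<in> hom C c' d. \<exists>\<xi>2 \<in> hom C c' d.
      (proj P d (h \<cdot> \<chi>), proj R' d \<xi>) \<in> Q d \<and> (proj P2 d (h \<cdot> \<chi>), proj R' d \<xi>2) \<in> Q2 d"
    if \<chi>: "\<chi> \<in> hom C c e" for e \<chi>
  proof -
    obtain d h \<xi> where h: "h \<in> hom C e d" "\<xi> \<in> hom C c' d" "(proj P d (h \<cdot> \<chi>), proj R' d \<xi>) \<in> Q d"
      using is_span_left[OF sp1 \<chi>] .
    obtain d' k \<xi>2 where k: "k \<in> hom C d d'" "\<xi>2 \<in> hom C c' d'"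
      "(proj P2 d' (k \<cdot> (h \<cdot> \<chi>)), proj R' d' \<xi>2) \<in> Q2 d'"
      using is_span_left[OF sp2 comp_hom[OF \<chi> h(1)]] .
    have "(proj P d' (k \<cdot> (h \<cdot> \<chi>)), proj R' d' (k \<cdot> \<xi>)) \<in> Q d'"
      using span_stable[OF sD(3,6) R'(2) k(1) comp_hom[OF \<chi> h(1)] h(2,3)] .
    moreover have "k \<cdot> (h \<cdot> \<chi>) = (k \<cdot> h) \<cdot> \<chi>" using comp_assoc[OF \<chi> h(1) k(1)] by simp
    ultimately show ?thesis using k comp_hom[OF h(1) k(1)] comp_hom[OF h(2) k(1)] by metis
  qed
  have same: "proj R' d \<xi> = proj R' d \<xi>2 \<longleftrightarrow> Fmap T' \<chi> z = Fmap T' \<chi> z2"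
    if "(proj P d \<chi>, proj R' d \<xi>) \<in> Q d" "(proj P2 d \<chi>, proj R' d \<xi>2) \<in> Q2 d"
      "\<chi> \<in> hom C c d" "\<xi> \<in> hom C c' d" "\<xi>2 \<in> hom C c' d" for d \<chi> \<xi> \<xi>2
    using yquot_proj_eq[OF R'(2) that(4,5)] representsD(3)[OF r1 that(3,4,1)]
      representsD(3)[OF r2 that(3,5,2)] that(4,5) by (simp add: gD(6) ev_ker_iff)
  show ?thesis
  proof
    assume rel: "((P, Q), (P2, Q2)) \<in> ce_triple_rel C (c', R') (c, R)"
    then have PP: "P = P2" and ar: "\<And>e w. e \<in> Obj C \<Longrightarrow> w \<in> Fob (shf (yquot C c P)) e \<Longrightarrow>
      span_arrow C (c', R') (c, R) (P, Q) e w = span_arrow C (c', R') (c, R) (P2, Q2) e w"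
      by (auto simp: ce_triple_rel_def)
    obtain d h \<xi> \<xi>2 where h: "h \<in> hom C c d" "\<xi> \<in> hom C c' d" "\<xi>2 \<in> hom C c' d"
      "(proj P d h, proj R' d \<xi>) \<in> Q d" "(proj P2 d h, proj R' d \<xi>2) \<in> Q2 d"
      using both[OF id_hom[OF c]] comp_id_right by metis
    have d: "d \<in> Obj C" using homD[OF h(1)] by blast
    have "sheaf_unit (yquot C c' R') d (proj R' d \<xi>) = sheaf_unit (yquot C c' R') d (proj R' d \<xi>2)"
      using a1(2)[OF h(4)] a2(2)[OF h(5)] PP
        ar[OF d nt_map[OF sheafify_facts(2)[OF Y] d yquot_proj_in[OF h(1)]]] by simp
    then have "proj R' d \<xi> = proj R' d \<xi>2"
      using sheaf_unit_inj[OF Y' sep' d yquot_proj_in[OF h(2)] yquot_proj_in[OF h(3)]] by blast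
    then have "Fmap T' h z = Fmap T' h z2" using same[OF h(4,5,1,2,3)] by blast
    then show "z = z2"
      using separatedD[OF gD(3) h(1)] representsD(1)[OF r1] representsD(1)[OF r2] by blast
  next
    assume z: "z = z2"
    then have PP: "P = P2" using representsD(2)[OF r1] representsD(2)[OF r2] by simp
    have "span_arrow C (c', R') (c, R) (P, Q) e w = span_arrow C (c', R') (c, R) (P2, Q2) e w"
      if e: "e \<in> Obj C" and w: "w \<in> Fob (shf (yquot C c P)) e" for e w
    proof -
      note S = sheafify_facts[OF Y] and S' = sheafify_facts[OF Y']
      note a2' = a2[folded PP]
      obtain d h X where h: "h \<in> hom C e d" "X \<in> Fob (yquot C c P) d"
        "sheaf_unit (yquot C c P) d X = Fmap (shf (yquot C c P)) h w"
        using locally_surjE[OF S(4) e w] .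
      have d: "d \<in> Obj C" using homD[OF h(1)] by blast
      obtain \<chi> where \<chi>: "\<chi> \<in> hom C c d" "X = proj P d \<chi>" using h(2) by (rule yquot_FobE)
      obtain b k \<xi> \<xi>2 where k: "k \<in> hom C d b" "\<xi> \<in> hom C c' b" "\<xi>2 \<in> hom C c' b"
        "(proj P b (k \<cdot> \<chi>), proj R' b \<xi>) \<in> Q b" "(proj P2 b (k \<cdot> \<chi>), proj R' b \<xi>2) \<in> Q2 b"
        using both[OF \<chi>(1)] by metis
      note kh = comp_hom[OF h(1) k(1)]
      have "Fmap (shf (yquot C c P)) (k \<cdot> h) w = sheaf_unit (yquot C c P) b (proj P b (k \<cdot> \<chi>))"
        using sf_comp[OF at_sheafD(1)[OF S(1)] h(1) k(1) w] h(3) nt_nat[OF S(2) k(1) h(2)]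
          yquot_Fmap[OF sD(6) k(1) \<chi>(1)] \<chi>(2) by simp
      moreover have "proj R' b \<xi> = proj R' b \<xi>2"
        using same[OF k(4,5) comp_hom[OF \<chi>(1) k(1)] k(2,3)] z by simp
      ultimately have "Fmap (shf (yquot C c' R')) (k \<cdot> h) (span_arrow C (c', R') (c, R) (P, Q) e w) =
          Fmap (shf (yquot C c' R')) (k \<cdot> h) (span_arrow C (c', R') (c, R) (P, Q2) e w)"
        using nt_nat[OF a1(1) kh w] nt_nat[OF a2'(1) kh w] a1(2)[OF k(4)] a2'(2)[OF k(5)[folded PP]]
        by simp
      then show ?thesis
        using separatedD[OF at_sheafD(2)[OF S'(1)] kh nt_map[OF a1(1) e w] nt_map[OF a2'(1) e w]] PP
        by simp
    qed
    then show "((P, Q), (P2, Q2)) \<in> ce_triple_rel C (c', R') (c, R)"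
      using s1 s2 PP by (auto simp: ce_triple_rel_def)
  qed
qed

text \<open>The diagonal of yc/R pairs every class with itself, so the element attached to it is the
  generator.\<close>

lemma ce_identity:
  assumes o: "(c, R) \<in> ce_objects C" and g: "generates c R T t"
  shows "is_span c R c R R (\<lambda>e. Id_on (Fob (yquot C c R) e))"
    and "represents c R c T t (R, \<lambda>e. Id_on (Fob (yquot C c R) e)) t"
proof -
  note gD = generatesD[OF g]
  have R: "closed_eqrel C (yoneda C c) R" "eqrel C (yoneda C c) R" using ce_objectsD[OF o] by auto
  note Y = set_functor_yquot[OF R(2)]
  have in_iff: "(proj R e \<chi>, proj R e \<xi>) \<in> Id_on (Fob (yquot C c R) e) \<longleftrightarrow> proj R e \<chi> = proj R e \<xi>"
    if "\<chi> \<in> hom C c e" for e \<chi> \<xi>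
    using yquot_proj_in[OF that] by (metis Id_on_iff)
  show "represents c R c T t (R, \<lambda>e. Id_on (Fob (yquot C c R) e)) t"
    unfolding represents_def using in_iff yquot_proj_eq[OF R(2)] gD(5,6) by (auto simp: ev_ker_iff)
  have empty: "Fob (yquot C c R) e = {}" if "e \<notin> Obj C" for e
    using that homD by (auto elim!: yquot_FobE)
  have id: "\<exists>d. \<exists>h \<in> hom C e d. h \<cdot> \<chi> \<in> hom C c d" if "\<chi> \<in> hom C c e" for e \<chi>
    using that homD[OF that] id_hom comp_hom by blast
  show "is_span c R c R R (\<lambda>e. Id_on (Fob (yquot C c R) e))"
  proof (rule is_spanI[OF R(1)])
    show "subfunctor C (prod_fun (yquot C c R) (yquot C c R)) (\<lambda>e. Id_on (Fob (yquot C c R) e))"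
      unfolding subfunctor_def using empty sf_map[OF Y arr_hom] by (auto simp: prod_fun_def Id_on_def)
    show "\<exists>d. \<exists>h \<in> hom C e d. \<exists>\<xi> \<in> hom C c d. (proj R d (h \<cdot> \<chi>), proj R d \<xi>) \<in> Id_on (Fob (yquot C c R) d)"
      if "\<chi> \<in> hom C c e" for e \<chi>
      using id[OF that] in_iff by blast
    show "\<exists>d. \<exists>h \<in> hom C e d. \<exists>\<chi> \<in> hom C c d. (proj R d \<chi>, proj R d (h \<cdot> \<xi>)) \<in> Id_on (Fob (yquot C c R) d)"
      if "\<xi> \<in> hom C c e" for e \<xi>
      using id[OF that] in_iff by blast
  qed auto
qed

end

section \<open>The composite of two spans\<close>

context amalg_category
begin

lemma locally_extend:
  assumes s: "is_span c' R' c R P Q" and R': "eqrel C (yoneda C c') R'"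
    and \<chi>: "\<chi> \<in> hom C c e" "\<chi>' \<in> hom C c e"
  obtains d h \<xi> \<xi>' where "h \<in> hom C e d" "\<xi> \<in> hom C c' d" "\<xi>' \<in> hom C c' d"
    "(proj P d (h \<cdot> \<chi>), proj R' d \<xi>) \<in> Q d" "(proj P d (h \<cdot> \<chi>'), proj R' d \<xi>') \<in> Q d"
proof -
  note sD = is_spanD[OF s]
  obtain d h \<xi> where h: "h \<in> hom C e d" "\<xi> \<in> hom C c' d" "(proj P d (h \<cdot> \<chi>), proj R' d \<xi>) \<in> Q d"
    using is_span_left[OF s \<chi>(1)] .
  obtain d' k \<xi>' where k: "k \<in> hom C d d'" "\<xi>' \<in> hom C c' d'"
    "(proj P d' (k \<cdot> (h \<cdot> \<chi>')), proj R' d' \<xi>') \<in> Q d'"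
    using is_span_left[OF s comp_hom[OF \<chi>(2) h(1)]] .
  have "(proj P d' ((k \<cdot> h) \<cdot> \<chi>), proj R' d' (k \<cdot> \<xi>)) \<in> Q d'"
    using span_stable[OF sD(3,6) R' k(1) comp_hom[OF \<chi>(1) h(1)] h(2,3)] comp_assoc[OF \<chi>(1) h(1) k(1)]
    by simp
  moreover have "(proj P d' ((k \<cdot> h) \<cdot> \<chi>'), proj R' d' \<xi>') \<in> Q d'"
    using k(3) comp_assoc[OF \<chi>(2) h(1) k(1)] by simp
  ultimately show ?thesis
    using that comp_hom[OF h(1) k(1)] comp_hom[OF h(2) k(1)] k(2) by blast
qed

text \<open>The stages of the construction are compared with \<open>T''\<close> by evaluation at
  \<open>v = \<psi> c z\<close>. The generated relation \<open>kr\<close> lies in the kernel of the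
  induced map \<open>u\<close> on yc/P, and \<open>S\<close> lies in the preimage of
  \<open>kr\<close>, so \<open>P0\<close> relates only arrows with equal values at \<open>v\<close>.
  Conversely, two arrows with equal values at \<open>v\<close> acquire after restriction partners in
  \<open>Q\<close> that \<open>P'\<close> identifies, that is, a pair coming from \<open>H\<close>.
  Hence \<open>P''\<close> is exactly the kernel of \<open>v\<close>, and a chase through
  \<open>N\<close> shows that \<open>Q''\<close> pairs arrows with equal values.\<close>

lemma represents_comp:
  assumes o: "(c, R) \<in> ce_objects C" and o': "(c', R') \<in> ce_objects C" and o'': "(c'', R'') \<in> ce_objects C"
    and g': "generates c' R' T' t'" and g'': "generates c'' R'' T'' t''"
    and s: "is_span c' R' c R P Q" and s': "is_span c'' R'' c' R' P' Q'"
    and r: "represents c' R' c T' t' (P, Q) z" and r': "represents c'' R'' c' T'' t'' (P', Q') z'"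
    and \<psi>: "nat_trans C T' T'' \<psi>" "\<psi> c' t' = z'"
  shows "case ce_comp C (c'', R'') (c', R') (c, R) (P, Q) (P', Q') of (P'', Q'') \<Rightarrow>
    is_span c'' R'' c R P'' Q'' \<and> represents c'' R'' c T'' t'' (P'', Q'') (\<psi> c z)"
proof -
  note sD = is_spanD[OF s] and sD' = is_spanD[OF s'] and gD' = generatesD[OF g'] and gD'' = generatesD[OF g'']
  note rD = representsD[OF r] and rD' = representsD[OF r']
  have c: "c \<in> Obj C" using ce_objectsD[OF o] by auto
  have R: "eqrel C (yoneda C c) R" and R': "eqrel C (yoneda C c') R'"
    and R'': "eqrel C (yoneda C c'') R''"
    using ce_objectsD[OF o] ce_objectsD[OF o'] ce_objectsD[OF o''] by auto
  note P = sD(6) and P' = sD'(6)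
  define v where "v = \<psi> c z"
  have v: "v \<in> Fob T'' c" unfolding v_def using nt_map[OF \<psi>(1) c rD(1)] .
  have ev: "Fmap T'' \<chi> v = \<psi> e (Fmap T' \<chi> z)" if "\<chi> \<in> hom C c e" for \<chi> e
    using nt_nat[OF \<psi>(1) that rD(1)] by (simp add: v_def)
  have et: "Fmap T'' \<xi> z' = \<psi> e (Fmap T' \<xi> t')" if "\<xi> \<in> hom C c' e" for \<xi> e
    using nt_nat[OF \<psi>(1) that gD'(5)] \<psi>(2) by simp

  \<comment> \<open>The names are those of the construction in \<open>ce_comp\<close>. The functor
    K' is \<open>quot C QF kq\<close>, and K enters through its relation \<open>kr\<close>.\<close>
  define QF where "QF = span_fun C c c' P R' Q"
  define QF' where "QF' = span_fun C c' c'' P' R'' Q'"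
  define ycR where "ycR = yquot C c R"
  define ycP where "ycP = yquot C c P"
  define Pt' where "Pt' = (\<lambda>e. (\<lambda>(x, y). (proj R' e x, proj R' e y)) ` P' e)"
  define L where "L = sub_fun (prod_fun QF QF)
             (\<lambda>e. {(s, t). s \<in> Q e \<and> t \<in> Q e \<and> (snd s, snd t) \<in> Pt' e})"
  define H where "H = pullback L (prod_fun ycR ycR)
             (\<lambda>e l. (fst (fst l), fst (snd l))) (\<lambda>e. map_prod (quot_proj P e) (quot_proj P e))"
  define S where "S = eqrel_generated C ycR (\<lambda>e. snd ` Fob H e)"
  define P0 where "P0 = (\<lambda>e. {(x, y). x \<in> hom C c e \<and> y \<in> hom C c e \<and> (proj R e x, proj R e y) \<in> S e})"
  define P'' where "P'' = at_closure C (yoneda C c) P0"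
  define kr where "kr = coeq_rel C L ycP (\<lambda>e l. fst (fst l)) (\<lambda>e l. fst (snd l))"
  define kq where "kq = coeq_rel C L QF (\<lambda>e. fst) (\<lambda>e. snd)"
  define b1 where "b1 = induced (\<lambda>e x. proj kr e (quot_proj P e (proj R e x)))"
  define b2 where "b2 = induced (\<lambda>e (s :: 'b set \<times> 'b set). proj kr e (fst s))"
  define b3 where "b3 = induced (\<lambda>e (s :: 'b set \<times> 'b set). quot_proj P' e (snd s))"
  define M where "M = pullback (yquot C c P0) (quot C QF kq) b1 b2"
  define W where "W = pullback (quot C QF kq) QF' b3 (\<lambda>e. fst)"
  define N where "N = pullback M W (\<lambda>e. snd) (\<lambda>e. fst)"
  define Q'' where "Q'' = (\<lambda>e. (\<lambda>n. (quot_proj P'' e (fst (fst n)), snd (snd (snd n)))) ` Fob N e)"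

  have comp: "ce_comp C (c'', R'') (c', R') (c, R) (P, Q) (P', Q') = (P'', Q'')"
    unfolding Q''_def N_def W_def M_def b1_def b2_def b3_def kq_def kr_def P''_def P0_def S_def H_def
      L_def Pt'_def ycP_def ycR_def QF_def QF'_def
    by (simp only: ce_comp_def Let_def prod.case coequalizer_def)

  note YR = set_functor_yquot[OF R, folded ycR_def] and YP = set_functor_yquot[OF P, folded ycP_def]
    and YR' = set_functor_yquot[OF R'] and YP' = set_functor_yquot[OF P']
  have QF: "set_functor C QF" "nat_trans C QF ycP (\<lambda>_. fst)" "nat_trans C QF (yquot C c' R') (\<lambda>_. snd)"
    unfolding QF_def span_fun_def ycP_def
    using set_functor_sub_prod[OF set_functor_yquot[OF P] YR' sD(3)] by auto
  have QFob: "Fob QF e = Q e" for e by (simp add: QF_def span_fun_def sub_fun_def)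
  have QFob': "Fob QF' e = Q' e" for e by (simp add: QF'_def span_fun_def sub_fun_def)
  have LFob: "(s1, s2) \<in> Fob L e \<longleftrightarrow> s1 \<in> Q e \<and> s2 \<in> Q e \<and> (snd s1, snd s2) \<in> Pt' e" for s1 s2 e
    by (simp add: L_def sub_fun_def)
  have qR: "quot_proj P e (proj R e \<chi>) = proj P e \<chi>" if "\<chi> \<in> hom C c e" for e \<chi>
    using quot_proj_proj[OF R P sD(2) that] .
  have qR': "quot_proj P' e (proj R' e \<xi>) = proj P' e \<xi>" if "\<xi> \<in> hom C c' e" for e \<xi>
    using quot_proj_proj[OF R' P' sD'(2) that] .
  have nq: "nat_trans C ycR ycP (quot_proj P)"
    unfolding ycR_def ycP_def by (rule nat_trans_quot_proj[OF R P sD(2)])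
  have nq': "nat_trans C (yquot C c' R') (yquot C c' P') (quot_proj P')"
    by (rule nat_trans_quot_proj[OF R' P' sD'(2)])

  have Pt': "(proj R' e \<xi>, proj R' e \<xi>') \<in> Pt' e \<longleftrightarrow> (\<xi>, \<xi>') \<in> P' e"
    if \<xi>: "\<xi> \<in> hom C c' e" "\<xi>' \<in> hom C c' e" for e \<xi> \<xi>'
  proof
    assume "(proj R' e \<xi>, proj R' e \<xi>') \<in> Pt' e"
    then obtain x y where xy: "(x, y) \<in> P' e" "proj R' e \<xi> = proj R' e x" "proj R' e \<xi>' = proj R' e y"
      by (auto simp: Pt'_def)
    then have "x \<in> hom C c' e" "y \<in> hom C c' e" using eqrel_in[OF P' xy(1)] by auto
    then have "quot_proj P' e (proj R' e \<xi>) = proj P' e x" "quot_proj P' e (proj R' e \<xi>') = proj P' e y"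
      "proj P' e x = proj P' e y"
      using xy qR' yquot_proj_eq[OF P'] by auto
    then show "(\<xi>, \<xi>') \<in> P' e" using qR' \<xi> yquot_proj_eq[OF P' \<xi>] by simp
  qed (force simp: Pt'_def)

  have P'_iff: "(\<xi>, \<xi>') \<in> P' e \<longleftrightarrow> Fmap T'' \<xi> z' = Fmap T'' \<xi>' z'"
    if "\<xi> \<in> hom C c' e" "\<xi>' \<in> hom C c' e" for e \<xi> \<xi>'
    using that by (simp add: rD'(2) ev_ker_iff)
  have Qv: "Fmap T'' \<chi> v = Fmap T'' \<xi> z'"
    if "\<chi> \<in> hom C c e" "\<xi> \<in> hom C c' e" "(proj P e \<chi>, proj R' e \<xi>) \<in> Q e" for e \<chi> \<xi>
    using rD(3)[OF that] ev[OF that(1)] et[OF that(2)] by simp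

  \<comment> \<open>Evaluation at \<open>v\<close> factors through yc/P because \<open>P\<close> is
    the kernel of \<open>z\<close> and \<open>v\<close> is the image of \<open>z\<close> under
    \<psi>.\<close>
  define u where "u = induced (ev T'' v)"
  have uP: "u e (proj P e \<chi>) = Fmap T'' \<chi> v" if \<chi>: "\<chi> \<in> hom C c e" for e \<chi>
  proof -
    have "u e (proj P e \<chi>) = ev T'' v e \<chi>"
      unfolding u_def
    proof (rule induced_proj[OF P])
      fix y assume y: "(\<chi>, y) \<in> P e"
      then have yh: "y \<in> hom C c e" using eqrel_in[OF P] by auto
      have "Fmap T' \<chi> z = Fmap T' y z" using y by (simp add: rD(2) ev_ker_iff)
      then show "ev T'' v e \<chi> = ev T'' v e y" using ev[OF \<chi>] ev[OF yh] by (simp add: ev_def)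
    qed (use homD[OF \<chi>] \<chi> in auto)
    then show ?thesis by (simp add: ev_def)
  qed
  have nu: "nat_trans C ycP T'' u"
    unfolding u_def ycP_def yquot_def
  proof (rule nat_trans_induced[OF set_functor_yoneda P nat_trans_ev[OF gD''(2) v]])
    fix e x y assume xy: "(x, y) \<in> P e"
    then have "x \<in> hom C c e" "y \<in> hom C c e" "proj P e x = proj P e y"
      using eqrel_in[OF P xy] yquot_proj_eq[OF P] by auto
    then show "ev T'' v e x = ev T'' v e y" using uP by (metis ev_def)
  qed
  \<comment> \<open>Two pairs joined by \<open>L\<close> have second components related by
    \<open>P'\<close>, the kernel of \<open>z'\<close>; hence \<open>u\<close> coequalizes the two
    maps from \<open>L\<close>.\<close>
  have Lu: "u e (fst s1) = u e (fst s2)" if l: "(s1, s2) \<in> Fob L e" for s1 s2 e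
  proof -
    have q: "s1 \<in> Q e" "s2 \<in> Q e" "(snd s1, snd s2) \<in> Pt' e" using l by (auto simp: LFob)
    obtain \<chi> \<xi> where 1: "\<chi> \<in> hom C c e" "\<xi> \<in> hom C c' e" "s1 = (proj P e \<chi>, proj R' e \<xi>)"
      using span_elem[OF sD(3) q(1)] .
    obtain \<chi>' \<xi>' where 2: "\<chi>' \<in> hom C c e" "\<xi>' \<in> hom C c' e" "s2 = (proj P e \<chi>', proj R' e \<xi>')"
      using span_elem[OF sD(3) q(2)] .
    have "(\<xi>, \<xi>') \<in> P' e" using q(3) 1 2 Pt' by simp
    then show ?thesis
      using Qv[OF 1(1,2)] Qv[OF 2(1,2)] P'_iff[OF 1(2) 2(2)] uP[OF 1(1)] uP[OF 2(1)] q 1(3) 2(3) by simp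
  qed

  have kr: "eqrel C ycP kr"
    unfolding kr_def coeq_rel_def by (rule eqrel_generated_eqrel[OF YP])
  have kq: "eqrel C QF kq"
    unfolding kq_def coeq_rel_def by (rule eqrel_generated_eqrel[OF QF(1)])
  have Se: "eqrel C ycR S" unfolding S_def by (rule eqrel_generated_eqrel[OF YR])

  have krI: "(fst s1, fst s2) \<in> kr e" if l: "(s1, s2) \<in> Fob L e" for s1 s2 e
  proof -
    have q: "s1 \<in> Q e" "s2 \<in> Q e" using l by (auto simp: LFob)
    have e: "e \<in> Obj C" using span_elem[OF sD(3) q(1)] .
    show ?thesis
      unfolding kr_def coeq_rel_def
    proof (rule eqrel_generated_incl[OF e])
      show "(fst s1, fst s2) \<in> (\<lambda>l. (fst (fst l), fst (snd l))) ` Fob L e"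
        using l by (metis (no_types, lifting) fst_conv image_eqI snd_conv)
    qed (use nt_map[OF QF(2) e] q QFob in auto)
  qed
  \<comment> \<open>Minimality of the generated relation bounds \<open>kr\<close> by the kernel of
    \<open>u\<close>.\<close>
  have kr_ker: "u e X = u e Y" if "(X, Y) \<in> kr e" for e X Y
  proof -
    have "(X, Y) \<in> ker_rel ycP u e"
    proof (rule eqrel_generated_least[OF eqrel_ker_rel[OF YP nu] _ that[unfolded kr_def coeq_rel_def]])
      fix e x y assume e: "e \<in> Obj C" and "(x, y) \<in> (\<lambda>l. (fst (fst l), fst (snd l))) ` Fob L e"
      then obtain s1 s2 where l: "(s1, s2) \<in> Fob L e" "x = fst s1" "y = fst s2" by auto
      then show "(x, y) \<in> ker_rel ycP u e"
        using Lu[OF l(1)] e nt_map[OF QF(2) e] QFob by (auto simp: ker_rel_iff LFob)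
    qed
    then show ?thesis by (simp add: ker_rel_iff)
  qed
  have HE: "\<exists>s1 s2. (s1, s2) \<in> Fob L e \<and> X \<in> Fob ycR e \<and> Y \<in> Fob ycR e \<and>
      quot_proj P e X = fst s1 \<and> quot_proj P e Y = fst s2" if "(X, Y) \<in> snd ` Fob H e" for e X Y
    using that by (force simp: H_def pullback_def prod_fun_def)
  \<comment> \<open>The preimage of \<open>kr\<close> along the projection to yc/P is an equivalence
    relation containing the pairs from \<open>H\<close>, so it contains \<open>S\<close>.\<close>
  have S_kr: "(quot_proj P e X, quot_proj P e Y) \<in> kr e" if r: "(X, Y) \<in> S e" for e X Y
  proof -
    note E = eqrel_vimage[OF YR nq kr]
    have "(X, Y) \<in> {(x, y). e \<in> Obj C \<and> x \<in> Fob ycR e \<and> y \<in> Fob ycR e \<and>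
        (quot_proj P e x, quot_proj P e y) \<in> kr e}"
    proof (rule eqrel_generated_least[OF E _ r[unfolded S_def]])
      fix e x y assume e: "e \<in> Obj C" and xy: "(x, y) \<in> snd ` Fob H e"
      obtain s1 s2 where l: "(s1, s2) \<in> Fob L e" "x \<in> Fob ycR e" "y \<in> Fob ycR e"
        "quot_proj P e x = fst s1" "quot_proj P e y = fst s2" using HE[OF xy] by blast
      show "(x, y) \<in> {(x, y). e \<in> Obj C \<and> x \<in> Fob ycR e \<and> y \<in> Fob ycR e \<and>
          (quot_proj P e x, quot_proj P e y) \<in> kr e}"
        using l(2-5) krI[OF l(1)] e by simp
    qed
    then show ?thesis by simp
  qed
  have P0_kr: "(proj P e \<chi>, proj P e \<chi>') \<in> kr e" if "(\<chi>, \<chi>') \<in> P0 e" for e \<chi> \<chi>'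
    using that S_kr qR by (fastforce simp: P0_def)

  have P0: "eqrel C (yoneda C c) P0"
  proof -
    have n: "nat_trans C (yoneda C c) ycR (proj R)"
      unfolding ycR_def yquot_def by (rule nat_trans_proj[OF set_functor_yoneda R])
    have "P0 = (\<lambda>e. {(x, y). e \<in> Obj C \<and> x \<in> Fob (yoneda C c) e \<and> y \<in> Fob (yoneda C c) e \<and>
        (proj R e x, proj R e y) \<in> S e})"
      using homD by (auto simp: P0_def fun_eq_iff)
    then show ?thesis using eqrel_vimage[OF set_functor_yoneda n Se] by simp
  qed

  have P''_eq: "P'' = ev_ker c T'' v"
  proof -
    have "(\<chi>, \<chi>') \<in> P'' e \<longleftrightarrow> (\<chi>, \<chi>') \<in> ev_ker c T'' v e" for e \<chi> \<chi>'
    proof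
      assume "(\<chi>, \<chi>') \<in> P'' e"
      then obtain d h where h: "\<chi> \<in> hom C c e" "\<chi>' \<in> hom C c e" "h \<in> hom C e d" "(h \<cdot> \<chi>, h \<cdot> \<chi>') \<in> P0 d"
        by (auto simp: P''_def at_closure_iff)
      have "Fmap T'' (h \<cdot> \<chi>) v = Fmap T'' (h \<cdot> \<chi>') v"
        using kr_ker[OF P0_kr[OF h(4)]] uP comp_hom[OF h(1,3)] comp_hom[OF h(2,3)] by simp
      then show "(\<chi>, \<chi>') \<in> ev_ker c T'' v e"
        using closed_eqrelD[OF closed_ev_ker[OF gD''(2,3) v] h(3), of \<chi> \<chi>']
          h comp_hom[OF h(1,3)] comp_hom[OF h(2,3)] by (simp add: ev_ker_iff)
    next
      assume "(\<chi>, \<chi>') \<in> ev_ker c T'' v e"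
      then have x: "\<chi> \<in> hom C c e" "\<chi>' \<in> hom C c e" "Fmap T'' \<chi> v = Fmap T'' \<chi>' v"
        by (simp_all add: ev_ker_iff)
      \<comment> \<open>Both arrows get partners in \<open>Q\<close> at a common stage, and equality
        of the values at \<open>v\<close> turns into \<open>P'\<close>-relatedness of the partners.
        The arrow \<open>h\<close> is absorbed by the closure that defines
        \<open>P''\<close>.\<close>
      obtain d h \<xi> \<xi>' where h: "h \<in> hom C e d" "\<xi> \<in> hom C c' d" "\<xi>' \<in> hom C c' d"
        "(proj P d (h \<cdot> \<chi>), proj R' d \<xi>) \<in> Q d" "(proj P d (h \<cdot> \<chi>'), proj R' d \<xi>') \<in> Q d"
        using locally_extend[OF s R' x(1,2)] .
      note hx = comp_hom[OF x(1) h(1)] and hx' = comp_hom[OF x(2) h(1)]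
      have d: "d \<in> Obj C" using homD[OF h(1)] by blast
      have "Fmap T'' \<xi> z' = Fmap T'' \<xi>' z'"
        using Qv[OF hx h(2,4)] Qv[OF hx' h(3,5)] sf_comp[OF gD''(2) x(1) h(1) v]
          sf_comp[OF gD''(2) x(2) h(1) v] x(3) by simp
      then have "((proj P d (h \<cdot> \<chi>), proj R' d \<xi>), (proj P d (h \<cdot> \<chi>'), proj R' d \<xi>')) \<in> Fob L d"
        using P'_iff[OF h(2,3)] Pt'[OF h(2,3)] h(4,5) by (simp add: LFob)
      then have "(((proj P d (h \<cdot> \<chi>), proj R' d \<xi>), (proj P d (h \<cdot> \<chi>'), proj R' d \<xi>')),
          (proj R d (h \<cdot> \<chi>), proj R d (h \<cdot> \<chi>'))) \<in> Fob H d"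
        using qR[OF hx] qR[OF hx'] yquot_proj_in[OF hx] yquot_proj_in[OF hx']
        by (simp add: H_def pullback_def prod_fun_def ycR_def)
      then have "(proj R d (h \<cdot> \<chi>), proj R d (h \<cdot> \<chi>')) \<in> snd ` Fob H d" by force
      then have "(proj R d (h \<cdot> \<chi>), proj R d (h \<cdot> \<chi>')) \<in> S d"
        unfolding S_def using yquot_proj_in[OF hx] yquot_proj_in[OF hx']
        by (intro eqrel_generated_incl d) (auto simp: ycR_def)
      then have "(h \<cdot> \<chi>, h \<cdot> \<chi>') \<in> P0 d" using hx hx' by (simp add: P0_def)
      then show "(\<chi>, \<chi>') \<in> P'' e" using x h(1) by (auto simp: P''_def at_closure_iff)
    qed
    then show ?thesis by (intro ext) auto
  qed
  have P'': "closed_eqrel C (yoneda C c) P''" "eqrel C (yoneda C c) P''"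
    unfolding P''_eq using closed_ev_ker[OF gD''(2,3) v] closed_eqrel_imp_eqrel by blast+
  have P0P'': "P0 e \<subseteq> P'' e" for e
  proof
    fix p assume p: "p \<in> P0 e"
    obtain x y where xy: "p = (x, y)" by (cases p)
    have i: "e \<in> Obj C" "x \<in> hom C c e" "y \<in> hom C c e" using eqrel_in[OF P0] p xy by auto
    show "p \<in> P'' e"
      using p i id_hom[OF i(1)] comp_id_left[OF i(2)] comp_id_left[OF i(3)] unfolding xy P''_def at_closure_iff
      by (metis yoneda_simps)
  qed
  have RP'': "R e \<subseteq> P'' e" for e
  proof
    fix p assume p: "p \<in> R e"
    obtain x y where xy: "p = (x, y)" by (cases p)
    have i: "e \<in> Obj C" "x \<in> hom C c e" "y \<in> hom C c e" using eqrel_in[OF R] p xy by auto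
    have "(x, y) \<in> ev_ker c T' z e" using p xy sD(2) rD(2) by blast
    then show "p \<in> P'' e" unfolding xy P''_eq using i ev by (simp add: ev_ker_iff)
  qed

  \<comment> \<open>The induced arrows are evaluated on classes; each time the defining map has to
    be constant on the classes of the relation divided out.\<close>
  have b1: "b1 e (proj P0 e \<chi>) = proj kr e (proj P e \<chi>)" if \<chi>: "\<chi> \<in> hom C c e" for e \<chi>
  proof -
    have e: "e \<in> Obj C" using homD[OF \<chi>] by blast
    have "b1 e (proj P0 e \<chi>) = proj kr e (quot_proj P e (proj R e \<chi>))"
      unfolding b1_def
    proof (rule induced_proj[OF P0 e])
      fix y assume y: "(\<chi>, y) \<in> P0 e"
      have yh: "y \<in> hom C c e" using eqrel_in[OF P0 y] by simp
      show "proj kr e (quot_proj P e (proj R e \<chi>)) = proj kr e (quot_proj P e (proj R e y))"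
        unfolding qR[OF \<chi>] qR[OF yh]
        using P0_kr[OF y] proj_eq_iff[OF kr e] eqrel_in[OF kr] by blast
    qed (use \<chi> in simp)
    then show ?thesis using qR[OF \<chi>] by simp
  qed
  have b2: "b2 e (proj kq e s) = proj kr e (fst s)" if q: "s \<in> Q e" for e s
  proof -
    have e: "e \<in> Obj C" using span_elem[OF sD(3) q] .
    show ?thesis
      unfolding b2_def
    proof (rule induced_proj[OF kq e])
      fix y assume y: "(s, y) \<in> kq e"
      have "(s, y) \<in> {(x, y). e \<in> Obj C \<and> x \<in> Fob QF e \<and> y \<in> Fob QF e \<and> (fst x, fst y) \<in> kr e}"
      proof (rule eqrel_generated_least[OF eqrel_vimage[OF QF(1,2) kr] _ y[unfolded kq_def coeq_rel_def]])
        fix e x y assume e: "e \<in> Obj C" and "(x, y) \<in> (\<lambda>l. (fst l, snd l)) ` Fob L e"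
        then have l: "(x, y) \<in> Fob L e" by auto
        then show "(x, y) \<in> {(x, y). e \<in> Obj C \<and> x \<in> Fob QF e \<and> y \<in> Fob QF e \<and> (fst x, fst y) \<in> kr e}"
          using krI[OF l] e by (simp add: LFob QFob)
      qed
      then show "proj kr e (fst s) = proj kr e (fst y)"
        using proj_eq_iff[OF kr e] eqrel_in[OF kr] by blast
    qed (use q QFob in simp)
  qed
  have b3: "b3 e (proj kq e s) = quot_proj P' e (snd s)" if q: "s \<in> Q e" for e s
  proof -
    have e: "e \<in> Obj C" using span_elem[OF sD(3) q] .
    show ?thesis
      unfolding b3_def
    proof (rule induced_proj[OF kq e])
      fix y assume y: "(s, y) \<in> kq e"
      have "(s, y) \<in> ker_rel QF (\<lambda>e s. quot_proj P' e (snd s)) e"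
      proof (rule eqrel_generated_least[OF eqrel_ker_rel[OF QF(1) nat_trans_comp[OF QF(3) nq']] _
            y[unfolded kq_def coeq_rel_def]])
        fix e x y assume e: "e \<in> Obj C" and "(x, y) \<in> (\<lambda>l. (fst l, snd l)) ` Fob L e"
        then have l: "x \<in> Q e" "y \<in> Q e" "(snd x, snd y) \<in> Pt' e" by (auto simp: LFob)
        obtain \<xi> where 1: "\<xi> \<in> hom C c' e" "snd x = proj R' e \<xi>" using span_elem[OF sD(3) l(1)] by (metis snd_conv)
        obtain \<xi>' where 2: "\<xi>' \<in> hom C c' e" "snd y = proj R' e \<xi>'" using span_elem[OF sD(3) l(2)] by (metis snd_conv)
        have "proj P' e \<xi> = proj P' e \<xi>'"
          using l(3) 1 2 Pt'[OF 1(1) 2(1)] yquot_proj_eq[OF P' 1(1) 2(1)] by simp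
        then show "(x, y) \<in> ker_rel QF (\<lambda>e s. quot_proj P' e (snd s)) e"
          using l e 1 2 qR' by (simp add: ker_rel_iff QFob)
      qed
      then show "quot_proj P' e (snd s) = quot_proj P' e (snd y)" by (simp add: ker_rel_iff)
    qed (use q QFob in simp)
  qed

  have q0: "quot_proj P'' e (proj P0 e \<chi>) = proj P'' e \<chi>" if "\<chi> \<in> hom C c e" for e \<chi>
    using quot_proj_proj[OF P0 P''(2) P0P'' that] .
  \<comment> \<open>This is an element of \<open>N\<close> with the shared class in K' replaced by a
    representative \<open>s\<close>: \<chi> and \<open>s\<close> agree in K, while \<open>s\<close>
    and \<open>q\<close> agree in yc'/P'.\<close>
  have Q''_iff: "p \<in> Q'' e \<longleftrightarrow> (\<exists>\<chi> s q. p = (proj P'' e \<chi>, snd q) \<and> \<chi> \<in> hom C c e \<and> s \<in> Q e \<and> q \<in> Q' e \<and>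
      (proj P e \<chi>, fst s) \<in> kr e \<and> quot_proj P' e (snd s) = fst q)" for p e
  proof
    assume "p \<in> Q'' e"
    then obtain X K q where n: "p = (quot_proj P'' e X, snd q)" "X \<in> Fob (yquot C c P0) e"
      "K \<in> Fob (quot C QF kq) e" "b1 e X = b2 e K" "q \<in> Q' e" "b3 e K = fst q"
      by (auto simp: Q''_def N_def M_def W_def pullback_def QFob')
    obtain \<chi> where \<chi>: "\<chi> \<in> hom C c e" "X = proj P0 e \<chi>" using n(2) by (rule yquot_FobE)
    obtain s where s: "s \<in> Q e" "K = proj kq e s" using n(3) by (auto simp: QFob elim: quot_FobE)
    have e: "e \<in> Obj C" using homD[OF \<chi>(1)] by blast
    have "proj P e \<chi> \<in> Fob ycP e" "fst s \<in> Fob ycP e"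
      using yquot_proj_in[OF \<chi>(1)] nt_map[OF QF(2) e] s(1) by (simp_all add: ycP_def QFob)
    then have "(proj P e \<chi>, fst s) \<in> kr e"
      using n(4) b1[OF \<chi>(1)] b2[OF s(1)] \<chi>(2) s(2) proj_eq_iff[OF kr e] by simp
    then show "\<exists>\<chi> s q. p = (proj P'' e \<chi>, snd q) \<and> \<chi> \<in> hom C c e \<and> s \<in> Q e \<and> q \<in> Q' e \<and>
        (proj P e \<chi>, fst s) \<in> kr e \<and> quot_proj P' e (snd s) = fst q"
      using n \<chi> s q0 b3 by metis
  next
    assume "\<exists>\<chi> s q. p = (proj P'' e \<chi>, snd q) \<and> \<chi> \<in> hom C c e \<and> s \<in> Q e \<and> q \<in> Q' e \<and>
        (proj P e \<chi>, fst s) \<in> kr e \<and> quot_proj P' e (snd s) = fst q"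
    then obtain \<chi> s q where n: "p = (proj P'' e \<chi>, snd q)" "\<chi> \<in> hom C c e" "s \<in> Q e" "q \<in> Q' e"
      "(proj P e \<chi>, fst s) \<in> kr e" "quot_proj P' e (snd s) = fst q" by blast
    have e: "e \<in> Obj C" using homD[OF n(2)] by blast
    have "proj kr e (proj P e \<chi>) = proj kr e (fst s)"
      using n(5) proj_eq_iff[OF kr e] eqrel_in[OF kr n(5)] by blast
    then have "((proj P0 e \<chi>, proj kq e s), (proj kq e s, q)) \<in> Fob N e"
      using n b1 b2 b3 yquot_proj_in[OF n(2)] proj_in[of s QF e kq]
      by (simp add: N_def M_def W_def pullback_def QFob' QFob)
    then show "p \<in> Q'' e"
      unfolding Q''_def using n(1) q0[OF n(2)] by (force intro: image_eqI)
  qed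

  \<comment> \<open>The value is carried through \<open>kr\<close> to the first component of
    \<open>s\<close>, across \<open>Q\<close> to its second, through \<open>P'\<close> to the first
    component of \<open>q\<close>, and across \<open>Q'\<close> to \<zeta>.\<close>
  have rep_el: "Fmap T'' \<chi> v = Fmap T'' \<zeta> t''"
    if \<chi>: "\<chi> \<in> hom C c e" and \<zeta>: "\<zeta> \<in> hom C c'' e" and p: "(proj P'' e \<chi>, proj R'' e \<zeta>) \<in> Q'' e" for e \<chi> \<zeta>
  proof -
    obtain \<chi>1 s q where n: "proj P'' e \<chi> = proj P'' e \<chi>1" "proj R'' e \<zeta> = snd q" "\<chi>1 \<in> hom C c e" "s \<in> Q e" "q \<in> Q' e"
      "(proj P e \<chi>1, fst s) \<in> kr e" "quot_proj P' e (snd s) = fst q" using p unfolding Q''_iff by blast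
    obtain \<chi>2 \<xi> where 1: "\<chi>2 \<in> hom C c e" "\<xi> \<in> hom C c' e" "s = (proj P e \<chi>2, proj R' e \<xi>)"
      using span_elem[OF sD(3) n(4)] .
    obtain \<xi>2 \<zeta>2 where 2: "\<xi>2 \<in> hom C c' e" "\<zeta>2 \<in> hom C c'' e" "q = (proj P' e \<xi>2, proj R'' e \<zeta>2)"
      using span_elem[OF sD'(3) n(5)] .
    have "(\<chi>, \<chi>1) \<in> P'' e" using n(1) yquot_proj_eq[OF P''(2) \<chi> n(3)] by simp
    then have "Fmap T'' \<chi> v = Fmap T'' \<chi>1 v" by (simp add: P''_eq ev_ker_iff)
    also have "\<dots> = Fmap T'' \<chi>2 v" using kr_ker[OF n(6)] uP[OF n(3)] uP[OF 1(1)] 1(3) by simp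
    also have "\<dots> = Fmap T'' \<xi> z'" using Qv[OF 1(1,2)] n(4) 1(3) by simp
    also have "\<dots> = Fmap T'' \<xi>2 z'"
      using n(7) qR'[OF 1(2)] 1(3) 2(3) yquot_proj_eq[OF P' 1(2) 2(1)] P'_iff[OF 1(2) 2(1)] by simp
    also have "\<dots> = Fmap T'' \<zeta>2 t''" using rD'(3)[OF 2(1,2)] n(5) 2(3) by simp
    also have "\<dots> = Fmap T'' \<zeta> t''"
      using n(2) 2(3) yquot_proj_eq[OF R'' \<zeta> 2(2)] by (simp add: gD''(6) ev_ker_iff)
    finally show ?thesis .
  qed
  have rep: "represents c'' R'' c T'' t'' (P'', Q'') v"
    unfolding represents_def using v P''_eq rep_el by simp

  \<comment> \<open>Composable pairs of \<open>Q\<close> and \<open>Q'\<close> lie in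
    \<open>Q''\<close> by reflexivity of \<open>kr\<close>; they suffice for local surjectivity of
    both legs.\<close>
  have Q''I: "(proj P'' e \<chi>, proj R'' e \<zeta>) \<in> Q'' e"
    if \<chi>: "\<chi> \<in> hom C c e" "\<xi> \<in> hom C c' e" "(proj P e \<chi>, proj R' e \<xi>) \<in> Q e"
      "(proj P' e \<xi>, proj R'' e \<zeta>) \<in> Q' e" for e \<chi> \<xi> \<zeta>
  proof -
    have e: "e \<in> Obj C" using homD[OF \<chi>(1)] by blast
    have "(proj P e \<chi>, proj P e \<chi>) \<in> kr e"
      using eqrel_refl[OF kr e] yquot_proj_in[OF \<chi>(1)] by (simp add: ycP_def)
    then show ?thesis unfolding Q''_iff using \<chi> qR'[OF \<chi>(2)] by (metis fst_conv snd_conv)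
  qed

  have sub: "subfunctor C (prod_fun (yquot C c P'') (yquot C c'' R'')) Q''"
    unfolding subfunctor_def
  proof (intro conjI ballI allI impI subsetI)
    fix e p assume "p \<in> Q'' e"
    then obtain \<chi> s q where n: "p = (proj P'' e \<chi>, snd q)" "\<chi> \<in> hom C c e" "q \<in> Q' e"
      unfolding Q''_iff by blast
    obtain \<zeta> where "\<zeta> \<in> hom C c'' e" "snd q = proj R'' e \<zeta>"
      using span_elem[OF sD'(3) n(3)] by (metis snd_conv)
    then show "p \<in> Fob (prod_fun (yquot C c P'') (yquot C c'' R'')) e"
      using n yquot_proj_in[OF n(2)] yquot_proj_in by (simp add: prod_fun_def)
  next
    fix e assume "e \<notin> Obj C"
    then show "Q'' e = {}" using Q''_iff homD by blast
  next
    fix f p assume f: "f \<in> Arr C" and p: "p \<in> Q'' (Dom C f)"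
    define a where "a = Dom C f"
    define b where "b = Cod C f"
    have fh: "f \<in> hom C a b" using arr_hom[OF f] by (simp add: a_def b_def)
    obtain \<chi> s q where n: "p = (proj P'' a \<chi>, snd q)" "\<chi> \<in> hom C c a" "s \<in> Q a" "q \<in> Q' a"
      "(proj P a \<chi>, fst s) \<in> kr a" "quot_proj P' a (snd s) = fst q" using p unfolding Q''_iff a_def by blast
    obtain \<chi>2 \<xi> where 1: "\<chi>2 \<in> hom C c a" "\<xi> \<in> hom C c' a" "s = (proj P a \<chi>2, proj R' a \<xi>)"
      using span_elem[OF sD(3) n(3)] .
    obtain \<xi>2 \<zeta> where 2: "\<xi>2 \<in> hom C c' a" "\<zeta> \<in> hom C c'' a" "q = (proj P' a \<xi>2, proj R'' a \<zeta>)"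
      using span_elem[OF sD'(3) n(4)] .
    have s2: "(proj P b (f \<cdot> \<chi>2), proj R' b (f \<cdot> \<xi>)) \<in> Q b"
      using span_stable[OF sD(3) P R' fh 1(1,2)] n(3) 1(3) by simp
    have q2: "(proj P' b (f \<cdot> \<xi>2), proj R'' b (f \<cdot> \<zeta>)) \<in> Q' b"
      using span_stable[OF sD'(3) P' R'' fh 2(1,2)] n(4) 2(3) by simp
    have k2: "(proj P b (f \<cdot> \<chi>), proj P b (f \<cdot> \<chi>2)) \<in> kr b"
      using eqrel_map[OF kr fh n(5)] yquot_Fmap[OF P fh n(2)] yquot_Fmap[OF P fh 1(1)] 1(3)
      by (simp add: ycP_def)
    have "(\<xi>, \<xi>2) \<in> P' a" using n(6) 1 2 qR'[OF 1(2)] yquot_proj_eq[OF P' 1(2) 2(1)] by simp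
    then have "proj P' b (f \<cdot> \<xi>) = proj P' b (f \<cdot> \<xi>2)"
      using eqrel_map[OF P' fh, of \<xi> \<xi>2] yquot_proj_eq[OF P' comp_hom[OF 1(2) fh] comp_hom[OF 2(1) fh]] by simp
    then have "(proj P'' b (f \<cdot> \<chi>), proj R'' b (f \<cdot> \<zeta>)) \<in> Q'' b"
      unfolding Q''_iff using s2 q2 k2 comp_hom[OF n(2) fh] qR'[OF comp_hom[OF 1(2) fh]]
      by (metis fst_conv snd_conv)
    then show "Fmap (prod_fun (yquot C c P'') (yquot C c'' R'')) f p \<in> Q'' (Cod C f)"
      using n(1) 2(3) yquot_Fmap[OF P''(2) fh n(2)] yquot_Fmap[OF R'' fh 2(2)]
      by (simp add: prod_fun_def b_def)
  qed

  have left: "\<exists>d. \<exists>h \<in> hom C e d. \<exists>\<zeta> \<in> hom C c'' d. (proj P'' d (h \<cdot> \<chi>), proj R'' d \<zeta>) \<in> Q'' d"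
    if \<chi>: "\<chi> \<in> hom C c e" for e \<chi>
  proof -
    obtain d h \<xi> where h: "h \<in> hom C e d" "\<xi> \<in> hom C c' d" "(proj P d (h \<cdot> \<chi>), proj R' d \<xi>) \<in> Q d"
      using is_span_left[OF s \<chi>] .
    obtain b k \<zeta> where k: "k \<in> hom C d b" "\<zeta> \<in> hom C c'' b" "(proj P' b (k \<cdot> \<xi>), proj R'' b \<zeta>) \<in> Q' b"
      using is_span_left[OF s' h(2)] .
    have "(proj P'' b (k \<cdot> (h \<cdot> \<chi>)), proj R'' b \<zeta>) \<in> Q'' b"
      using Q''I[OF comp_hom[OF comp_hom[OF \<chi> h(1)] k(1)] comp_hom[OF h(2) k(1)]
          span_stable[OF sD(3) P R' k(1) comp_hom[OF \<chi> h(1)] h(2,3)] k(3)] .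
    then show ?thesis using comp_assoc[OF \<chi> h(1) k(1)] comp_hom[OF h(1) k(1)] k(2) by metis
  qed
  have right: "\<exists>d. \<exists>h \<in> hom C e d. \<exists>\<chi> \<in> hom C c d. (proj P'' d \<chi>, proj R'' d (h \<cdot> \<zeta>)) \<in> Q'' d"
    if \<zeta>: "\<zeta> \<in> hom C c'' e" for e \<zeta>
  proof -
    obtain d h \<xi> where h: "h \<in> hom C e d" "\<xi> \<in> hom C c' d" "(proj P' d \<xi>, proj R'' d (h \<cdot> \<zeta>)) \<in> Q' d"
      using is_span_right[OF s' \<zeta>] .
    obtain b k \<chi> where k: "k \<in> hom C d b" "\<chi> \<in> hom C c b" "(proj P b \<chi>, proj R' b (k \<cdot> \<xi>)) \<in> Q b"
      using is_span_right[OF s h(2)] .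
    have "(proj P'' b \<chi>, proj R'' b (k \<cdot> (h \<cdot> \<zeta>))) \<in> Q'' b"
      using Q''I[OF k(2) comp_hom[OF h(2) k(1)] k(3)
          span_stable[OF sD'(3) P' R'' k(1) h(2) comp_hom[OF \<zeta> h(1)] h(3)]] .
    then show ?thesis using comp_assoc[OF \<zeta> h(1) k(1)] comp_hom[OF h(1) k(1)] k(2) by metis
  qed
  have "is_span c'' R'' c R P'' Q''"
    by (rule is_spanI[OF P''(1) RP'' sub represents_inj[OF g'' rep sub] left right])
  then show ?thesis using rep by (simp add: comp v_def)
qed

end

section \<open>Atoms of the category of sheaves\<close>

lemma category_dual:
  assumes "category C"
  shows "category (dual C)"
proof -
  interpret category C by fact
  have h: "hom (dual C) a b = hom C b a" for a b by (auto simp: hom_def dual_def)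
  show ?thesis
    by unfold_locales (auto simp: h dom_obj cod_obj id_hom comp_hom comp_id_left comp_id_right comp_assoc,
        auto simp: dual_def dom_obj cod_obj id_hom comp_hom comp_id_left comp_id_right comp_assoc)
qed

lemma full_subcat_simps [simp]:
  "Obj (full_subcat C X) = Obj C \<inter> X" "Id (full_subcat C X) = Id C" "Comp (full_subcat C X) = Comp C"
  "Dom (full_subcat C X) = Dom C" "Cod (full_subcat C X) = Cod C"
  "Arr (full_subcat C X) = {f \<in> Arr C. Dom C f \<in> X \<and> Cod C f \<in> X}"
  by (simp_all add: full_subcat_def)

lemma full_subcat_hom: "hom (full_subcat C X) a b = (if a \<in> X \<and> b \<in> X then hom C a b else {})"
  by (auto simp: hom_def)

lemma category_full_subcat:
  assumes "category C"
  shows "category (full_subcat C X)"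
proof -
  interpret category C by fact
  show ?thesis
    by unfold_locales (auto simp: full_subcat_hom dom_obj cod_obj id_hom comp_hom comp_id_left
        comp_id_right comp_assoc split: if_splits)
qed

text \<open>Unit and associativity laws are reflected by a faithful assignment that respects
  identities and composition. For \<open>C_e\<close> this replaces a comparison of iterated
  composites of spans.\<close>

lemma category_if_faithful:
  assumes B: "category B"
    and obj: "\<And>f. f \<in> Arr A \<Longrightarrow> Dom A f \<in> Obj A \<and> Cod A f \<in> Obj A"
    and id: "\<And>a. a \<in> Obj A \<Longrightarrow> Id A a \<in> hom A a a"
    and comp: "\<And>f g a b c. f \<in> hom A a b \<Longrightarrow> g \<in> hom A b c \<Longrightarrow> g \<cdot>\<^bsub>A\<^esub> f \<in> hom A a c"
    and Fhom: "\<And>f a b. f \<in> hom A a b \<Longrightarrow> Fa f \<in> hom B (Fo a) (Fo b)"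
    and Fid: "\<And>a. a \<in> Obj A \<Longrightarrow> Fa (Id A a) = Id B (Fo a)"
    and Fcomp: "\<And>f g a b c. f \<in> hom A a b \<Longrightarrow> g \<in> hom A b c \<Longrightarrow> Fa (g \<cdot>\<^bsub>A\<^esub> f) = Fa g \<cdot>\<^bsub>B\<^esub> Fa f"
    and inj: "\<And>a b. inj_on Fa (hom A a b)"
  shows "category A"
proof -
  interpret B: category B by fact
  have ob: "a \<in> Obj A \<and> b \<in> Obj A" if "f \<in> hom A a b" for f a b
    using that obj by (auto simp: hom_def)
  show ?thesis
  proof
    fix f a b assume f: "f \<in> hom A a b"
    note a = ob[OF f, THEN conjunct1] and b = ob[OF f, THEN conjunct2]
    show "f \<cdot>\<^bsub>A\<^esub> Id A a = f"
      by (rule inj_onD[OF inj _ comp[OF id[OF a] f] f])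
        (simp add: Fcomp[OF id[OF a] f] Fid[OF a] B.comp_id_right[OF Fhom[OF f]])
    show "Id A b \<cdot>\<^bsub>A\<^esub> f = f"
      by (rule inj_onD[OF inj _ comp[OF f id[OF b]] f])
        (simp add: Fcomp[OF f id[OF b]] Fid[OF b] B.comp_id_left[OF Fhom[OF f]])
  next
    fix f g h a b c d assume f: "f \<in> hom A a b" and g: "g \<in> hom A b c" and h: "h \<in> hom A c d"
    show "(h \<cdot>\<^bsub>A\<^esub> g) \<cdot>\<^bsub>A\<^esub> f = h \<cdot>\<^bsub>A\<^esub> (g \<cdot>\<^bsub>A\<^esub> f)"
      by (rule inj_onD[OF inj _ comp[OF f comp[OF g h]] comp[OF comp[OF f g] h]])
        (simp add: Fcomp[OF f comp[OF g h]] Fcomp[OF comp[OF f g] h] Fcomp[OF g h] Fcomp[OF f g]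
          B.comp_assoc[OF Fhom[OF f] Fhom[OF g] Fhom[OF h]])
  qed (use obj id comp in auto)
qed

context amalg_category
begin

section \<open>The category of sheaves over the universe\<close>

definition sh_obj :: "('a, 'b, 'u) setfun \<Rightarrow> bool" where
  "sh_obj F \<longleftrightarrow> at_sheaf F \<and> extensional_setfun C F"

definition sh_map :: "('a, 'b, 'u) setfun \<Rightarrow> ('a, 'b, 'u) setfun \<Rightarrow> ('a \<Rightarrow> 'u \<Rightarrow> 'u) \<Rightarrow> bool" where
  "sh_map F G \<eta> \<longleftrightarrow> sh_obj F \<and> sh_obj G \<and> nat_trans C F G \<eta> \<and> normalise C F \<eta> = \<eta>"

lemma sh_mapD:
  assumes "sh_map F G \<eta>"
  shows "sh_obj F" "sh_obj G" "nat_trans C F G \<eta>" "at_sheaf F" "at_sheaf G" "set_functor C F"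
    "set_functor C G" "separated F" "separated G"
  using assms at_sheafD by (auto simp: sh_map_def sh_obj_def)

lemma sh_obj_Fob: "sh_obj F \<Longrightarrow> x \<in> Fob F e \<Longrightarrow> e \<in> Obj C"
  by (auto simp: sh_obj_def extensional_setfun_def)

lemma normalise_apply: "e \<in> Obj C \<Longrightarrow> x \<in> Fob F e \<Longrightarrow> normalise C F \<eta> e x = \<eta> e x"
  by (simp add: normalise_def)

lemma sh_map_normalise:
  assumes F: "sh_obj F" "sh_obj G" and n: "nat_trans C F G \<eta>"
  shows "sh_map F G (normalise C F \<eta>)"
proof -
  have sf: "set_functor C F" using F(1) at_sheafD(1)[of F] by (simp add: sh_obj_def)
  have "nat_trans C F G (normalise C F \<eta>)"
  proof (rule nat_transI)
    fix f a b x assume f: "f \<in> hom C a b" and x: "x \<in> Fob F a"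
    then show "normalise C F \<eta> b (Fmap F f x) = Fmap G f (normalise C F \<eta> a x)"
      using homD[OF f] nt_nat[OF n f x] by (simp add: normalise_apply sf_map[OF sf f x])
  qed (simp add: normalise_apply nt_map[OF n])
  moreover have "normalise C F (normalise C F \<eta>) = normalise C F \<eta>"
    by (auto simp: normalise_def fun_eq_iff)
  ultimately show ?thesis using F by (simp add: sh_map_def)
qed

lemma sh_map_eqI:
  assumes "sh_map F G \<eta>" "sh_map F G' \<theta>" "\<And>e x. e \<in> Obj C \<Longrightarrow> x \<in> Fob F e \<Longrightarrow> \<eta> e x = \<theta> e x"
  shows "\<eta> = \<theta>"
proof -
  have "normalise C F \<eta> = normalise C F \<theta>" using assms(3) by (auto simp: normalise_def fun_eq_iff)
  then show ?thesis using assms(1,2) by (simp add: sh_map_def)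
qed

lemma sh_map_comp:
  assumes "sh_map F G \<eta>" "sh_map G H \<theta>"
  shows "sh_map F H (normalise C F (\<lambda>e x. \<theta> e (\<eta> e x)))"
  using sh_map_normalise sh_mapD[OF assms(1)] sh_mapD[OF assms(2)] nat_trans_comp by blast

lemma sh_map_id: "sh_obj F \<Longrightarrow> sh_map F F (normalise C F (\<lambda>e x. x))"
  by (intro sh_map_normalise nat_trans_id)

lemma Sh_at_simps [simp]:
  "F \<in> Obj (Sh_at C) \<longleftrightarrow> sh_obj F"
  "Id (Sh_at C) F = (F, normalise C F (\<lambda>e x. x), F)"
  "(G', \<theta>, H) \<cdot>\<^bsub>Sh_at C\<^esub> (F, \<eta>, G) = (F, normalise C F (\<lambda>e x. \<theta> e (\<eta> e x)), H)"
  "Dom (Sh_at C) (F, \<eta>, G) = F" "Cod (Sh_at C) (F, \<eta>, G) = G"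
  by (simp_all add: Sh_at_def sh_obj_def sheaf_iff)

lemma Sh_at_Arr: "(F, \<eta>, G) \<in> Arr (Sh_at C) \<longleftrightarrow> sh_map F G \<eta>"
  by (auto simp: Sh_at_def sh_obj_def sheaf_iff sh_map_def)

lemma Sh_at_hom: "f \<in> hom (Sh_at C) F G \<longleftrightarrow> (\<exists>\<eta>. f = (F, \<eta>, G) \<and> sh_map F G \<eta>)"
  by (cases f) (auto simp: hom_def Sh_at_Arr)

lemma category_Sh_at: "category (Sh_at C :: (('a, 'b, 'u) setfun, ('a, 'b, 'u) ntrans) cat)"
proof
  fix f :: "('a, 'b, 'u) ntrans" assume "f \<in> Arr (Sh_at C)"
  then show "Dom (Sh_at C) f \<in> Obj (Sh_at C)" "Cod (Sh_at C) f \<in> Obj (Sh_at C)"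
    by (cases f, simp add: Sh_at_Arr sh_map_def)+
next
  fix a :: "('a, 'b, 'u) setfun" assume "a \<in> Obj (Sh_at C)"
  then show "Id (Sh_at C) a \<in> hom (Sh_at C) a a" by (simp add: Sh_at_hom sh_map_id)
next
  fix f g :: "('a, 'b, 'u) ntrans" and a b c
  assume "f \<in> hom (Sh_at C) a b" "g \<in> hom (Sh_at C) b c"
  then show "g \<cdot>\<^bsub>Sh_at C\<^esub> f \<in> hom (Sh_at C) a c"
    by (auto simp: Sh_at_hom intro: sh_map_comp)
next
  fix f :: "('a, 'b, 'u) ntrans" and a b
  assume "f \<in> hom (Sh_at C) a b"
  then obtain \<eta> where f: "f = (a, \<eta>, b)" "sh_map a b \<eta>" by (auto simp: Sh_at_hom)
  note fD = sh_mapD[OF f(2)]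
  have "normalise C a (\<lambda>e x. \<eta> e (normalise C a (\<lambda>e x. x) e x)) = \<eta>"
    by (rule sh_map_eqI[OF sh_map_comp[OF sh_map_id[OF fD(1)] f(2)] f(2)]) (simp add: normalise_apply)
  then show "f \<cdot>\<^bsub>Sh_at C\<^esub> Id (Sh_at C) a = f" using f by simp
  have "normalise C a (\<lambda>e x. normalise C b (\<lambda>e x. x) e (\<eta> e x)) = \<eta>"
    by (rule sh_map_eqI[OF sh_map_comp[OF f(2) sh_map_id[OF fD(2)]] f(2)])
      (simp add: normalise_apply nt_map[OF fD(3)])
  then show "Id (Sh_at C) b \<cdot>\<^bsub>Sh_at C\<^esub> f = f" using f by simp
next
  fix f g h :: "('a, 'b, 'u) ntrans" and a b c d
  assume "f \<in> hom (Sh_at C) a b" "g \<in> hom (Sh_at C) b c" "h \<in> hom (Sh_at C) c d"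
  then obtain \<eta> \<theta> \<zeta> where f: "f = (a, \<eta>, b)" "sh_map a b \<eta>" "g = (b, \<theta>, c)" "sh_map b c \<theta>"
    "h = (c, \<zeta>, d)" "sh_map c d \<zeta>" by (auto simp: Sh_at_hom)
  have "normalise C a (\<lambda>e x. normalise C b (\<lambda>e x. \<zeta> e (\<theta> e x)) e (\<eta> e x)) =
      normalise C a (\<lambda>e x. \<zeta> e (normalise C a (\<lambda>e x. \<theta> e (\<eta> e x)) e x))"
    by (rule sh_map_eqI[OF sh_map_comp[OF f(2) sh_map_comp[OF f(4,6)]]
          sh_map_comp[OF sh_map_comp[OF f(2,4)] f(6)]])
      (simp add: normalise_apply nt_map[OF sh_mapD(3)[OF f(2)]])
  then show "(h \<cdot>\<^bsub>Sh_at C\<^esub> g) \<cdot>\<^bsub>Sh_at C\<^esub> f = h \<cdot>\<^bsub>Sh_at C\<^esub> (g \<cdot>\<^bsub>Sh_at C\<^esub> f)" using f by simp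
qed

text \<open>The empty functor is a sheaf, since no covering sieve is empty, and a map into it can
  only start from an empty functor.\<close>

lemma is_initial_Sh_at:
  fixes Z :: "('a, 'b, 'u) setfun"
  shows "is_initial (Sh_at C) Z \<longleftrightarrow> sh_obj Z \<and> (\<forall>e. Fob Z e = {})"
proof
  define E :: "('a, 'b, 'u) setfun" where "E = \<lparr>Fob = (\<lambda>e. {}), Fmap = (\<lambda>f x. undefined)\<rparr>"
  have E: "sh_obj E"
    by (auto simp: sh_obj_def at_sheaf_def separated_def set_functor_def extensional_setfun_def E_def)
  assume i: "is_initial (Sh_at C) Z"
  then obtain f where "f \<in> hom (Sh_at C) Z E" using E unfolding is_initial_def by fastforce
  then obtain \<eta> where \<eta>: "sh_map Z E \<eta>" by (auto simp: Sh_at_hom)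
  have "x \<notin> Fob Z e" for e x
    using nt_map[OF sh_mapD(3)[OF \<eta>], of e x] sh_obj_Fob[OF sh_mapD(1)[OF \<eta>]] by (auto simp: E_def)
  then show "sh_obj Z \<and> (\<forall>e. Fob Z e = {})" using sh_mapD(1)[OF \<eta>] by auto
next
  assume Z: "sh_obj Z \<and> (\<forall>e. Fob Z e = {})"
  have "\<exists>!f. f \<in> hom (Sh_at C) Z a" if a: "sh_obj a" for a :: "('a, 'b, 'u) setfun"
  proof (rule ex1I)
    have "nat_trans C Z a (\<lambda>e x. x)" by (rule nat_transI) (use Z in auto)
    then have m: "sh_map Z a (normalise C Z (\<lambda>e x. x))" using sh_map_normalise Z a by blast
    then show "(Z, normalise C Z (\<lambda>e x. x), a) \<in> hom (Sh_at C) Z a" by (simp add: Sh_at_hom)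
    fix f assume "f \<in> hom (Sh_at C) Z a"
    then obtain \<eta> where "f = (Z, \<eta>, a)" "sh_map Z a \<eta>" by (auto simp: Sh_at_hom)
    then show "f = (Z, normalise C Z (\<lambda>e x. x), a)"
      using sh_map_eqI[OF _ m] Z by auto
  qed
  then show "is_initial (Sh_at C) Z" using Z by (simp add: is_initial_def)
qed

lemma is_mono_if_inj:
  assumes m: "sh_map G F \<phi>"
    and inj: "\<And>e x y. e \<in> Obj C \<Longrightarrow> x \<in> Fob G e \<Longrightarrow> y \<in> Fob G e \<Longrightarrow> \<phi> e x = \<phi> e y \<Longrightarrow> x = y"
  shows "is_mono (Sh_at C) (G, \<phi>, F)"
  unfolding is_mono_def
proof (intro conjI allI ballI impI)
  fix a g h assume "g \<in> hom (Sh_at C) a (Dom (Sh_at C) (G, \<phi>, F))"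
    "h \<in> hom (Sh_at C) a (Dom (Sh_at C) (G, \<phi>, F))"
    and eq: "(G, \<phi>, F) \<cdot>\<^bsub>Sh_at C\<^esub> g = (G, \<phi>, F) \<cdot>\<^bsub>Sh_at C\<^esub> h"
  then obtain \<eta> \<theta> where g: "g = (a, \<eta>, G)" "sh_map a G \<eta>" "h = (a, \<theta>, G)" "sh_map a G \<theta>"
    by (auto simp: Sh_at_hom)
  have "\<eta> = \<theta>"
  proof (rule sh_map_eqI[OF g(2,4)])
    fix e x assume x: "e \<in> Obj C" "x \<in> Fob a e"
    have "normalise C a (\<lambda>e x. \<phi> e (\<eta> e x)) e x = normalise C a (\<lambda>e x. \<phi> e (\<theta> e x)) e x"
      using eq g by simp
    then show "\<eta> e x = \<theta> e x"
      using x inj[OF x(1) nt_map[OF sh_mapD(3)[OF g(2)] x] nt_map[OF sh_mapD(3)[OF g(4)] x]]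
      by (simp add: normalise_apply)
  qed
  then show "g = h" using g by simp
qed (use m in \<open>simp add: Sh_at_Arr\<close>)

lemma generates_map_sh:
  assumes g: "generates c R T t" and T: "sh_obj T" and G: "sh_obj G" and z: "z \<in> Fob G c"
    and R: "\<And>e \<chi> \<xi>. (\<chi>, \<xi>) \<in> R e \<Longrightarrow> Fmap G \<chi> z = Fmap G \<xi> z"
  obtains \<phi> where "sh_map T G \<phi>" "\<phi> c t = z"
proof -
  have Gs: "at_sheaf G" using G by (simp add: sh_obj_def)
  show ?thesis
  proof (rule generates_map[OF g Gs z R])
    fix \<phi> assume \<phi>: "nat_trans C T G \<phi>" "\<phi> c t = z"
    show ?thesis
      by (rule that[OF sh_map_normalise[OF T G \<phi>(1)]])
        (simp add: normalise_apply generatesD(4,5)[OF g] \<phi>(2))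
  qed
qed

lemma generates_sh_eq:
  assumes g: "generates c R T t" and m: "sh_map T G \<phi>" "sh_map T G \<psi>" and eq: "\<phi> c t = \<psi> c t"
  shows "\<phi> = \<psi>"
  using sh_map_eqI[OF m] generates_map_unique[OF g sh_mapD(9)[OF m(1)] sh_mapD(3)[OF m(1)] sh_mapD(3)[OF m(2)] eq]
  by blast

text \<open>The monomorphism is tested on two maps from one sheaf with a generator over
  \<open>e\<close>, sending the generator to \<open>x\<close> and to \<open>y\<close>. The relations
  imposed are those satisfied by \<open>x\<close> and \<open>y\<close> simultaneously: they permit
  both maps and, being the kernel of a map into a separated functor, are closed.\<close>

lemma inj_if_is_mono:
  fixes \<iota> :: "'b \<Rightarrow> 'u" and G :: "('a, 'b, 'u) setfun"
  assumes \<iota>: "inj_on \<iota> (Arr C)" "infinite (UNIV :: 'u set)"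
    and m: "is_mono (Sh_at C) (G, \<phi>, F)" and x: "x \<in> Fob G e" "y \<in> Fob G e" and eq: "\<phi> e x = \<phi> e y"
  shows "x = y"
proof -
  have \<phi>: "sh_map G F \<phi>" using m by (simp add: is_mono_def Sh_at_Arr)
  note \<phi>D = sh_mapD[OF \<phi>]
  have e: "e \<in> Obj C" using sh_obj_Fob[OF \<phi>D(1) x(1)] .
  define R where "R = ker_rel (yoneda C e) (\<lambda>d \<chi>. (Fmap G \<chi> x, Fmap G \<chi> y))"
  have "closed_eqrel C (yoneda C e) R"
    unfolding R_def
  proof (rule closed_ker_rel[OF set_functor_yoneda])
    show "nat_trans C (yoneda C e) (prod_fun G G) (\<lambda>d \<chi>. (Fmap G \<chi> x, Fmap G \<chi> y))"
      by (rule nat_transI) (auto simp: prod_fun_def sf_map[OF \<phi>D(6)] x sf_comp[OF \<phi>D(6)])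
    show "separated (prod_fun G G)"
      unfolding separated_def using separatedD[OF \<phi>D(8)] by (auto simp: prod_fun_def)
  qed
  then have "(e, R) \<in> ce_objects C" using e by (simp add: ce_objects_def)
  then obtain T :: "('a, 'b, 'u) setfun" and t where g: "generates e R T t" and "extensional_setfun C T"
    using exists_generates[OF _ \<iota>] by blast
  then have T: "sh_obj T" using generatesD(1) by (simp add: sh_obj_def)
  have R: "Fmap G \<chi> x = Fmap G \<xi> x" "Fmap G \<chi> y = Fmap G \<xi> y" if "(\<chi>, \<xi>) \<in> R d" for d \<chi> \<xi>
    using that by (auto simp: R_def ker_rel_iff)
  obtain \<eta> where \<eta>: "sh_map T G \<eta>" "\<eta> e t = x" using generates_map_sh[OF g T \<phi>D(1) x(1) R(1)] .
  obtain \<theta> where \<theta>: "sh_map T G \<theta>" "\<theta> e t = y" using generates_map_sh[OF g T \<phi>D(1) x(2) R(2)] .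
  have t: "t \<in> Fob T e" using generatesD[OF g] by simp
  have "normalise C T (\<lambda>e x. \<phi> e (\<eta> e x)) = normalise C T (\<lambda>e x. \<phi> e (\<theta> e x))"
    by (rule generates_sh_eq[OF g sh_map_comp[OF \<eta>(1) \<phi>] sh_map_comp[OF \<theta>(1) \<phi>]])
      (simp add: normalise_apply e t \<eta> \<theta> eq)
  then have "(G, \<phi>, F) \<cdot>\<^bsub>Sh_at C\<^esub> (T, \<eta>, G) = (G, \<phi>, F) \<cdot>\<^bsub>Sh_at C\<^esub> (T, \<theta>, G)" by simp
  moreover have "(T, \<eta>, G) \<in> hom (Sh_at C) T G" "(T, \<theta>, G) \<in> hom (Sh_at C) T G"
    using \<eta>(1) \<theta>(1) by (simp_all add: Sh_at_hom)
  ultimately have "(T, \<eta>, G) = (T, \<theta>, G)"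
    using m[unfolded is_mono_def Sh_at_simps(4), THEN conjunct2, rule_format] by blast
  then show "x = y" using \<eta> \<theta> by simp
qed

text \<open>A monomorphism into \<open>T\<close> is injective on elements, so compatibility
  conditions and relations that hold in \<open>T\<close> hold in \<open>G\<close>. This lifts
  \<open>t\<close> to an element \<open>z\<close> of \<open>G\<close>, and the map from
  \<open>T\<close> to \<open>G\<close> sending \<open>t\<close> to \<open>z\<close> is the
  inverse.\<close>

lemma generates_is_atom:
  fixes \<iota> :: "'b \<Rightarrow> 'u" and T :: "('a, 'b, 'u) setfun"
  assumes \<iota>: "inj_on \<iota> (Arr C)" "infinite (UNIV :: 'u set)"
    and g: "generates c R T t" and T: "sh_obj T"
  shows "is_atom (Sh_at C) T"
  unfolding is_atom_def
proof (intro conjI allI impI)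
  note gD = generatesD[OF g]
  show "T \<in> Obj (Sh_at C)" using T by simp
  show "\<not> is_initial (Sh_at C) T" using gD(5) by (auto simp: is_initial_Sh_at)
  fix f assume f: "is_mono (Sh_at C) f \<and> Cod (Sh_at C) f = T"
  then obtain G \<phi> where f': "f = (G, \<phi>, T)" by (cases f) auto
  have m: "is_mono (Sh_at C) (G, \<phi>, T)" using f f' by simp
  have \<phi>: "sh_map G T \<phi>" using m by (simp add: is_mono_def Sh_at_Arr)
  note \<phi>D = sh_mapD[OF \<phi>] and inj = inj_if_is_mono[OF \<iota> m]
  have "is_iso (Sh_at C) (G, \<phi>, T)" if ne: "\<not> (\<forall>e. Fob G e = {})"
  proof -
    obtain e x where x: "x \<in> Fob G e" using ne by blast
    have e: "e \<in> Obj C" using sh_obj_Fob[OF \<phi>D(1) x] .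
    obtain d h \<chi> where h: "h \<in> hom C e d" "\<chi> \<in> hom C c d" "Fmap T \<chi> t = Fmap T h (\<phi> e x)"
      using generates_loc[OF g e nt_map[OF \<phi>D(3) e x]] .
    define y where "y = Fmap G h x"
    have y: "y \<in> Fob G d" "\<phi> d y = Fmap T \<chi> t"
      unfolding y_def using sf_map[OF \<phi>D(6) h(1) x] nt_nat[OF \<phi>D(3) h(1) x] h(3) by simp_all
    \<comment> \<open>Compatibility of \<open>y\<close> along \<chi> is checked in \<open>T\<close>,
      where the image of \<open>y\<close> is the translate of \<open>t\<close> along \<chi>.\<close>
    have "Fmap G k y = Fmap G k' y" if k: "k \<in> hom C d b" "k' \<in> hom C d b" "k \<cdot> \<chi> = k' \<cdot> \<chi>" for b k k'
      using inj[OF sf_map[OF \<phi>D(6) k(1) y(1)] sf_map[OF \<phi>D(6) k(2) y(1)]]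
        nt_nat[OF \<phi>D(3) k(1) y(1)] nt_nat[OF \<phi>D(3) k(2) y(1)] y(2) sf_comp[OF gD(2) h(2) k(1) gD(5)]
        sf_comp[OF gD(2) h(2) k(2) gD(5)] k(3) by simp
    then obtain z where z: "z \<in> Fob G c" "Fmap G \<chi> z = y"
      using at_sheaf_glue[OF \<phi>D(4) h(2) y(1)] by blast
    have "Fmap T \<chi> (\<phi> c z) = Fmap T \<chi> t" using nt_nat[OF \<phi>D(3) h(2) z(1)] z(2) y(2) by simp
    then have zt: "\<phi> c z = t"
      using separatedD[OF gD(3) h(2) nt_map[OF \<phi>D(3) gD(4) z(1)] gD(5)] by blast
    have "Fmap G \<xi> z = Fmap G \<xi>' z" if r: "(\<xi>, \<xi>') \<in> R b" for b \<xi> \<xi>'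
    proof -
      have x: "\<xi> \<in> hom C c b" "\<xi>' \<in> hom C c b" "Fmap T \<xi> t = Fmap T \<xi>' t"
        using r by (simp_all add: gD(6) ev_ker_iff)
      then show ?thesis
        using inj[OF sf_map[OF \<phi>D(6) x(1) z(1)] sf_map[OF \<phi>D(6) x(2) z(1)]]
          nt_nat[OF \<phi>D(3) x(1) z(1)] nt_nat[OF \<phi>D(3) x(2) z(1)] zt by simp
    qed
    then obtain \<theta> where \<theta>: "sh_map T G \<theta>" "\<theta> c t = z"
      using generates_map_sh[OF g T \<phi>D(1) z(1)] by blast
    have 1: "normalise C T (\<lambda>e x. \<phi> e (\<theta> e x)) = normalise C T (\<lambda>e x. x)"
      by (rule generates_sh_eq[OF g sh_map_comp[OF \<theta>(1) \<phi>] sh_map_id[OF T]])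
        (simp add: normalise_apply gD(4,5) \<theta>(2) zt)
    have 2: "normalise C G (\<lambda>e x. \<theta> e (\<phi> e x)) = normalise C G (\<lambda>e x. x)"
    proof (rule sh_map_eqI[OF sh_map_comp[OF \<phi> \<theta>(1)] sh_map_id[OF \<phi>D(1)]])
      fix e x assume x: "e \<in> Obj C" "x \<in> Fob G e"
      note p = nt_map[OF \<phi>D(3) x]
      have "\<phi> e (\<theta> e (\<phi> e x)) = \<phi> e x"
        using fun_cong[OF fun_cong[OF 1, of e], of "\<phi> e x"] x p by (simp add: normalise_apply)
      then have "\<theta> e (\<phi> e x) = x" using inj[OF nt_map[OF sh_mapD(3)[OF \<theta>(1)] x(1) p] x(2)] by blast
      then show "normalise C G (\<lambda>e x. \<theta> e (\<phi> e x)) e x = normalise C G (\<lambda>e x. x) e x"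
        using x by (simp add: normalise_apply)
    qed
    have "(T, \<theta>, G) \<in> hom (Sh_at C) T G" using \<theta>(1) by (simp add: Sh_at_hom)
    moreover have "(T, \<theta>, G) \<cdot>\<^bsub>Sh_at C\<^esub> (G, \<phi>, T) = Id (Sh_at C) G" using 2 by simp
    moreover have "(G, \<phi>, T) \<cdot>\<^bsub>Sh_at C\<^esub> (T, \<theta>, G) = Id (Sh_at C) T" using 1 by simp
    ultimately show ?thesis using \<phi> unfolding is_iso_def Sh_at_simps(4,5) Sh_at_Arr by blast
  qed
  then show "is_iso (Sh_at C) f \<or> is_initial (Sh_at C) (Dom (Sh_at C) f)"
    using f' \<phi>D(1) by (auto simp: is_initial_Sh_at)
qed

section \<open>The dual of the category of atoms, and presentation of atoms by a generator\<close>

lemma atomic_completion_simps [simp]: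
  "F \<in> Obj (atomic_completion C) \<longleftrightarrow> sh_obj F \<and> is_atom (Sh_at C) F"
  "Id (atomic_completion C) F = Id (Sh_at C) F"
  "g \<cdot>\<^bsub>atomic_completion C\<^esub> f = f \<cdot>\<^bsub>Sh_at C\<^esub> g"
  "Dom (atomic_completion C) = Cod (Sh_at C)" "Cod (atomic_completion C) = Dom (Sh_at C)"
  by (simp_all add: atomic_completion_def dual_def)

lemma atomic_completion_hom:
  "f \<in> hom (atomic_completion C) G F \<longleftrightarrow>
    f \<in> hom (Sh_at C) F G \<and> is_atom (Sh_at C) F \<and> is_atom (Sh_at C) G"
  by (auto simp: hom_def atomic_completion_def dual_def)

lemma category_atomic_completion:
  "category (atomic_completion C :: (('a, 'b, 'u) setfun, ('a, 'b, 'u) ntrans) cat)"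
  unfolding atomic_completion_def by (intro category_dual category_full_subcat category_Sh_at)

text \<open>An atom is covered by the generator sheaf attached to any of its elements; the covering is
  a monomorphism, hence invertible.\<close>

lemma atom_iso_generated:
  fixes F T :: "('a, 'b, 'u) setfun"
  assumes F: "is_atom (Sh_at C) F" and x: "x \<in> Fob F c"
    and g: "generates c (ev_ker c F x) T t" and T: "sh_obj T" "is_atom (Sh_at C) T"
  shows "\<exists>f \<in> hom (atomic_completion C) T F. is_iso (atomic_completion C) f"
proof -
  note gD = generatesD[OF g]
  have Fs: "sh_obj F" using F by (simp add: is_atom_def)
  obtain \<phi> where \<phi>: "sh_map T F \<phi>" "\<phi> c t = x"
    using generates_map_sh[OF g T(1) Fs x] by (metis ev_ker_iff)
  note \<phi>D = sh_mapD[OF \<phi>(1)]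
  have "is_mono (Sh_at C) (T, \<phi>, F)"
  proof (rule is_mono_if_inj[OF \<phi>(1)])
    fix e v w assume e: "e \<in> Obj C" and v: "v \<in> Fob T e" and w: "w \<in> Fob T e" and eq: "\<phi> e v = \<phi> e w"
    \<comment> \<open>Both elements are restricted to a stage where they are translates of
      \<open>t\<close>; there, equality of their images in \<open>F\<close> is a relation satisfied
      by \<open>x\<close>, hence by \<open>t\<close>.\<close>
    obtain d h \<chi> where h: "h \<in> hom C e d" "\<chi> \<in> hom C c d" "Fmap T \<chi> t = Fmap T h v"
      using generates_loc[OF g e v] .
    have d: "d \<in> Obj C" using homD[OF h(1)] by blast
    obtain d' k \<xi> where k: "k \<in> hom C d d'" "\<xi> \<in> hom C c d'" "Fmap T \<xi> t = Fmap T k (Fmap T h w)"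
      using generates_loc[OF g d sf_map[OF gD(2) h(1) w]] .
    note kc = comp_hom[OF h(2) k(1)] and kh = comp_hom[OF h(1) k(1)]
    have 1: "Fmap T (k \<cdot> \<chi>) t = Fmap T (k \<cdot> h) v"
      using sf_comp[OF gD(2) h(2) k(1) gD(5)] sf_comp[OF gD(2) h(1) k(1) v] h(3) by simp
    have 2: "Fmap T \<xi> t = Fmap T (k \<cdot> h) w" using sf_comp[OF gD(2) h(1) k(1) w] k(3) by simp
    have "Fmap F (k \<cdot> \<chi>) x = Fmap F \<xi> x"
      using nt_nat[OF \<phi>D(3) kc gD(5)] nt_nat[OF \<phi>D(3) k(2) gD(5)] nt_nat[OF \<phi>D(3) kh v]
        nt_nat[OF \<phi>D(3) kh w] 1 2 eq \<phi>(2) by simp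
    then have "(k \<cdot> \<chi>, \<xi>) \<in> ev_ker c T t d'" using kc k(2) gD(6) by (metis ev_ker_iff)
    then have "Fmap T (k \<cdot> h) v = Fmap T (k \<cdot> h) w" using 1 2 by (simp add: ev_ker_iff)
    then show "v = w" using separatedD[OF gD(3) kh v w] by blast
  qed
  moreover have "\<not> is_initial (Sh_at C) T" using gD(5) by (auto simp: is_initial_Sh_at)
  \<comment> \<open>Here \<open>F\<close> being an atom enters: this is a monomorphism into
    \<open>F\<close> whose domain is not initial.\<close>
  ultimately have "is_iso (Sh_at C) (T, \<phi>, F)" using F unfolding is_atom_def by auto
  then obtain g where "g \<in> hom (Sh_at C) F T" "g \<cdot>\<^bsub>Sh_at C\<^esub> (T, \<phi>, F) = Id (Sh_at C) T"
    "(T, \<phi>, F) \<cdot>\<^bsub>Sh_at C\<^esub> g = Id (Sh_at C) F"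
    unfolding is_iso_def by auto
  moreover have "(T, \<phi>, F) \<in> hom (Sh_at C) T F" using \<phi>(1) by (simp add: Sh_at_hom)
  ultimately show ?thesis
    using F T(2) by (intro bexI[of _ g]) (auto simp: is_iso_def atomic_completion_hom hom_def
        atomic_completion_def dual_def)
qed

end

section \<open>The equivalence\<close>

locale small_amalg_category = amalg_category C for C :: "('a, 'b) cat" (structure) +
  fixes \<iota> :: "'b \<Rightarrow> 'u"
  assumes inj_universe: "inj_on \<iota> (Arr C)" and infinite_universe: "infinite (UNIV :: 'u set)"
begin

abbreviation Sh :: "(('a, 'b, 'u) setfun, ('a, 'b, 'u) ntrans) cat" where
  "Sh \<equiv> Sh_at C"

abbreviation Cat :: "(('a, 'b, 'u) setfun, ('a, 'b, 'u) ntrans) cat" where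
  "Cat \<equiv> atomic_completion C"

text \<open>A copy of a(yc/R) over \<open>'u\<close> is fixed for each object together with its
  generator; arrows are measured against these choices.\<close>

definition chosen :: "('a, 'b) ce_obj \<Rightarrow> ('a, 'b, 'u) setfun \<times> 'u" where
  "chosen A = (SOME p. generates (fst A) (snd A) (fst p) (snd p) \<and> extensional_setfun C (fst p))"

definition shobj :: "('a, 'b) ce_obj \<Rightarrow> ('a, 'b, 'u) setfun" where
  "shobj A = fst (chosen A)"

definition gen :: "('a, 'b) ce_obj \<Rightarrow> 'u" where
  "gen A = snd (chosen A)"

lemma generates_chosen:
  assumes "A \<in> ce_objects C"
  shows "generates (fst A) (snd A) (shobj A) (gen A)" "sh_obj (shobj A)" "is_atom Sh (shobj A)"
proof -
  have "(fst A, snd A) \<in> ce_objects C" using assms by simp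
  then obtain T :: "('a, 'b, 'u) setfun" and t
    where "generates (fst A) (snd A) T t" "extensional_setfun C T"
    using exists_generates[OF _ inj_universe infinite_universe] by blast
  then have "\<exists>p :: ('a, 'b, 'u) setfun \<times> 'u.
      generates (fst A) (snd A) (fst p) (snd p) \<and> extensional_setfun C (fst p)" by auto
  from someI_ex[OF this] show g: "generates (fst A) (snd A) (shobj A) (gen A)"
    and s: "sh_obj (shobj A)"
    using generatesD(1) by (auto simp: chosen_def[symmetric] shobj_def gen_def sh_obj_def)
  show "is_atom Sh (shobj A)" by (rule generates_is_atom[OF inj_universe infinite_universe g s])
qed

text \<open>Arrows from \<open>A'\<close> to \<open>A\<close> in \<open>C_e\<close>, arrows between the sheaves in the opposite direction, and
  the admissible images of the generator all correspond to each other.\<close>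

definition elts :: "('a, 'b) ce_obj \<Rightarrow> ('a, 'b) ce_obj \<Rightarrow> 'u set" where
  "elts A' A = {z \<in> Fob (shobj A') (fst A). \<forall>e. snd A e \<subseteq> ev_ker (fst A) (shobj A') z e}"

definition ext_map :: "('a, 'b) ce_obj \<Rightarrow> ('a, 'b) ce_obj \<Rightarrow> 'u \<Rightarrow> 'a \<Rightarrow> 'u \<Rightarrow> 'u" where
  "ext_map A' A z = (SOME \<phi>. sh_map (shobj A) (shobj A') \<phi> \<and> \<phi> (fst A) (gen A) = z)"

abbreviation rep :: "('a, 'b) ce_obj \<Rightarrow> ('a, 'b) ce_obj \<Rightarrow> ('a, 'b) ce_triple \<Rightarrow> 'u \<Rightarrow> bool" where
  "rep A' A \<equiv> represents (fst A') (snd A') (fst A) (shobj A') (gen A')"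

definition cls :: "('a, 'b) ce_obj \<Rightarrow> ('a, 'b) ce_obj \<Rightarrow> 'u \<Rightarrow> ('a, 'b) ce_triple set" where
  "cls A' A z = {t \<in> ce_triples C A' A. rep A' A t z}"

lemma ext_map:
  assumes A: "A' \<in> ce_objects C" "A \<in> ce_objects C" and z: "z \<in> elts A' A"
  shows "sh_map (shobj A) (shobj A') (ext_map A' A z)" "ext_map A' A z (fst A) (gen A) = z"
proof -
  note g = generates_chosen[OF A(2)] and g' = generates_chosen[OF A(1)]
  have "Fmap (shobj A') \<chi> z = Fmap (shobj A') \<xi> z" if "(\<chi>, \<xi>) \<in> snd A e" for e \<chi> \<xi>
    using z that by (force simp: elts_def ev_ker_iff)
  moreover have "z \<in> Fob (shobj A') (fst A)" using z by (simp add: elts_def)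
  ultimately have "\<exists>\<phi>. sh_map (shobj A) (shobj A') \<phi> \<and> \<phi> (fst A) (gen A) = z"
    using generates_map_sh[OF g(1,2) g'(2)] by metis
  from someI_ex[OF this] show "sh_map (shobj A) (shobj A') (ext_map A' A z)"
    "ext_map A' A z (fst A) (gen A) = z" by (simp_all add: ext_map_def)
qed

lemma image_in_elts:
  assumes A: "A' \<in> ce_objects C" "A \<in> ce_objects C" and m: "sh_map (shobj A) (shobj A') \<phi>"
  shows "\<phi> (fst A) (gen A) \<in> elts A' A"
proof -
  note gD = generatesD[OF generates_chosen(1)[OF A(2)]] and mD = sh_mapD[OF m]
  have in_T: "\<phi> (fst A) (gen A) \<in> Fob (shobj A') (fst A)" using nt_map[OF mD(3) gD(4,5)] .
  moreover have "(\<chi>, \<xi>) \<in> ev_ker (fst A) (shobj A') (\<phi> (fst A) (gen A)) e" if "(\<chi>, \<xi>) \<in> snd A e" for \<chi> \<xi> e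
  proof -
    have r: "(\<chi>, \<xi>) \<in> ev_ker (fst A) (shobj A) (gen A) e" using that gD(6) by metis
    then show ?thesis using ev_ker_incl[OF mD(3) gD(5) r] by (simp add: ev_ker_iff)
  qed
  ultimately show ?thesis by (auto simp: elts_def)
qed

lemma ext_map_unique:
  assumes A: "A' \<in> ce_objects C" "A \<in> ce_objects C" and m: "sh_map (shobj A) (shobj A') \<phi>"
  shows "ext_map A' A (\<phi> (fst A) (gen A)) = \<phi>"
  using generates_sh_eq[OF generates_chosen(1)[OF A(2)] ext_map(1)[OF A image_in_elts[OF A m]] m]
    ext_map(2)[OF A image_in_elts[OF A m]] by blast

lemma triple_rep:
  assumes A: "A' \<in> ce_objects C" "A \<in> ce_objects C" and t: "t \<in> ce_triples C A' A"
  shows "\<exists>!z. rep A' A t z" and "rep A' A t z \<Longrightarrow> z \<in> elts A' A"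
proof -
  obtain P Q where PQ: "t = (P, Q)" by (cases t)
  have s: "is_span (fst A') (snd A') (fst A) (snd A) P Q"
    using ce_triples_iff[of "fst A'" "snd A'" "fst A" "snd A" P Q] A t PQ by simp
  note g' = generates_chosen(1)[OF A(1)]
  have c: "fst A \<in> Obj C" using generatesD(4)[OF generates_chosen(1)[OF A(2)]] .
  show "\<exists>!z. rep A' A t z"
    using represents_exists[OF g' c s] represents_unique[OF g' c s] unfolding PQ by metis
  assume "rep A' A t z"
  then have "rep A' A (P, Q) z" by (simp add: PQ)
  note r = representsD(1,2)[OF this]
  show "z \<in> elts A' A" using is_spanD(2)[OF s] r by (simp add: elts_def)
qed

lemma triple_rel_iff:
  assumes A: "A' \<in> ce_objects C" "A \<in> ce_objects C" and t: "t1 \<in> ce_triples C A' A" "t2 \<in> ce_triples C A' A"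
    and r: "rep A' A t1 z1" "rep A' A t2 z2"
  shows "(t1, t2) \<in> ce_triple_rel C A' A \<longleftrightarrow> z1 = z2"
  using ce_triple_rel_iff[of "fst A'" "snd A'" "fst A" "snd A" "shobj A'" "gen A'" "fst t1" "snd t1"
      "fst t2" "snd t2" z1 z2] generates_chosen(1)[OF A(1)] assms by simp

lemma triple_rel_in: "(t1, t2) \<in> ce_triple_rel C A' A \<Longrightarrow> t1 \<in> ce_triples C A' A \<and> t2 \<in> ce_triples C A' A"
  by (auto simp: ce_triple_rel_def)

lemma cls_nonempty:
  assumes A: "A' \<in> ce_objects C" "A \<in> ce_objects C" and z: "z \<in> elts A' A"
  shows "\<exists>t. t \<in> cls A' A z"
proof -
  note g' = generates_chosen(1)[OF A(1)]
  have c: "fst A \<in> Obj C" using generatesD(4)[OF generates_chosen(1)[OF A(2)]] .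
  obtain P Q where "is_span (fst A') (snd A') (fst A) (snd A) P Q" "rep A' A (P, Q) z"
    using span_exists[OF g' c, of z "snd A"] z by (auto simp: elts_def)
  then have "(P, Q) \<in> cls A' A z"
    using ce_triples_iff[of "fst A'" "snd A'" "fst A" "snd A" P Q] A by (simp add: cls_def)
  then show ?thesis by blast
qed

text \<open>Composition and identities of \<open>C_e\<close> are defined by saturating a set of
  representatives. The saturation is known once the set is non-empty and all its members represent
  the same \<open>z\<close>.\<close>

lemma rel_image_cls:
  assumes A: "A' \<in> ce_objects C" "A \<in> ce_objects C" and X: "X \<subseteq> cls A' A z" "X \<noteq> {}"
  shows "ce_triple_rel C A' A `` X = cls A' A z"
proof
  show "ce_triple_rel C A' A `` X \<subseteq> cls A' A z"
  proof
    fix t assume "t \<in> ce_triple_rel C A' A `` X"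
    then obtain s where s: "s \<in> X" "(s, t) \<in> ce_triple_rel C A' A" by blast
    have t: "t \<in> ce_triples C A' A" using triple_rel_in[OF s(2)] by blast
    obtain z' where z': "rep A' A t z'" using triple_rep(1)[OF A t] by blast
    have "s \<in> ce_triples C A' A" "rep A' A s z" using s(1) X(1) by (auto simp: cls_def)
    then have "z = z'" using triple_rel_iff[OF A _ t _ z'] s(2) by blast
    then show "t \<in> cls A' A z" using t z' by (simp add: cls_def)
  qed
  show "cls A' A z \<subseteq> ce_triple_rel C A' A `` X"
  proof
    fix t assume t: "t \<in> cls A' A z"
    obtain s where s: "s \<in> X" using X by blast
    then have "s \<in> ce_triples C A' A" "rep A' A s z" using X(1) by (auto simp: cls_def)
    then have "(s, t) \<in> ce_triple_rel C A' A" using triple_rel_iff[OF A, of s t z z] t by (simp add: cls_def)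
    then show "t \<in> ce_triple_rel C A' A `` X" using s by blast
  qed
qed

lemma cls_inj:
  assumes A: "A' \<in> ce_objects C" "A \<in> ce_objects C" and z: "z \<in> elts A' A"
    and eq: "cls A' A z = cls A' A z'"
  shows "z = z'"
proof -
  obtain t where "t \<in> cls A' A z" using cls_nonempty[OF A z] by blast
  then have "t \<in> ce_triples C A' A" "rep A' A t z" "rep A' A t z'" using eq by (auto simp: cls_def)
  then show ?thesis using triple_rep(1)[OF A] by blast
qed

text \<open>The relation on triples is equality of represented elements, and every admissible
  element is represented, so the classes are the fibres over \<open>elts A' A\<close>.\<close>

lemma classes_eq:
  assumes A: "A' \<in> ce_objects C" "A \<in> ce_objects C"
  shows "ce_triples C A' A // ce_triple_rel C A' A = cls A' A ` elts A' A"
proof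
  show "ce_triples C A' A // ce_triple_rel C A' A \<subseteq> cls A' A ` elts A' A"
  proof
    fix X assume "X \<in> ce_triples C A' A // ce_triple_rel C A' A"
    then obtain t where t: "t \<in> ce_triples C A' A" "X = ce_triple_rel C A' A `` {t}" by (rule quotientE)
    obtain z where z: "rep A' A t z" using triple_rep(1)[OF A t(1)] by blast
    have "X = cls A' A z" using rel_image_cls[OF A, of "{t}" z] t z by (simp add: cls_def)
    then show "X \<in> cls A' A ` elts A' A" using triple_rep(2)[OF A t(1) z] by blast
  qed
  show "cls A' A ` elts A' A \<subseteq> ce_triples C A' A // ce_triple_rel C A' A"
  proof
    fix X assume "X \<in> cls A' A ` elts A' A"
    then obtain z where z: "z \<in> elts A' A" "X = cls A' A z" by blast
    obtain t where t: "t \<in> cls A' A z" using cls_nonempty[OF A z(1)] by blast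
    then have "X = ce_triple_rel C A' A `` {t}" using rel_image_cls[OF A, of "{t}" z] z by simp
    moreover have "t \<in> ce_triples C A' A" using t by (simp add: cls_def)
    ultimately show "X \<in> ce_triples C A' A // ce_triple_rel C A' A" by (simp add: quotientI)
  qed
qed

section \<open>Hom-sets and composition of \<open>C_e\<close> in terms of elements\<close>

lemma C_e_simps [simp]:
  "Obj (C_e C) = ce_objects C" "Dom (C_e C) (A', A, X) = A'" "Cod (C_e C) (A', A, X) = A"
  by (simp_all add: C_e_def)

lemma C_e_hom: "f \<in> hom (C_e C) A' A \<longleftrightarrow>
    A' \<in> ce_objects C \<and> A \<in> ce_objects C \<and> (\<exists>z \<in> elts A' A. f = (A', A, cls A' A z))"
  using classes_eq by (cases f) (auto simp: hom_def C_e_def)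

lemma C_e_homE:
  assumes "f \<in> hom (C_e C) A' A"
  obtains z where "A' \<in> ce_objects C" "A \<in> ce_objects C" "z \<in> elts A' A" "f = (A', A, cls A' A z)"
  using assms unfolding C_e_hom by blast

text \<open>By \<open>represents_comp\<close> every composite of representatives represents the
  image of \<open>z\<close> under the map of sheaves attached to \<open>z'\<close>; saturation then
  returns the whole class.\<close>

lemma C_e_comp:
  assumes A: "A'' \<in> ce_objects C" "A' \<in> ce_objects C" "A \<in> ce_objects C"
    and z: "z \<in> elts A' A" and z': "z' \<in> elts A'' A'"
  shows "(A', A, cls A' A z) \<cdot>\<^bsub>C_e C\<^esub> (A'', A', cls A'' A' z') =
    (A'', A, cls A'' A (ext_map A'' A' z' (fst A) z))"
proof -
  define w where "w = ext_map A'' A' z' (fst A) z"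
  have "ce_comp C A'' A' A t t' \<in> cls A'' A w" if t: "t \<in> cls A' A z" and t': "t' \<in> cls A'' A' z'" for t t'
  proof -
    obtain P Q P' Q' where q: "t = (P, Q)" "t' = (P', Q')" by (cases t; cases t')
    have "is_span (fst A') (snd A') (fst A) (snd A) P Q" "is_span (fst A'') (snd A'') (fst A') (snd A') P' Q'"
      using ce_triples_iff[of "fst A'" "snd A'" "fst A" "snd A" P Q]
        ce_triples_iff[of "fst A''" "snd A''" "fst A'" "snd A'" P' Q'] A t t' q by (simp_all add: cls_def)
    moreover have "rep A' A (P, Q) z" "rep A'' A' (P', Q') z'" using t t' q by (simp_all add: cls_def)
    moreover have "nat_trans C (shobj A') (shobj A'') (ext_map A'' A' z')"
      "ext_map A'' A' z' (fst A') (gen A') = z'"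
      using ext_map[OF A(1,2) z'] sh_mapD(3) by auto
    ultimately have "case ce_comp C (fst A'', snd A'') (fst A', snd A') (fst A, snd A) (P, Q) (P', Q') of
      (P'', Q'') \<Rightarrow> is_span (fst A'') (snd A'') (fst A) (snd A) P'' Q'' \<and> rep A'' A (P'', Q'') w"
      unfolding w_def using A generates_chosen(1)[OF A(1)] generates_chosen(1)[OF A(2)]
      by (intro represents_comp) auto
    then show ?thesis
      using q ce_triples_iff[of "fst A''" "snd A''" "fst A" "snd A"] A
      by (auto simp: cls_def split: prod.splits)
  qed
  then have sub: "{ce_comp C A'' A' A t t' | t t'. t \<in> cls A' A z \<and> t' \<in> cls A'' A' z'} \<subseteq> cls A'' A w" by blast
  have ne: "{ce_comp C A'' A' A t t' | t t'. t \<in> cls A' A z \<and> t' \<in> cls A'' A' z'} \<noteq> {}"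
    using cls_nonempty[OF A(2,3) z] cls_nonempty[OF A(1,2) z'] by blast
  show ?thesis using rel_image_cls[OF A(1,3) sub ne] by (simp add: C_e_def w_def)
qed

lemma gen_in_elts:
  assumes A: "A \<in> ce_objects C"
  shows "gen A \<in> elts A A" "ext_map A A (gen A) = normalise C (shobj A) (\<lambda>e x. x)"
proof -
  note gD = generatesD[OF generates_chosen(1)[OF A]] and m = sh_map_id[OF generates_chosen(2)[OF A]]
  have e: "normalise C (shobj A) (\<lambda>e x. x) (fst A) (gen A) = gen A"
    by (rule normalise_apply[OF gD(4,5)])
  show "gen A \<in> elts A A" "ext_map A A (gen A) = normalise C (shobj A) (\<lambda>e x. x)"
    using image_in_elts[OF A A m] ext_map_unique[OF A A m] unfolding e by auto
qed

lemma C_e_id: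
  assumes A: "A \<in> ce_objects C"
  shows "Id (C_e C) A = (A, A, cls A A (gen A))"
proof -
  define t where "t = (snd A, \<lambda>e. Id_on (Fob (yquot C (fst A) (snd A)) e))"
  have A': "(fst A, snd A) \<in> ce_objects C" using A by simp
  have "t \<in> cls A A (gen A)"
    using ce_identity[OF A' generates_chosen(1)[OF A]] ce_triples_iff[OF A' A']
    by (simp add: cls_def t_def)
  then have "ce_triple_rel C A A `` {t} = cls A A (gen A)" using rel_image_cls[OF A A, of "{t}"] by simp
  then show ?thesis by (simp add: C_e_def t_def)
qed

text \<open>An arrow from \<open>A'\<close> to \<open>A\<close> gives a map of sheaves in the
  opposite direction; the dual in \<open>atomic_completion\<close> restores the direction. The use
  of \<open>THE\<close> is justified by \<open>cls_inj\<close>.\<close>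

definition Fa :: "('a, 'b) ce_arr \<Rightarrow> ('a, 'b, 'u) ntrans" where
  "Fa = (\<lambda>(A', A, X). (shobj A, ext_map A' A (THE z. z \<in> elts A' A \<and> X = cls A' A z), shobj A'))"

lemma Fa_cls:
  assumes A: "A' \<in> ce_objects C" "A \<in> ce_objects C" and z: "z \<in> elts A' A"
  shows "Fa (A', A, cls A' A z) = (shobj A, ext_map A' A z, shobj A')"
proof -
  have "(THE z'. z' \<in> elts A' A \<and> cls A' A z = cls A' A z') = z"
    using z cls_inj[OF A] by (intro the_equality) auto
  then show ?thesis by (simp add: Fa_def)
qed

lemma Fa_bij:
  assumes A: "A' \<in> ce_objects C" "A \<in> ce_objects C"
  shows "bij_betw Fa (hom (C_e C) A' A) (hom Cat (shobj A') (shobj A))"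
  unfolding bij_betw_def
proof
  note g = generates_chosen[OF A(2)] and g' = generates_chosen[OF A(1)]
  show "inj_on Fa (hom (C_e C) A' A)"
  proof (rule inj_onI)
    fix f h assume f: "f \<in> hom (C_e C) A' A" and h: "h \<in> hom (C_e C) A' A" and eq: "Fa f = Fa h"
    obtain z where z: "z \<in> elts A' A" "f = (A', A, cls A' A z)" using f by (rule C_e_homE)
    obtain w where w: "w \<in> elts A' A" "h = (A', A, cls A' A w)" using h by (rule C_e_homE)
    have "ext_map A' A z = ext_map A' A w" using eq Fa_cls[OF A] z w by simp
    then have "z = w" using ext_map(2)[OF A z(1)] ext_map(2)[OF A w(1)] by metis
    then show "f = h" using z w by simp
  qed
  show "Fa ` hom (C_e C) A' A = hom Cat (shobj A') (shobj A)"
  proof (intro equalityI subsetI)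
    fix f assume "f \<in> Fa ` hom (C_e C) A' A"
    then obtain z where z: "z \<in> elts A' A" "f = Fa (A', A, cls A' A z)" by (auto elim: C_e_homE)
    then show "f \<in> hom Cat (shobj A') (shobj A)"
      using ext_map(1)[OF A z(1)] Fa_cls[OF A z(1)] g(3) g'(3) by (simp add: atomic_completion_hom Sh_at_hom)
  next
    fix f assume "f \<in> hom Cat (shobj A') (shobj A)"
    then obtain \<phi> where \<phi>: "f = (shobj A, \<phi>, shobj A')" "sh_map (shobj A) (shobj A') \<phi>"
      by (auto simp: atomic_completion_hom Sh_at_hom)
    define z where "z = \<phi> (fst A) (gen A)"
    have z: "z \<in> elts A' A" "ext_map A' A z = \<phi>"
      unfolding z_def by (rule image_in_elts[OF A \<phi>(2)], rule ext_map_unique[OF A \<phi>(2)])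
    then have "f = Fa (A', A, cls A' A z)" using Fa_cls[OF A z(1)] \<phi>(1) by simp
    moreover have "(A', A, cls A' A z) \<in> hom (C_e C) A' A" using A z(1) by (auto simp: C_e_hom)
    ultimately show "f \<in> Fa ` hom (C_e C) A' A" by blast
  qed
qed

text \<open>The composite of the two sheaf maps sends the generator of \<open>shobj A\<close> to
  \<open>w\<close>, and a map out of \<open>shobj A\<close> is determined by that value.\<close>

lemma comp_elts:
  assumes A: "A'' \<in> ce_objects C" "A' \<in> ce_objects C" "A \<in> ce_objects C"
    and z: "z \<in> elts A' A" and z': "z' \<in> elts A'' A'"
  defines "w \<equiv> ext_map A'' A' z' (fst A) z"
  shows "w \<in> elts A'' A"
    "ext_map A'' A w = normalise C (shobj A) (\<lambda>e x. ext_map A'' A' z' e (ext_map A' A z e x))"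
proof -
  note gD = generatesD[OF generates_chosen(1)[OF A(3)]]
  note m = sh_map_comp[OF ext_map(1)[OF A(2,3) z] ext_map(1)[OF A(1,2) z']]
  have "normalise C (shobj A) (\<lambda>e x. ext_map A'' A' z' e (ext_map A' A z e x)) (fst A) (gen A) = w"
    using normalise_apply[OF gD(4,5)] ext_map(2)[OF A(2,3) z] by (simp add: w_def)
  then show "w \<in> elts A'' A"
    "ext_map A'' A w = normalise C (shobj A) (\<lambda>e x. ext_map A'' A' z' e (ext_map A' A z e x))"
    using image_in_elts[OF A(1,3) m] ext_map_unique[OF A(1,3) m] by simp_all
qed

lemma C_e_comp_hom:
  assumes f: "f \<in> hom (C_e C) A'' A'" and h: "h \<in> hom (C_e C) A' A"
  shows "h \<cdot>\<^bsub>C_e C\<^esub> f \<in> hom (C_e C) A'' A" "Fa (h \<cdot>\<^bsub>C_e C\<^esub> f) = Fa h \<cdot>\<^bsub>Cat\<^esub> Fa f"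
proof -
  have A: "A'' \<in> ce_objects C" "A' \<in> ce_objects C" "A \<in> ce_objects C"
    using f h by (auto elim: C_e_homE)
  obtain z where z: "z \<in> elts A' A" "h = (A', A, cls A' A z)" using h by (rule C_e_homE)
  obtain z' where z': "z' \<in> elts A'' A'" "f = (A'', A', cls A'' A' z')" using f by (rule C_e_homE)
  note c = C_e_comp[OF A z(1) z'(1)] and w = comp_elts[OF A z(1) z'(1)]
  show "h \<cdot>\<^bsub>C_e C\<^esub> f \<in> hom (C_e C) A'' A" unfolding z(2) z'(2) c using A w(1) by (auto simp: C_e_hom)
  show "Fa (h \<cdot>\<^bsub>C_e C\<^esub> f) = Fa h \<cdot>\<^bsub>Cat\<^esub> Fa f"
    unfolding z(2) z'(2) c
    using Fa_cls[OF A(1,3) w(1)] Fa_cls[OF A(2,3) z(1)] Fa_cls[OF A(1,2) z'(1)] w(2) by simp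
qed

lemma Fa_id:
  assumes A: "A \<in> ce_objects C"
  shows "Fa (Id (C_e C) A) = Id Cat (shobj A)"
  unfolding C_e_id[OF A] Fa_cls[OF A A gen_in_elts(1)[OF A]] gen_in_elts(2)[OF A] by simp

lemma Fa_hom:
  assumes f: "f \<in> hom (C_e C) A' A"
  shows "Fa f \<in> hom Cat (shobj A') (shobj A)"
proof -
  have "A' \<in> ce_objects C" "A \<in> ce_objects C" using f by (auto elim: C_e_homE)
  from bij_betw_apply[OF Fa_bij[OF this] f] show ?thesis .
qed

text \<open>The laws come from the atomic completion through \<open>Fa\<close>, which is injective
  on hom-sets by \<open>Fa_bij\<close>.\<close>

lemma category_C_e: "category (C_e C)"
proof (rule category_if_faithful[OF category_atomic_completion])
  fix f assume "f \<in> Arr (C_e C)"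
  then show "Dom (C_e C) f \<in> Obj (C_e C) \<and> Cod (C_e C) f \<in> Obj (C_e C)"
    by (auto simp: C_e_def)
next
  fix A assume "A \<in> Obj (C_e C)"
  then have A: "A \<in> ce_objects C" by simp
  show "Id (C_e C) A \<in> hom (C_e C) A A" using A gen_in_elts(1)[OF A] by (auto simp: C_e_id C_e_hom)
  show "Fa (Id (C_e C) A) = Id Cat (shobj A)" by (rule Fa_id[OF A])
next
  fix f A' A assume "f \<in> hom (C_e C) A' A"
  then show "Fa f \<in> hom Cat (shobj A') (shobj A)" by (rule Fa_hom)
next
  fix A' A
  show "inj_on Fa (hom (C_e C) A' A)"
  proof (cases "A' \<in> ce_objects C \<and> A \<in> ce_objects C")
    case True then show ?thesis using Fa_bij by (auto simp: bij_betw_def)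
  next
    case False then have "hom (C_e C) A' A = {}" by (auto simp: C_e_hom)
    then show ?thesis by simp
  qed
qed (fact C_e_comp_hom)+

lemma weakly_equivalent_C_e: "weakly_equivalent (C_e C) Cat"
  unfolding weakly_equivalent_def
proof (intro conjI exI[of _ shobj] exI[of _ Fa] ballI)
  show "category (C_e C)" "category Cat" by (rule category_C_e, rule category_atomic_completion)
  show "is_functor (C_e C) Cat shobj Fa"
    unfolding is_functor_def
  proof (intro conjI ballI impI)
    fix A assume "A \<in> Obj (C_e C)"
    then show "shobj A \<in> Obj Cat" "Fa (Id (C_e C) A) = Id Cat (shobj A)"
      using generates_chosen by (auto simp: Fa_id)
  next
    fix f assume "f \<in> Arr (C_e C)"
    then have f: "f \<in> hom (C_e C) (Dom (C_e C) f) (Cod (C_e C) f)" by (simp add: hom_def)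
    then show "Fa f \<in> hom Cat (shobj (Dom (C_e C) f)) (shobj (Cod (C_e C) f))"
      by (rule Fa_hom)
    fix h assume "h \<in> Arr (C_e C)" "Cod (C_e C) f = Dom (C_e C) h"
    then have "h \<in> hom (C_e C) (Cod (C_e C) f) (Cod (C_e C) h)" by (simp add: hom_def)
    from C_e_comp_hom(2)[OF f this] show "Fa (h \<cdot>\<^bsub>C_e C\<^esub> f) = Fa h \<cdot>\<^bsub>Cat\<^esub> Fa f" .
  qed
next
  fix A' A assume "A' \<in> Obj (C_e C)" "A \<in> Obj (C_e C)"
  then show "bij_betw Fa (hom (C_e C) A' A) (hom Cat (shobj A') (shobj A))" using Fa_bij by simp
next
  fix F assume "F \<in> Obj Cat"
  then have F: "sh_obj F" "is_atom Sh F" by simp_all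
  \<comment> \<open>An atom is not initial, so it has an element \<open>x\<close> over some
    \<open>c\<close>; the object of \<open>C_e\<close> sought is \<open>c\<close> with the kernel of
    \<open>x\<close>.\<close>
  then obtain c x where x: "x \<in> Fob F c" by (auto simp: is_atom_def is_initial_Sh_at)
  have c: "c \<in> Obj C" using sh_obj_Fob[OF F(1) x] .
  have "at_sheaf F" using F(1) by (simp add: sh_obj_def)
  define A where "A = (c, ev_ker c F x)"
  have A: "A \<in> ce_objects C"
    using closed_ev_ker[OF at_sheafD[OF \<open>at_sheaf F\<close>] x] c by (simp add: ce_objects_def A_def)
  have "\<exists>f \<in> hom Cat (shobj A) F. is_iso Cat f"
    using atom_iso_generated[OF F(2) x] generates_chosen[OF A] by (simp add: A_def)
  then show "\<exists>A \<in> Obj (C_e C). \<exists>f \<in> hom Cat (shobj A) F. is_iso Cat f" using A by auto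
qed

end

theorem theorem4p15:
  fixes C :: "('o, 'm) cat" and \<iota> :: "'m \<Rightarrow> 'u"
  assumes "category C"
    and "inj_on \<iota> (Arr C)" and "infinite (UNIV :: 'u set)"
    and "amalgamation_property C"
    and "\<forall>f \<in> Arr C. strict_monomorphism C f"
  shows "weakly_equivalent (C_e C)
    (atomic_completion C :: (('o, 'm, 'u) setfun, ('o, 'm, 'u) ntrans) cat)"
proof -
  interpret category C by fact
  interpret small_amalg_category C \<iota>
    by unfold_locales (use assms in auto)
  show ?thesis by (rule weakly_equivalent_C_e)
qed

end
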